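(* Let $G_1$ and $G_2$ be two finite simple graphs on the disjoint vertex sets $\{x_1,\ldots,x_n\}$ and $\{y_1,\ldots,y_m\}$, respectively, and let $r$ be a positive integer. Then the $\mathbb N$-graded Betti numbers of $R_{G_1*G_2}/I_r(G_1*G_2)$ are given, for $i\ge 0$, as follows. For $d=r$, $$\beta_{i,i+d}(R_{G_1*G_2}/I_r(G_1*G_2))=\sum_{j=0}^{i+d-1}\left\{\binom{m}{j}\beta_{i-j,i-j+d}(R_{G_1}/I_r(G_1))+\binom{n}{j}\beta_{i-j,i-j+d}(R_{G_2}/I_r(G_2))\right\}+\sum_{j=1}^{i+d-1}\left[\binom{i+d-1}{d}-\binom{i+d-1-j}{d}-\binom{j-1}{d}\right]\binom{m}{j}\binom{n}{i+d-j},$$ and for $d\ge r+1$, $$\beta_{i,i+d}(R_{G_1*G_2}/I_r(G_1*G_2))=\sum_{j=0}^{i+d-1}\left\{\binom{m}{j}\beta_{i-j,i-j+d}(R_{G_1}/I_r(G_1))+\binom{n}{j}\beta_{i-j,i-j+d}(R_{G_2}/I_r(G_2))\right\}.$$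
   Context: $\mathbb K$ is a field. For a finite simple graph $G$ with vertex set $V(G)$, $R_G$ is the polynomial ring over $\mathbb K$ whose variables are the vertices of $G$ (standard grading). For a positive integer $r$, $I_r(G)\subseteq R_G$ is the square-free monomial ideal generated by the monomials $\prod_{x\in A}x$, where $A$ ranges over all subsets $A\subseteq V(G)$ with $|A|=r+1$ such that the induced subgraph $G[A]$ is connected ($I_r(G)=0$ if there are none). The join $G_1*G_2$ of graphs with disjoint vertex sets has vertex set $V(G_1)\sqcup V(G_2)$ and edge set $E(G_1)\cup E(G_2)\cup\{\{x,y\}\mid x\in V(G_1),\,y\in V(G_2)\}$. $\beta_{i,j}(R/I)$ denotes the $(i,j)$-th graded Betti number, i.e. the multiplicity of $R(-j)$ in homological degree $i$ of the graded minimal free resolution of $R/I$; it is $0$ if $i<0$. Binomial coefficients $\binom{a}{b}$ are $0$ when $b>a\ge 0$. *)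

theory Defs
  imports
    "HOL-Library.Poly_Mapping"
    "Graph_Theory.Digraph_Component"
    "Jordan_Normal_Form.Matrix"
begin

text \<open>
  Finite simple graphs are taken from Graph\_Theory: \<open>pair_graph G\<close> says that \<open>pverts G\<close> is finite
  and that \<open>parcs G\<close> is a symmetric, irreflexive relation on \<open>pverts G\<close>; an edge \<open>{x, y}\<close> is
  the pair of arcs \<open>(x, y)\<close>, \<open>(y, x)\<close>.
\<close>

definition graph_join :: "'v pair_pre_digraph \<Rightarrow> 'v pair_pre_digraph \<Rightarrow> 'v pair_pre_digraph" where
  "graph_join G H =
     \<lparr> pverts = pverts G \<union> pverts H,
       parcs = parcs G \<union> parcs H \<union> pverts G \<times> pverts H \<union> pverts H \<times> pverts G \<rparr>"

text \<open>
  A polynomial maps monomials (exponent vectors) to coefficients. The type has every element of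
  \<open>'v\<close> as a variable; \<open>poly_ring V\<close> is the subring of polynomials in the variables \<open>V\<close>.
\<close>

type_synonym ('v, 'k) mpoly = "('v \<Rightarrow>\<^sub>0 nat) \<Rightarrow>\<^sub>0 'k"

definition poly_ring :: "'v set \<Rightarrow> ('v, 'k::field) mpoly set" where
  "poly_ring V = {p. \<forall>m\<in>Poly_Mapping.keys p. Poly_Mapping.keys m \<subseteq> V}"

definition indet :: "'v \<Rightarrow> ('v, 'k::field) mpoly" where
  "indet x = Poly_Mapping.single (Poly_Mapping.single x 1) 1"

definition mon_degree :: "('v \<Rightarrow>\<^sub>0 nat) \<Rightarrow> nat" where
  "mon_degree m = (\<Sum>x\<in>Poly_Mapping.keys m. Poly_Mapping.lookup m x)"

text \<open>The zero polynomial is homogeneous of every degree, and the only one of negative degree.\<close>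

definition homogeneous :: "int \<Rightarrow> ('v, 'k::field) mpoly \<Rightarrow> bool" where
  "homogeneous d p \<longleftrightarrow> (\<forall>m\<in>Poly_Mapping.keys p. int (mon_degree m) = d)"

definition irrelevant_ideal :: "'v set \<Rightarrow> ('v, 'k::field) mpoly set" where
  "irrelevant_ideal V = {p \<in> poly_ring V. Poly_Mapping.lookup p 0 = 0}"

definition ideal_gen :: "'v set \<Rightarrow> ('v, 'k::field) mpoly set \<Rightarrow> ('v, 'k) mpoly set" where
  "ideal_gen V S =
     {(\<Sum>s\<in>T. c s * s) | T c. finite T \<and> T \<subseteq> S \<and> (\<forall>s\<in>T. c s \<in> poly_ring V)}"

definition conn_ideal :: "nat \<Rightarrow> 'v pair_pre_digraph \<Rightarrow> ('v, 'k::field) mpoly set" where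
  "conn_ideal r G = ideal_gen (pverts G)
     {(\<Prod>x\<in>A. indet x) | A. A \<subseteq> pverts G \<and> card A = r + 1 \<and>
        Digraph_Component.connected (with_proj G \<restriction> A)}"

text \<open>
  With \<open>R = poly_ring V\<close>, a value of the following type encodes
  \<open>\<dots> \<rightarrow> F\<^sub>2 \<rightarrow> F\<^sub>1 \<rightarrow> F\<^sub>0 \<rightarrow> R/I\<close>. The module \<open>F\<^sub>i\<close> is the direct sum of the
  \<open>R(- shift i b)\<close> for \<open>b < rnk i\<close>, with elements written as column vectors; \<open>bd i\<close> is the matrix
  of \<open>F\<^bsub>i+1\<^esub> \<rightarrow> F\<^sub>i\<close>, and \<open>aug\<close> lists representatives in \<open>R\<close> of the images in
  \<open>R/I\<close> of the basis of \<open>F\<^sub>0\<close>.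
\<close>

record (overloaded) ('v, 'k) resolution =
  rnk :: "nat \<Rightarrow> nat"
  shift :: "nat \<Rightarrow> nat \<Rightarrow> int"
  bd :: "nat \<Rightarrow> ('v, 'k) mpoly mat"
  aug :: "('v, 'k) mpoly vec"

definition free_mod :: "'v set \<Rightarrow> nat \<Rightarrow> ('v, 'k::field) mpoly vec set" where
  "free_mod V n = {f \<in> carrier_vec n. \<forall>a<n. f $ a \<in> poly_ring V}"

definition graded_maps :: "'v set \<Rightarrow> ('v, 'k::field) resolution \<Rightarrow> bool" where
  "graded_maps V F \<longleftrightarrow>
     aug F \<in> free_mod V (rnk F 0) \<and>
     (\<forall>a<rnk F 0. homogeneous (shift F 0 a) (aug F $ a)) \<and>
     (\<forall>i. bd F i \<in> carrier_mat (rnk F i) (rnk F (Suc i)) \<and>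
       (\<forall>a<rnk F i. \<forall>b<rnk F (Suc i).
          bd F i $$ (a, b) \<in> poly_ring V \<and>
          homogeneous (shift F (Suc i) b - shift F i a) (bd F i $$ (a, b))))"

definition exact_resolution ::
  "'v set \<Rightarrow> ('v, 'k::field) mpoly set \<Rightarrow> ('v, 'k) resolution \<Rightarrow> bool" where
  "exact_resolution V I F \<longleftrightarrow>
     (\<forall>p\<in>poly_ring V. \<exists>f\<in>free_mod V (rnk F 0). p - scalar_prod (aug F) f \<in> I) \<and>
     {f \<in> free_mod V (rnk F 0). scalar_prod (aug F) f \<in> I}
       = (\<lambda>g. bd F 0 *\<^sub>v g) ` free_mod V (rnk F 1) \<and>
     (\<forall>i. {f \<in> free_mod V (rnk F (Suc i)). bd F i *\<^sub>v f = 0\<^sub>v (rnk F i)}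
       = (\<lambda>g. bd F (Suc i) *\<^sub>v g) ` free_mod V (rnk F (Suc (Suc i))))"

definition minimal_maps :: "'v set \<Rightarrow> ('v, 'k::field) resolution \<Rightarrow> bool" where
  "minimal_maps V F \<longleftrightarrow>
     (\<forall>i. \<forall>a<rnk F i. \<forall>b<rnk F (Suc i). bd F i $$ (a, b) \<in> irrelevant_ideal V)"

definition min_graded_free_res ::
  "'v set \<Rightarrow> ('v, 'k::field) mpoly set \<Rightarrow> ('v, 'k) resolution \<Rightarrow> bool" where
  "min_graded_free_res V I F \<longleftrightarrow> graded_maps V F \<and> exact_resolution V I F \<and> minimal_maps V F"

text \<open>
  For finite \<open>V\<close> and a homogeneous ideal \<open>I\<close> a minimal graded free resolution of \<open>R/I\<close> exists and
  is unique up to isomorphism of graded complexes, so the choice below does not affect the number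
  of summands \<open>R(-j)\<close>.
\<close>

definition betti :: "'v set \<Rightarrow> ('v, 'k::field) mpoly set \<Rightarrow> int \<Rightarrow> int \<Rightarrow> nat" where
  "betti V I i j =
     (if i < 0 then 0
      else let F = (SOME F. min_graded_free_res V I F)
           in card {b. b < rnk F (nat i) \<and> shift F (nat i) b = j})"

text \<open>The type argument selects the coefficient field, which \<open>G\<close> does not determine.\<close>

definition graph_betti ::
  "'k::field itself \<Rightarrow> nat \<Rightarrow> 'v pair_pre_digraph \<Rightarrow> int \<Rightarrow> int \<Rightarrow> nat" where
  "graph_betti _ r G = betti (pverts G) (conn_ideal r G :: ('v, 'k) mpoly set)"

end

theory Submission
  imports Defs "HOL-Library.Function_Algebras"
begin

text \<open>
  Let \<open>\<Delta>\<close> be the simplicial complex of vertex sets that contain no connected set of \<open>r + 1\<close>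
  vertices, so that \<open>I\<^sub>r(G)\<close> is its Stanley--Reisner ideal. By Hochster's formula
  \<open>\<beta>\<^bsub>i,i+d\<^esub>\<close> is the sum, over the vertex sets \<open>W\<close> with \<open>i + d\<close> elements, of the dimensions of
  the reduced cohomology of \<open>\<Delta>\<close> restricted to \<open>W\<close> in degree \<open>d - 1\<close>. The complex of a join is
  \<open>\<Delta>\<^sub>1 \<union> \<Delta>\<^sub>2\<close> together with all sets of at most \<open>r\<close> vertices. In degrees above \<open>r - 1\<close>
  its cohomology is therefore the direct sum of those of \<open>\<Delta>\<^sub>1\<close> and \<open>\<Delta>\<^sub>2\<close>; in degree \<open>r - 1\<close>
  the difference is a count of cochains of full simplices, which gives the binomial correction term.

  Hochster's formula comes from Koszul homology. If \<open>F\<close> is free, \<open>F \<rightarrow> N'\<close> is onto and its kernel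
  \<open>N\<close> lies in \<open>\<mm>F\<close>, then \<open>H\<^sub>p(N) \<cong> H\<^bsub>p+1\<^esub>(N')\<close>; so along a minimal resolution the number of
  generators of the \<open>i\<close>-th syzygy module is the dimension of \<open>H\<^bsub>i-1\<^esub>(I)\<close>. The latter splits by
  multidegree, and a cone argument kills all multidegrees that are not squarefree. As the total
  dimension is thus finite, the same shift together with graded Nakayama also constructs a minimal
  resolution, without Hilbert's basis theorem.
\<close>

section \<open>Dimensions of quotients\<close>

text \<open>Betti numbers are read off one resolution picked by \<open>SOME\<close>, so two facts
  are needed: a minimal resolution exists, and all of them have the same numbers of summands. Both
  come from the dimensions \<open>khom\<close>, which do not mention a resolution. No quotient space
  is ever formed. \<open>has_qdim s Z B n\<close> exhibits a basis of Z modulo B, and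
  \<open>has_qdim_transfer\<close> replaces the isomorphism theorems; a connecting isomorphism
  becomes one space with two linear maps out of it. The obstacle in the join is the signs: the
  coboundary on W and the one on its part in a single graph count vertices in different complements.
  Numbering the first graph before the second makes the two agree up to one constant factor. The
  binomials of the correction arise as follows. If every r-set of a nonempty U is a face, then the
  coboundaries of size r have codimension \<open>(card U - 1) choose r\<close> in all cochains.
  Cochains modulo cocycles are additive over the two sides, and subtracting this additive part for
  W, W1 and W2 leaves the difference of three binomials.\<close>

definition has_qdim :: "('k::field \<Rightarrow> 'b::ab_group_add \<Rightarrow> 'b) \<Rightarrow> 'b set \<Rightarrow> 'b set \<Rightarrow> nat \<Rightarrow> bool" where
  "has_qdim s Z B n \<longleftrightarrow> (\<exists>b. (\<forall>i<n. b i \<in> Z) \<and>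
     (\<forall>z\<in>Z. \<exists>c. z - (\<Sum>i<n. s (c i) (b i)) \<in> B) \<and>
     (\<forall>c. (\<Sum>i<n. s (c i) (b i)) \<in> B \<longrightarrow> (\<forall>i<n. c i = 0)))"

text \<open>Gaussian elimination, one equation at a time: unless the last equation is void, one
  unknown \<open>i0\<close> is solved for and substituted into the remaining equations.\<close>

lemma homogeneous_system_nontrivial:
  fixes C :: "'i \<Rightarrow> nat \<Rightarrow> 'k::field"
  assumes "finite I" "m < card I"
  shows "\<exists>x. (\<exists>i\<in>I. x i \<noteq> 0) \<and> (\<forall>j<m. (\<Sum>i\<in>I. x i * C i j) = 0)"
  using assms
proof (induction m arbitrary: I C)
  case 0
  then obtain i where "i \<in> I" by fastforce
  then show ?case by (intro exI[of _ "\<lambda>_. 1"]) auto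
next
  case (Suc m)
  show ?case
  proof (cases "\<forall>i\<in>I. C i m = 0")
    case True
    from Suc.IH[of I C] Suc.prems obtain x where "\<exists>i\<in>I. x i \<noteq> 0"
      "\<forall>j<m. (\<Sum>i\<in>I. x i * C i j) = 0" by auto
    with True show ?thesis by (intro exI[of _ x]) (auto simp: less_Suc_eq)
  next
    case False
    then obtain i0 where i0: "i0 \<in> I" "C i0 m \<noteq> 0" by auto
    define I' where "I' = I - {i0}"
    define C' where "C' i j = C i j - C i m / C i0 m * C i0 j" for i j
    have fin: "finite I'" and I: "I = insert i0 I'" "i0 \<notin> I'" and "m < card I'"
      using i0 Suc.prems by (auto simp: I'_def)
    from Suc.IH[of I' C'] fin \<open>m < card I'\<close> obtain x where x: "\<exists>i\<in>I'. x i \<noteq> 0"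
      "\<And>j. j<m \<Longrightarrow> (\<Sum>i\<in>I'. x i * C' i j) = 0" by auto
    \<comment> \<open>The value that the last equation forces on the unknown
      \<open>i0\<close>.\<close>
    define a where "a = - (\<Sum>i\<in>I'. x i * C i m / C i0 m)"
    define y where "y = x(i0 := a)"
    have sum_y: "(\<Sum>i\<in>I. y i * C i j) = a * C i0 j + (\<Sum>i\<in>I'. x i * C i j)" for j
    proof -
      have "(\<Sum>i\<in>I'. y i * C i j) = (\<Sum>i\<in>I'. x i * C i j)"
        using I by (intro sum.cong) (auto simp: y_def)
      then show ?thesis using fin I by (simp add: y_def)
    qed
    have "(\<Sum>i\<in>I. y i * C i j) = (\<Sum>i\<in>I'. x i * C' i j)" for j
      unfolding sum_y a_def C'_def
      by (simp add: sum_distrib_right sum_distrib_left algebra_simps sum_subtractf sum_negf)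
    moreover have "(\<Sum>i\<in>I'. x i * C' i m) = 0" using i0 by (simp add: C'_def)
    moreover have "\<exists>i\<in>I. y i \<noteq> 0" using x(1) I by (auto simp: y_def)
    ultimately show ?thesis using x(2) by (intro exI[of _ y]) (auto simp: less_Suc_eq)
  qed
qed

context
  fixes s :: "'k::field \<Rightarrow> 'b::ab_group_add \<Rightarrow> 'b"
  assumes vs: "vector_space s"
begin

interpretation vector_space s by (rule vs)

text \<open>Exchange argument modulo B. Writing each \<open>a i\<close> in terms of the
  \<open>b j\<close> turns a relation among the \<open>a i\<close> into m equations in n unknowns;
  for n > m a nontrivial solution would contradict independence.\<close>

lemma qdim_le:
  fixes n m :: nat
  assumes B: "subspace B"
    and a: "\<And>i. i < n \<Longrightarrow> a i \<in> Z" "\<And>c. (\<Sum>i<n. s (c i) (a i)) \<in> B \<Longrightarrow> \<forall>i<n. c i = 0"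
    and b: "\<And>z. z \<in> Z \<Longrightarrow> \<exists>c. z - (\<Sum>i<m. s (c i) (b i)) \<in> B"
  shows "n \<le> m"
proof (rule ccontr)
  assume "\<not> n \<le> m"
  have "\<exists>c. i < n \<longrightarrow> a i - (\<Sum>j<m. s (c j) (b j)) \<in> B" for i
    using a(1) b by blast
  then obtain C where C: "\<And>i. i < n \<Longrightarrow> a i - (\<Sum>j<m. s (C i j) (b j)) \<in> B" by metis
  from homogeneous_system_nontrivial[of "{..<n}" m C] \<open>\<not> n \<le> m\<close> obtain x where
    x: "\<exists>i<n. x i \<noteq> 0" "\<And>j. j < m \<Longrightarrow> (\<Sum>i<n. x i * C i j) = 0" by auto
  have "(\<Sum>i<n. s (x i) (a i - (\<Sum>j<m. s (C i j) (b j)))) \<in> B"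
    using B C by (intro subspace_sum subspace_scale) auto
  also have "(\<Sum>i<n. s (x i) (a i - (\<Sum>j<m. s (C i j) (b j)))) =
      (\<Sum>i<n. s (x i) (a i)) - (\<Sum>i<n. \<Sum>j<m. s (x i * C i j) (b j))"
    by (simp add: scale_right_diff_distrib sum_subtractf scale_sum_right)
  also have "(\<Sum>i<n. \<Sum>j<m. s (x i * C i j) (b j)) = (\<Sum>j<m. s (\<Sum>i<n. x i * C i j) (b j))"
    by (subst sum.swap) (simp add: scale_sum_left)
  also have "\<dots> = 0" using x(2) by (intro sum.neutral) auto
  finally have "(\<Sum>i<n. s (x i) (a i)) \<in> B" by simp
  with a(2) x(1) show False by blast
qed

lemma has_qdim_unique:
  assumes "subspace B" "has_qdim s Z B n" "has_qdim s Z B m"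
  shows "n = m"
proof -
  have "n \<le> m" if "has_qdim s Z B n" "has_qdim s Z B m" for n m
  proof -
    from that(1) obtain a where a: "\<forall>i<n. a i \<in> Z"
      "\<forall>c. (\<Sum>i<n. s (c i) (a i)) \<in> B \<longrightarrow> (\<forall>i<n. c i = 0)" unfolding has_qdim_def by blast
    from that(2) obtain b where b: "\<forall>z\<in>Z. \<exists>c. z - (\<Sum>i<m. s (c i) (b i)) \<in> B"
      unfolding has_qdim_def by blast
    show "n \<le> m" 
    proof (rule qdim_le[OF assms(1), where n=n and a=a and Z=Z and m=m and b=b])
      fix i assume "i < n" then show "a i \<in> Z" using a(1) by blast
    next
      fix c assume "(\<Sum>i<n. s (c i) (a i)) \<in> B" then show "\<forall>i<n. c i = 0" using a(2) by blast
    next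
      fix z assume "z \<in> Z" then show "\<exists>c. z - (\<Sum>i<m. s (c i) (b i)) \<in> B" using b by blast
    qed
  qed
  with assms(2,3) show ?thesis by (simp add: antisym)
qed

lemma has_qdim_self: "subspace Z \<Longrightarrow> has_qdim s Z Z 0"
  unfolding has_qdim_def by simp

text \<open>Additivity of dimension along B, Z, C: a basis of Z modulo B is followed by lifts of a
  basis of C modulo Z.\<close>

lemma has_qdim_chain:
  assumes Z: "subspace Z" "subspace B" "B \<subseteq> Z" "Z \<subseteq> C" and "subspace C"
    and "has_qdim s Z B n" "has_qdim s C Z m"
  shows "has_qdim s C B (n + m)"
proof -
  from assms(6) obtain b where b: "\<And>i. i<n \<Longrightarrow> b i \<in> Z"
    "\<And>z. z \<in> Z \<Longrightarrow> \<exists>c. z - (\<Sum>i<n. s (c i) (b i)) \<in> B"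
    "\<And>c. (\<Sum>i<n. s (c i) (b i)) \<in> B \<Longrightarrow> \<forall>i<n. c i = 0" unfolding has_qdim_def by blast
  from assms(7) obtain a where a: "\<And>i. i<m \<Longrightarrow> a i \<in> C"
    "\<And>z. z \<in> C \<Longrightarrow> \<exists>c. z - (\<Sum>i<m. s (c i) (a i)) \<in> Z"
    "\<And>c. (\<Sum>i<m. s (c i) (a i)) \<in> Z \<Longrightarrow> \<forall>i<m. c i = 0" unfolding has_qdim_def by blast
  define d where "d i = (if i < n then b i else a (i - n))" for i
  have split: "(\<Sum>i<n+m. s (c i) (d i)) = (\<Sum>i<n. s (c i) (b i)) + (\<Sum>i<m. s (c (n + i)) (a i))" for c
  proof -
    have "(\<Sum>i<n+m. s (c i) (d i)) = (\<Sum>i<n. s (c i) (d i)) + (\<Sum>i=n..<n+m. s (c i) (d i))"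
      by (metis lessThan_atLeast0 le_add1 sum.atLeastLessThan_concat zero_le)
    also have "(\<Sum>i=n..<n+m. s (c i) (d i)) = (\<Sum>i<m. s (c (n + i)) (d (n + i)))"
      using sum.shift_bounds_nat_ivl[of "\<lambda>i. s (c i) (d i)" 0 n m]
      by (simp add: lessThan_atLeast0 add.commute)
    finally show ?thesis by (simp add: d_def)
  qed
  show ?thesis unfolding has_qdim_def
  proof (intro exI[of _ d] conjI allI impI ballI)
    fix i assume "i < n + m"
    then show "d i \<in> C" using a(1) b(1) Z(4) by (auto simp: d_def)
  next
    fix z assume "z \<in> C"
    then obtain c where c: "z - (\<Sum>i<m. s (c i) (a i)) \<in> Z" using a(2) by blast
    then obtain e where e: "z - (\<Sum>i<m. s (c i) (a i)) - (\<Sum>i<n. s (e i) (b i)) \<in> B"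
      using b(2) by blast
    show "\<exists>c. z - (\<Sum>i<n+m. s (c i) (d i)) \<in> B"
      unfolding split using e
      by (intro exI[of _ "\<lambda>i. if i < n then e i else c (i - n)"]) (simp add: algebra_simps)
  next
    fix c i assume *: "(\<Sum>i<n + m. s (c i) (d i)) \<in> B" and "i < n + m"
    have bZ: "(\<Sum>i<n. s (c i) (b i)) \<in> Z" using b(1) Z by (intro subspace_sum subspace_scale) auto
    have "(\<Sum>i<n + m. s (c i) (d i)) - (\<Sum>i<n. s (c i) (b i)) \<in> Z"
      using * bZ Z by (intro subspace_diff) auto
    then have "(\<Sum>i<m. s (c (n + i)) (a i)) \<in> Z" unfolding split by simp
    then have c0: "\<forall>i<m. c (n + i) = 0" using a(3)[of "\<lambda>i. c (n + i)"] by simp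
    then have "(\<Sum>i<m. s (c (n + i)) (a i)) = 0" by (intro sum.neutral) auto
    with * have "(\<Sum>i<n. s (c i) (b i)) \<in> B" unfolding split by simp
    then have "\<forall>i<n. c i = 0" using b(3) by blast
    with c0 \<open>i < n + m\<close> show "c i = 0"
      by (metis add_diff_inverse_nat nat_add_left_cancel_less)
  qed
qed

text \<open>A longest sequence in Z that is independent modulo B also spans Z modulo B. Such a
  sequence exists because the ambient C bounds the length of independent sequences.\<close>

lemma has_qdim_exists:
  assumes Z: "subspace Z" "subspace B" "Z \<subseteq> C" and C: "has_qdim s C {0} n"
  shows "\<exists>m. has_qdim s Z B m"
proof -
  define P where "P m \<longleftrightarrow> (\<exists>b. (\<forall>i<m. b i \<in> Z) \<and> (\<forall>c. (\<Sum>i<m. s (c i) (b i)) \<in> B \<longrightarrow> (\<forall>i<m. c i = 0)))" for m :: nat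
  from C obtain a where a: "\<And>z. z \<in> C \<Longrightarrow> \<exists>c. z - (\<Sum>i<n. s (c i) (a i)) \<in> {0}"
    unfolding has_qdim_def by blast
  have P0: "P 0" unfolding P_def by simp
  have "m \<le> n" if Pm: "P m" for m
  proof -
    from Pm obtain b where "\<forall>i<m. b i \<in> Z" "\<forall>c. (\<Sum>i<m. s (c i) (b i)) \<in> B \<longrightarrow> (\<forall>i<m. c i = 0)"
      unfolding P_def by blast
    note b = this
    show ?thesis
    proof (rule qdim_le[where B="{0}" and n=m and a=b and Z=C and m=n and b=a])
      fix c assume "(\<Sum>i<m. s (c i) (b i)) \<in> {0}"
      then have "(\<Sum>i<m. s (c i) (b i)) \<in> B" using subspace_0[OF Z(2)] by simp
      then show "\<forall>i<m. c i = 0" using b(2) by blast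
    next
      fix z assume "z \<in> C" then show "\<exists>c. z - (\<Sum>i<n. s (c i) (a i)) \<in> {0}" by (rule a)
    qed (use b Z in auto)
  qed
  then have bound: "\<forall>m. P m \<longrightarrow> m \<le> n" by blast
  define m where "m = (GREATEST m. P m)"
  have Pm: "P m" unfolding m_def using GreatestI_nat[of P 0 n] P0 bound by blast
  have nP: "\<not> P (Suc m)"
    using Greatest_le_nat[of P "Suc m" n] bound m_def by (metis Suc_n_not_le_n)
  from Pm obtain b where b: "\<forall>i<m. b i \<in> Z" "\<forall>c. (\<Sum>i<m. s (c i) (b i)) \<in> B \<longrightarrow> (\<forall>i<m. c i = 0)"
    unfolding P_def by blast
  have "\<exists>c. z - (\<Sum>i<m. s (c i) (b i)) \<in> B" if z: "z \<in> Z" for z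
  proof (rule ccontr)
    assume no: "\<nexists>c. z - (\<Sum>i<m. s (c i) (b i)) \<in> B"
    have "P (Suc m)" unfolding P_def
    proof (intro exI[of _ "b(m := z)"] conjI allI impI)
      fix i assume "i < Suc m" then show "(b(m := z)) i \<in> Z" using b z by auto
    next
      fix c i assume *: "(\<Sum>i<Suc m. s (c i) ((b(m := z)) i)) \<in> B" and i: "i < Suc m"
      have eq: "(\<Sum>i<Suc m. s (c i) ((b(m := z)) i)) = (\<Sum>i<m. s (c i) (b i)) + s (c m) z"
        by simp
      \<comment> \<open>A nonzero coefficient of z would express z modulo B by the
        \<open>b i\<close>, against the choice of z.\<close>
      have cm: "c m = 0"
      proof (rule ccontr)
        assume cm: "c m \<noteq> 0"
        have "s (inverse (c m)) ((\<Sum>i<m. s (c i) (b i)) + s (c m) z) \<in> B"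
          using * Z(2) unfolding eq by (intro subspace_scale) auto
        also have "s (inverse (c m)) ((\<Sum>i<m. s (c i) (b i)) + s (c m) z) =
           z - (\<Sum>i<m. s (- inverse (c m) * c i) (b i))"
          using cm by (simp add: scale_right_distrib scale_sum_right sum_negf)
        finally show False using spec[OF no[unfolded not_ex], of "\<lambda>i. - inverse (c m) * c i"] by simp
      qed
      with * have "(\<Sum>i<m. s (c i) (b i)) \<in> B" unfolding eq by simp
      with b(2) cm i show "c i = 0" by (metis less_Suc_eq)
    qed
    with nP show False by blast
  qed
  with b show ?thesis unfolding has_qdim_def by (intro exI[of _ m] exI[of _ b] conjI) simp_all
qed

end

text \<open>The isomorphism theorem without quotients: \<open>f\<close> maps Z onto Z', and inside Z
  the preimage of B' is B, so \<open>f\<close> induces an isomorphism of Z/B with Z'/B'. B is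
  compared on Z alone, so it may be given simply as a preimage under \<open>f\<close>.\<close>

lemma has_qdim_transfer:
  fixes s :: "'k::field \<Rightarrow> 'b::ab_group_add \<Rightarrow> 'b" and s' :: "'k \<Rightarrow> 'c::ab_group_add \<Rightarrow> 'c"
  assumes f: "Vector_Spaces.linear s s' f" and Z: "module.subspace s Z"
    and img: "f ` Z = Z'" and iff: "\<And>z. z \<in> Z \<Longrightarrow> z \<in> B \<longleftrightarrow> f z \<in> B'"
  shows "has_qdim s Z B n \<longleftrightarrow> has_qdim s' Z' B' n"
proof -
  interpret L: Vector_Spaces.linear s s' f by (rule f)
  have f_lc: "f (\<Sum>i<n. s (c i) (b i)) = (\<Sum>i<n. s' (c i) (f (b i)))" for c b
    by (simp add: L.sum L.scale)
  have lc: "(\<Sum>i<n. s (c i) (b i)) \<in> Z" if "\<forall>i<n. b i \<in> Z" for b c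
    using that Z by (intro L.vs1.subspace_sum L.vs1.subspace_scale) auto
  have lc2: "z - (\<Sum>i<n. s (c i) (b i)) \<in> Z" if "\<forall>i<n. b i \<in> Z" "z \<in> Z" for b c z
    using that lc Z by (intro L.vs1.subspace_diff) auto
  show ?thesis
  proof
    assume "has_qdim s Z B n"
    then obtain b where b: "\<forall>i<n. b i \<in> Z" "\<forall>z\<in>Z. \<exists>c. z - (\<Sum>i<n. s (c i) (b i)) \<in> B"
      "\<forall>c. (\<Sum>i<n. s (c i) (b i)) \<in> B \<longrightarrow> (\<forall>i<n. c i = 0)" unfolding has_qdim_def by blast
    show "has_qdim s' Z' B' n" unfolding has_qdim_def
    proof (intro exI[of _ "f \<circ> b"] conjI ballI allI impI)
      fix i assume "i < n" then show "(f \<circ> b) i \<in> Z'" using b img by auto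
    next
      fix z' assume "z' \<in> Z'"
      then obtain z where z: "z \<in> Z" "z' = f z" using img by auto
      then obtain c where c: "z - (\<Sum>i<n. s (c i) (b i)) \<in> B" using b by blast
      then have "f (z - (\<Sum>i<n. s (c i) (b i))) \<in> B'" using iff lc2 b z by blast
      then show "\<exists>c. z' - (\<Sum>i<n. s' (c i) ((f \<circ> b) i)) \<in> B'"
        using z by (auto simp: L.diff f_lc)
    next
      fix c i assume "(\<Sum>i<n. s' (c i) ((f \<circ> b) i)) \<in> B'" "i < n"
      then have "f (\<Sum>i<n. s (c i) (b i)) \<in> B'" by (simp add: f_lc)
      then have "(\<Sum>i<n. s (c i) (b i)) \<in> B" using iff lc b by blast
      then show "c i = 0" using b \<open>i < n\<close> by blast
    qed
  next
    assume "has_qdim s' Z' B' n"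
    then obtain b' where b': "\<forall>i<n. b' i \<in> Z'" "\<forall>z\<in>Z'. \<exists>c. z - (\<Sum>i<n. s' (c i) (b' i)) \<in> B'"
      "\<forall>c. (\<Sum>i<n. s' (c i) (b' i)) \<in> B' \<longrightarrow> (\<forall>i<n. c i = 0)" unfolding has_qdim_def by blast
    define b where "b i = (SOME y. y \<in> Z \<and> f y = b' i)" for i
    have "b i \<in> Z \<and> f (b i) = b' i" if "i < n" for i
    proof -
      have "b' i \<in> f ` Z" using b'(1) img that by simp
      then have "\<exists>y. y \<in> Z \<and> f y = b' i" by auto
      then show ?thesis unfolding b_def by (rule someI_ex)
    qed
    then have b: "\<forall>i<n. b i \<in> Z" "\<And>i. i < n \<Longrightarrow> f (b i) = b' i" by simp_all
    have f_lc': "f (\<Sum>i<n. s (c i) (b i)) = (\<Sum>i<n. s' (c i) (b' i))" for c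
      unfolding f_lc using b by (intro sum.cong) auto
    show "has_qdim s Z B n" unfolding has_qdim_def
    proof (intro exI[of _ b] conjI ballI allI impI)
      fix i assume "i < n" then show "b i \<in> Z" using b by auto
    next
      fix z assume z: "z \<in> Z"
      then obtain c where "f z - (\<Sum>i<n. s' (c i) (b' i)) \<in> B'" using b'(2) img by blast
      then have "f (z - (\<Sum>i<n. s (c i) (b i))) \<in> B'" by (simp add: L.diff f_lc')
      then have "z - (\<Sum>i<n. s (c i) (b i)) \<in> B" using iff[OF lc2[OF b(1) z]] by blast
      then show "\<exists>c. z - (\<Sum>i<n. s (c i) (b i)) \<in> B" by (intro exI[of _ c])
    next
      fix c i assume "(\<Sum>i<n. s (c i) (b i)) \<in> B" "i < n"
      then have "f (\<Sum>i<n. s (c i) (b i)) \<in> B'" using iff lc b by blast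
      then show "c i = 0" using b'(3) \<open>i < n\<close> by (auto simp: f_lc')
    qed
  qed
qed

section \<open>Spaces of functions and finite products of quotients\<close>

text \<open>The scaling is a parameter so that the construction can be iterated: Koszul chains are
  functions with values in functions, and families of chains indexed by multidegrees add one more
  level.\<close>

definition fscale :: "('k \<Rightarrow> 'b \<Rightarrow> 'b) \<Rightarrow> 'k \<Rightarrow> ('i \<Rightarrow> 'b) \<Rightarrow> 'i \<Rightarrow> 'b" where
  "fscale s c g = (\<lambda>i. s c (g i))"

lemma fscale_apply [simp]: "fscale s c g i = s c (g i)"
  by (simp add: fscale_def)

lemma vector_space_fscale:
  assumes "vector_space s" shows "vector_space (fscale s)"
proof -
  interpret vector_space s by fact
  show ?thesis by unfold_locales (auto simp: fun_eq_iff algebra_simps)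
qed

lemma vector_space_times: "vector_space ((*) :: 'k::field \<Rightarrow> 'k \<Rightarrow> 'k)"
  by unfold_locales (auto simp: algebra_simps)

lemma linearI:
  assumes "vector_space s" "vector_space s'" "\<And>x y. f (x + y) = f x + f y" "\<And>c x. f (s c x) = s' c (f x)"
  shows "Vector_Spaces.linear s s' f"
  unfolding Vector_Spaces.linear_iff using assms by auto

lemma sum_fun_apply: "(\<Sum>i\<in>A. g i) x = (\<Sum>i\<in>A. (g i x :: 'b::comm_monoid_add))"
  by (induction A rule: infinite_finite_induct) auto

text \<open>One coordinate a is split off at a time. The intermediate space \<open>?M\<close>
  requires coordinate a to lie in \<open>B a\<close>. Evaluation at a computes \<open>?C\<close>
  modulo \<open>?M\<close>, and erasing coordinate a reduces \<open>?M\<close> modulo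
  \<open>?B\<close> to the induction hypothesis.\<close>

lemma has_qdim_product:
  fixes s :: "'k::field \<Rightarrow> 'b::ab_group_add \<Rightarrow> 'b" and Z B :: "'i \<Rightarrow> 'b set"
  assumes vs: "vector_space s" and "finite A"
    and ZB: "\<And>a. a \<in> A \<Longrightarrow> module.subspace s (Z a) \<and> module.subspace s (B a) \<and> B a \<subseteq> Z a \<and> has_qdim s (Z a) (B a) (n a)"
  shows "has_qdim (fscale s) {g. (\<forall>a\<in>A. g a \<in> Z a) \<and> (\<forall>a. a \<notin> A \<longrightarrow> g a = 0)}
     {g. (\<forall>a\<in>A. g a \<in> B a) \<and> (\<forall>a. a \<notin> A \<longrightarrow> g a = 0)} (\<Sum>a\<in>A. n a)"
  using assms(2) ZB
proof (induction A rule: finite_induct)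
  case empty
  have "{g. (\<forall>a\<in>{}. g a \<in> Z a) \<and> (\<forall>a. a \<notin> {} \<longrightarrow> g a = 0)} = {0}" 
    "{g. (\<forall>a\<in>{}. g a \<in> B a) \<and> (\<forall>a. a \<notin> {} \<longrightarrow> g a = 0)} = {0}" by (auto simp: fun_eq_iff)
  then show ?case by (simp add: has_qdim_def)
next
  case (insert a A)
  interpret S: vector_space s by (rule vs)
  interpret F: vector_space "fscale s :: _ \<Rightarrow> ('i \<Rightarrow> 'b) \<Rightarrow> _" by (rule vector_space_fscale[OF vs])
  let ?C = "{g. (\<forall>a\<in>insert a A. g a \<in> Z a) \<and> (\<forall>b. b \<notin> insert a A \<longrightarrow> g b = 0)}"
  let ?M = "{g\<in>?C. g a \<in> B a}"
  let ?B = "{g. (\<forall>a\<in>insert a A. g a \<in> B a) \<and> (\<forall>b. b \<notin> insert a A \<longrightarrow> g b = 0)}"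
  note sub = insert.prems
  have subC: "F.subspace ?C" "F.subspace ?M" "F.subspace ?B"
    using sub by (auto simp: F.subspace_def S.subspace_def)
  have aa: "S.subspace (Z a)" "S.subspace (B a)" "B a \<subseteq> Z a" using sub[of a] by auto
  have "has_qdim (fscale s) ?C ?M (n a) \<longleftrightarrow> has_qdim s (Z a) (B a) (n a)"
  proof (rule has_qdim_transfer[OF _ subC(1)])
    show "Vector_Spaces.linear (fscale s) s (\<lambda>g. g a)"
      by (rule linearI) (auto simp: vs vector_space_fscale)
    show "(\<lambda>g. g a) ` ?C = Z a"
    proof safe
      fix z assume "z \<in> Z a"
      then have "(\<lambda>i. if i = a then z else 0) \<in> ?C" using sub by (auto simp: S.subspace_0)
      then show "z \<in> (\<lambda>g. g a) ` ?C" by (rule rev_image_eqI) simp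
    qed auto
  qed auto
  moreover have "has_qdim (fscale s) ?M ?B (sum n A) \<longleftrightarrow>
     has_qdim (fscale s) {g. (\<forall>a\<in>A. g a \<in> Z a) \<and> (\<forall>a. a \<notin> A \<longrightarrow> g a = 0)}
     {g. (\<forall>a\<in>A. g a \<in> B a) \<and> (\<forall>a. a \<notin> A \<longrightarrow> g a = 0)} (sum n A)"
  proof (rule has_qdim_transfer[OF _ subC(2)])
    show "Vector_Spaces.linear (fscale s) (fscale s) (\<lambda>g. g(a := 0))"
      by (rule linearI) (auto simp: vs vector_space_fscale fun_eq_iff)
    show "(\<lambda>g. g(a := 0)) ` ?M = {g. (\<forall>a\<in>A. g a \<in> Z a) \<and> (\<forall>a. a \<notin> A \<longrightarrow> g a = 0)}"
    proof safe
      fix g assume g: "\<forall>a\<in>A. g a \<in> Z a" "\<forall>a. a \<notin> A \<longrightarrow> g a = 0"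
      then have "g \<in> ?M" using insert.hyps aa by (auto simp: S.subspace_0)
      moreover have "g = g(a := 0)" using g insert.hyps by auto
      ultimately show "g \<in> (\<lambda>g. g(a := 0)) ` ?M" by (metis (no_types, lifting) image_eqI)
    qed (use insert.hyps in auto)
  qed (use insert.hyps in auto)
  ultimately have "has_qdim (fscale s) ?C ?M (n a)" "has_qdim (fscale s) ?M ?B (sum n A)"
    using insert.IH sub by auto
  then have "has_qdim (fscale s) ?C ?B (sum n A + n a)"
    using sub by (intro has_qdim_chain[OF vector_space_fscale[OF vs] subC(2,3) _ _ subC(1)]) auto
  then show ?case unfolding sum.insert[OF insert.hyps] by (simp only: add.commute)
qed

lemma has_qdim_functions:
  assumes "finite A"
  shows "has_qdim (fscale (*)) {g. \<forall>a. g a \<noteq> (0::'k::field) \<longrightarrow> a \<in> A} {0} (card A)"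
proof -
  interpret vector_space "(*) :: 'k \<Rightarrow> 'k \<Rightarrow> 'k" by (rule vector_space_times)
  have "has_qdim (*) (UNIV::'k set) {0} 1"
    unfolding has_qdim_def by (intro exI[of _ "\<lambda>_. 1"]) auto
  then have "has_qdim (fscale (*)) {g. (\<forall>a\<in>A. g a \<in> (UNIV::'k set)) \<and> (\<forall>a. a \<notin> A \<longrightarrow> g a = 0)}
     {g. (\<forall>a\<in>A. g a \<in> {0::'k}) \<and> (\<forall>a. a \<notin> A \<longrightarrow> g a = 0)} (\<Sum>a\<in>A. 1)"
    using assms by (intro has_qdim_product) (auto simp: vector_space_times subspace_def)
  moreover have "{g. (\<forall>a\<in>A. g a \<in> {0::'k}) \<and> (\<forall>a. a \<notin> A \<longrightarrow> g a = 0)} = {0}"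
    by (auto intro!: ext simp: zero_fun_def)
  moreover have "{g. (\<forall>a\<in>A. g a \<in> (UNIV::'k set)) \<and> (\<forall>a. a \<notin> A \<longrightarrow> g a = 0)} = {g. \<forall>a. g a \<noteq> (0::'k) \<longrightarrow> a \<in> A}"
    by auto
  ultimately show ?thesis by simp
qed


section \<open>Koszul chains\<close>

text \<open>The numbering \<open>f\<close> serves as a linear order on the vertices; this is the
  exterior algebra sign for moving x to its place in T.\<close>

definition ksign :: "('v \<Rightarrow> nat) \<Rightarrow> 'v \<Rightarrow> 'v set \<Rightarrow> 'k::field" where
  "ksign f x T = (- 1) ^ card {y\<in>T. f y < f x}"

lemma ksign_square [simp]: "ksign f x T * ksign f x T = (1::'k::field)"
  by (simp add: ksign_def flip: power_mult_distrib)

lemma ksign_square_left [simp]: "ksign f x T * (ksign f x T * a) = (a::'k::field)"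
  by (simp flip: mult.assoc)

text \<open>Of two distinct vertices only the earlier one is counted in the sign of the other, so
  inserting them changes exactly one of the two signs.\<close>

lemma ksign_anticommute:
  assumes "finite T" "x \<notin> T" "y \<notin> T" "f x \<noteq> f y"
  shows "ksign f x T * ksign f y (insert x T) = - (ksign f y T * ksign f x (insert y T) :: 'k::field)"
proof -
  have *: "ksign f x T * ksign f y (insert x T) = - (ksign f y T * ksign f x (insert y T) :: 'k::field)"
    if "f x < f y" "x \<notin> T" for x y
  proof -
    have "{z\<in>insert x T. f z < f y} = insert x {z\<in>T. f z < f y}" using that by auto
    moreover have "{z\<in>insert y T. f z < f x} = {z\<in>T. f z < f x}" using that by auto
    ultimately show ?thesis using assms(1) that by (simp add: ksign_def)
  qed
  from assms(4) consider "f x < f y" | "f y < f x" by linarith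
  then show ?thesis by cases (use *[of x y] *[of y x] assms(2,3) in simp_all)
qed

text \<open>The coefficient at T of the Koszul differential: the basis element of S goes to the
  signed sum of x times that of S - {x}, so T receives contributions from all
  \<open>insert x T\<close>. With trivial \<open>X\<close> and scalar coefficients it is the
  simplicial boundary, augmented by the empty set.\<close>

definition kdiff :: "'v set \<Rightarrow> ('v \<Rightarrow> nat) \<Rightarrow> ('k::field \<Rightarrow> 'b \<Rightarrow> 'b) \<Rightarrow> ('v \<Rightarrow> 'b \<Rightarrow> 'b) \<Rightarrow>
    ('v set \<Rightarrow> 'b::ab_group_add) \<Rightarrow> 'v set \<Rightarrow> 'b" where
  "kdiff V f s X c T = (\<Sum>x\<in>V - T. s (ksign f x T) (X x (c (insert x T))))"

text \<open>The basis element of a set of size p has degree p, which accounts for the shift in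
  \<open>N (j - int p)\<close>.\<close>

definition kchains :: "'v set \<Rightarrow> (int \<Rightarrow> 'b set) \<Rightarrow> nat \<Rightarrow> int \<Rightarrow> ('v set \<Rightarrow> 'b::ab_group_add) set" where
  "kchains V N p j = {c. \<forall>S. c S \<noteq> 0 \<longrightarrow> S \<subseteq> V \<and> card S = p \<and> c S \<in> N (j - int p)}"

text \<open>A module is encoded by a vector space with commuting operators \<open>X x\<close>, the
  multiplications by the variables. The same locale serves modules over the polynomial ring and,
  with identity operators, simplicial chains over the field.\<close>

locale koszul = vector_space s
  for s :: "'k::field \<Rightarrow> 'b::ab_group_add \<Rightarrow> 'b" +
  fixes V :: "'v set" and f :: "'v \<Rightarrow> nat" and X :: "'v \<Rightarrow> 'b \<Rightarrow> 'b"
  assumes finite_V: "finite V" and inj_f: "inj_on f V"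
    and linear_X: "x \<in> V \<Longrightarrow> Vector_Spaces.linear s s (X x)"
    and X_commute: "x \<in> V \<Longrightarrow> y \<in> V \<Longrightarrow> X x (X y b) = X y (X x b)"
begin

abbreviation D where "D \<equiv> kdiff V f s X"

sublocale chains: vector_space "fscale s :: 'k \<Rightarrow> ('v set \<Rightarrow> 'b) \<Rightarrow> _"
  by (rule vector_space_fscale) (rule vector_space_axioms)

lemma X_simps:
  assumes "x \<in> V"
  shows X_0: "X x 0 = 0" and X_add: "X x (a + b) = X x a + X x b"
    and X_scale: "X x (s r a) = s r (X x a)" and X_sum: "X x (sum g A) = (\<Sum>a\<in>A. X x (g a))"
proof -
  interpret Vector_Spaces.linear s s "X x" by (rule linear_X) fact
  show "X x 0 = 0" "X x (a + b) = X x a + X x b" "X x (s r a) = s r (X x a)" "X x (sum g A) = (\<Sum>a\<in>A. X x (g a))"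
    by (simp_all add: zero add scale sum)
qed

lemma linear_D: "Vector_Spaces.linear (fscale s) (fscale s) D"
  by (rule linearI[OF chains.vector_space_axioms chains.vector_space_axioms])
    (auto simp: kdiff_def fun_eq_iff X_add X_scale scale_right_distrib sum.distrib scale_sum_right
       mult.commute intro!: sum.cong)

lemma D_diff: "D (c - d) = D c - D d"
proof -
  interpret D: Vector_Spaces.linear "fscale s" "fscale s" D by (rule linear_D)
  show ?thesis by (rule D.diff)
qed

text \<open>Each pair x, y outside T is removed in both orders; the multiplications commute and the
  signs anticommute, so the two terms cancel.\<close>

lemma D_D:
  assumes supp: "\<And>S. c S \<noteq> 0 \<Longrightarrow> S \<subseteq> V"
  shows "D (D c) = 0"
proof
  fix T
  show "D (D c) T = 0 T"
  proof (cases "T \<subseteq> V")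
    case False
    then have "c (insert y (insert x T)) = 0" for x y using supp by blast
    then show ?thesis by (auto simp: kdiff_def X_0 intro!: sum.neutral)
  next
    case True
    then have fT: "finite T" using finite_V finite_subset by blast
    define g where "g x y = s (ksign f x T * ksign f y (insert x T)) (X x (X y (c (insert y (insert x T)))))" for x y
    let ?P = "{(x,y)\<in>(V - T) \<times> (V - T). f x < f y}"
    let ?Q = "{(x,y)\<in>(V - T) \<times> (V - T). f y < f x}"
    have finP: "finite ?P" "finite ?Q" using finite_V by (auto intro: finite_subset[of _ "V \<times> V"])
    have "D (D c) T = (\<Sum>x\<in>V - T. \<Sum>y\<in>V - insert x T. g x y)"
      by (auto simp: kdiff_def X_sum X_scale scale_sum_right g_def intro!: sum.cong)
    also have "\<dots> = sum (\<lambda>(x,y). g x y) (Sigma (V - T) (\<lambda>x. V - insert x T))"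
      using finite_V by (subst sum.Sigma) auto
    also have "Sigma (V - T) (\<lambda>x. V - insert x T) = ?P \<union> ?Q"
      using inj_f by (auto simp: inj_on_def) (metis linorder_neqE_nat)
    also have "sum (\<lambda>(x,y). g x y) (?P \<union> ?Q) = sum (\<lambda>(x,y). g x y) ?P + sum (\<lambda>(x,y). g x y) ?Q"
      using finP by (intro sum.union_disjoint) auto
    also have "sum (\<lambda>(x,y). g x y) ?Q = sum (\<lambda>(x,y). g y x) ?P"
      by (rule sum.reindex_bij_witness[of _ prod.swap prod.swap]) auto
    also have "sum (\<lambda>(x,y). g x y) ?P + sum (\<lambda>(x,y). g y x) ?P = sum (\<lambda>(x,y). g x y + g y x) ?P"
      by (simp add: sum.distrib split_def)
    also have "\<dots> = 0"
    proof (intro sum.neutral ballI, clarify)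
      fix x y assume *: "x \<in> V" "x \<notin> T" "y \<in> V" "y \<notin> T" "f x < f y"
      have "g x y = - g y x"
        unfolding g_def using ksign_anticommute[OF fT, of x y f, where ?'k = 'k] *
        by (simp add: X_commute insert_commute)
      then show "g x y + g y x = 0" by simp
    qed
    finally show ?thesis by simp
  qed
qed

definition graded_sub :: "(int \<Rightarrow> 'b set) \<Rightarrow> bool" where
  "graded_sub N \<longleftrightarrow> (\<forall>j. subspace (N j)) \<and> (\<forall>x\<in>V. \<forall>j. \<forall>b\<in>N j. X x b \<in> N (j + 1))"

abbreviation K where "K \<equiv> kchains V"

definition kcycles :: "(int \<Rightarrow> 'b set) \<Rightarrow> nat \<Rightarrow> int \<Rightarrow> ('v set \<Rightarrow> 'b) set" where
  "kcycles N p j = {c \<in> K N p j. D c = 0}"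

definition kbounds :: "(int \<Rightarrow> 'b set) \<Rightarrow> nat \<Rightarrow> int \<Rightarrow> ('v set \<Rightarrow> 'b) set" where
  "kbounds N p j = D ` K N (Suc p) j"

text \<open>A relation, so that finite dimension is asserted together with its value; syzygy modules
  then inherit it through \<open>khom_shift\<close>.\<close>

definition khom :: "(int \<Rightarrow> 'b set) \<Rightarrow> nat \<Rightarrow> int \<Rightarrow> nat \<Rightarrow> bool" where
  "khom N p j n \<longleftrightarrow> has_qdim (fscale s) (kcycles N p j) (kbounds N p j) n"

lemma chain_mem: "graded_sub N \<Longrightarrow> c \<in> K N p j \<Longrightarrow> c S \<in> N (j - int p)"
  by (cases "c S = 0") (auto simp: graded_sub_def kchains_def subspace_0)

lemma subspace_chains: "graded_sub N \<Longrightarrow> chains.subspace (K N p j)"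
  unfolding chains.subspace_def
proof (intro conjI ballI allI)
  assume N: "graded_sub N"
  show "0 \<in> K N p j" by (simp add: kchains_def)
  fix c assume c: "c \<in> K N p j"
  { fix d assume d: "d \<in> K N p j"
    show "c + d \<in> K N p j" unfolding kchains_def
    proof (intro CollectI allI impI)
      fix S assume "(c + d) S \<noteq> 0"
      then have "c S \<noteq> 0 \<or> d S \<noteq> 0" by auto
      then show "S \<subseteq> V \<and> card S = p \<and> (c + d) S \<in> N (j - int p)"
        using c d chain_mem[OF N c, of S] chain_mem[OF N d, of S] N
        by (auto simp: kchains_def graded_sub_def intro: subspace_add)
    qed }
  fix r
  show "fscale s r c \<in> K N p j"
    using c N by (auto simp: kchains_def graded_sub_def intro: subspace_scale)
qed

lemma D_chain:
  assumes N: "graded_sub N" and c: "c \<in> K N (Suc p) j"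
  shows "D c \<in> K N p j"
  unfolding kchains_def
proof (intro CollectI allI impI)
  fix T assume nz: "D c T \<noteq> 0"
  then obtain x where x: "x \<in> V - T" "s (ksign f x T) (X x (c (insert x T))) \<noteq> 0"
    unfolding kdiff_def by (rule sum.not_neutral_contains_not_neutral)
  then have "c (insert x T) \<noteq> 0" using X_0 by auto
  then have T: "insert x T \<subseteq> V" "card (insert x T) = Suc p" using c by (auto simp: kchains_def)
  then have "finite T" using finite_subset[OF _ finite_V, of T] by simp
  have "D c T \<in> N (j - int p)" unfolding kdiff_def
  proof (intro subspace_sum subspace_scale)
    show "subspace (N (j - int p))" using N by (simp add: graded_sub_def)
    fix x assume "x \<in> V - T"
    then have "X x (c (insert x T)) \<in> N (j - int (Suc p) + 1)"
      using N chain_mem[OF N c] unfolding graded_sub_def by blast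
    then show "X x (c (insert x T)) \<in> N (j - int p)" by simp
  qed (use N in \<open>simp add: graded_sub_def\<close>)
  then show "T \<subseteq> V \<and> card T = p \<and> D c T \<in> N (j - int p)"
    using T x \<open>finite T\<close> by auto
qed

lemma D_D_chain: "c \<in> K N p j \<Longrightarrow> D (D c) = 0"
  by (rule D_D) (auto simp: kchains_def)

lemma D_chain_0: assumes "c \<in> K N 0 j" shows "D c = 0"
proof -
  have "c (insert x T) = 0" for x T
    using assms finite_V unfolding kchains_def by (auto dest: finite_subset simp: card_eq_0_iff)
  then show ?thesis by (auto simp: kdiff_def X_0 fun_eq_iff intro!: sum.neutral)
qed

lemma subspace_cycles: "graded_sub N \<Longrightarrow> chains.subspace (kcycles N p j)"
proof -
  interpret D: Vector_Spaces.linear "fscale s" "fscale s" D by (rule linear_D)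
  assume "graded_sub N"
  then show ?thesis using subspace_chains[of N p j] 
    by (auto simp: kcycles_def chains.subspace_def D.zero D.add D.scale)
qed

lemma subspace_bounds: "graded_sub N \<Longrightarrow> chains.subspace (kbounds N p j)"
proof -
  interpret D: Vector_Spaces.linear "fscale s" "fscale s" D by (rule linear_D)
  assume "graded_sub N"
  then show ?thesis unfolding kbounds_def by (intro D.subspace_image subspace_chains)
qed

lemma khom_unique: "graded_sub N \<Longrightarrow> khom N p j n \<Longrightarrow> khom N p j m \<Longrightarrow> n = m"
  unfolding khom_def using has_qdim_unique[OF chains.vector_space_axioms subspace_bounds] by blast

end

section \<open>Dimension shift along a minimal surjection\<close>

text \<open>\<open>exact\<close> states that the positive Koszul homology of F vanishes, and
  \<open>minimal\<close> that the kernel of \<phi> lies in the irrelevant ideal times F. Working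
  with these two properties keeps the homological argument apart from polynomials.\<close>

locale koszul_surj = koszul s V f X
  for s :: "'k::field \<Rightarrow> 'b::ab_group_add \<Rightarrow> 'b" and V :: "'v set" and f X +
  fixes F N' :: "int \<Rightarrow> 'b set" and \<phi> :: "'b \<Rightarrow> 'b"
  assumes F: "graded_sub F" and N': "graded_sub N'"
    and lin: "Vector_Spaces.linear s s \<phi>" and \<phi>_X: "x \<in> V \<Longrightarrow> \<phi> (X x b) = X x (\<phi> b)"
    and img: "\<phi> ` F j = N' j"
    and exact: "c \<in> kchains V F (Suc p) j \<Longrightarrow> kdiff V f s X c = 0 \<Longrightarrow> c \<in> kbounds F (Suc p) j"
    and minimal: "c \<in> kchains V F 0 j \<Longrightarrow> \<phi> (c {}) = 0 \<Longrightarrow> c \<in> kbounds F 0 j"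
begin

definition N where "N j = {b \<in> F j. \<phi> b = 0}"

interpretation \<phi>: Vector_Spaces.linear s s \<phi> by (rule lin)

interpretation D: Vector_Spaces.linear "fscale s" "fscale s" D by (rule linear_D)

lemma N: "graded_sub N"
  using F X_0 \<phi>_X by (auto simp: graded_sub_def N_def subspace_def \<phi>.zero \<phi>.add \<phi>.scale)

lemma D_\<phi>: "D (\<phi> \<circ> c) = \<phi> \<circ> D c"
  by (auto simp: kdiff_def fun_eq_iff \<phi>.sum \<phi>.scale \<phi>_X intro!: sum.cong)

lemma \<phi>_chain: "c \<in> K F p j \<Longrightarrow> \<phi> \<circ> c \<in> K N' p j"
  unfolding kchains_def
proof (intro CollectI allI impI)
  fix S assume c: "c \<in> {c. \<forall>S. c S \<noteq> 0 \<longrightarrow> S \<subseteq> V \<and> card S = p \<and> c S \<in> F (j - int p)}"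
    and "(\<phi> \<circ> c) S \<noteq> 0"
  then have "c S \<noteq> 0" by (auto simp: \<phi>.zero)
  with c show "S \<subseteq> V \<and> card S = p \<and> (\<phi> \<circ> c) S \<in> N' (j - int p)"
    by (auto simp flip: img)
qed

lemma lift_chain:
  assumes "z \<in> K N' p j"
  obtains w where "w \<in> K F p j" "\<phi> \<circ> w = z"
proof -
  \<comment> \<open>Where z vanishes the lift is set to 0 instead of being chosen, so that w keeps
    the support of z.\<close>
  define w where "w S = (if z S = 0 then 0 else SOME b. b \<in> F (j - int p) \<and> \<phi> b = z S)" for S
  have *: "w S \<in> F (j - int p) \<and> \<phi> (w S) = z S" if "z S \<noteq> 0" for S
  proof -
    have "z S \<in> \<phi> ` F (j - int p)" using assms that unfolding img by (auto simp: kchains_def)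
    then have "\<exists>b. b \<in> F (j - int p) \<and> \<phi> b = z S" by auto
    then have "(SOME b. b \<in> F (j - int p) \<and> \<phi> b = z S) \<in> F (j - int p) \<and> \<phi> (SOME b. b \<in> F (j - int p) \<and> \<phi> b = z S) = z S"
      by (rule someI_ex)
    then show ?thesis unfolding w_def using that by simp
  qed
  have "w S \<noteq> 0 \<Longrightarrow> z S \<noteq> 0" for S by (auto simp: w_def)
  then have "w \<in> K F p j" using assms * by (auto simp: kchains_def)
  moreover have "\<phi> \<circ> w = z" using * by (auto simp: fun_eq_iff w_def \<phi>.zero)
  ultimately show thesis by (rule that)
qed

lemma chain_N_iff: "c \<in> K N p j \<longleftrightarrow> c \<in> K F p j \<and> \<phi> \<circ> c = 0"
  by (auto simp: kchains_def N_def fun_eq_iff \<phi>.zero) (metis \<phi>.zero)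

lemma \<phi>_0: "\<phi> \<circ> (0 :: 'v set \<Rightarrow> 'b) = 0" and \<phi>_diff: "\<phi> \<circ> (c - d) = (\<phi> \<circ> c) - (\<phi> \<circ> d)"
  by (auto simp: fun_eq_iff \<phi>.zero \<phi>.diff)

lemma linear_\<phi>: "Vector_Spaces.linear (fscale s) (fscale s) (\<lambda>c :: 'v set \<Rightarrow> 'b. \<phi> \<circ> c)"
  by (rule linearI[OF chains.vector_space_axioms chains.vector_space_axioms])
    (auto simp: fun_eq_iff \<phi>.add \<phi>.scale)

lemma diff_chain: "c \<in> K F p j \<Longrightarrow> d \<in> K F p j \<Longrightarrow> c - d \<in> K F p j"
  using chains.subspace_diff[OF subspace_chains[OF F]] by blast

text \<open>The connecting isomorphism, realised as a zigzag of two surjections out of the chains of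
  \<open>F\<close> whose boundary lies in \<open>N\<close>.\<close>

lemma khom_shift: "khom N p j n \<longleftrightarrow> khom N' (Suc p) j n"
proof -
  define W where "W = {w \<in> K F (Suc p) j. D w \<in> K N p j}"
  have subW: "chains.subspace W"
    using subspace_chains[OF F, of "Suc p" j] subspace_chains[OF N, of p j]
    by (auto simp: W_def chains.subspace_def D.zero D.add D.scale)
  have img1: "D ` W = kcycles N p j"
  proof safe
    fix w assume "w \<in> W" then show "D w \<in> kcycles N p j"
      by (auto simp: W_def kcycles_def D_D_chain)
  next
    fix u assume u: "u \<in> kcycles N p j"
    then have uF: "u \<in> K F p j" "\<phi> \<circ> u = 0" "D u = 0" by (auto simp: kcycles_def chain_N_iff)
    \<comment> \<open>For p = 0 this is minimality, for positive p the acyclicity of F; thus the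
      shift holds from the bottom degree on.\<close>
    have "u \<in> kbounds F p j"
    proof (cases p)
      case 0 then show ?thesis using minimal uF by (metis comp_apply zero_fun_apply)
    next
      case (Suc q) then show ?thesis using exact uF by blast
    qed
    then obtain w where "w \<in> K F (Suc p) j" "u = D w" by (auto simp: kbounds_def)
    then show "u \<in> D ` W" using u by (auto simp: W_def kcycles_def)
  qed
  have img2: "(\<lambda>c. \<phi> \<circ> c) ` W = kcycles N' (Suc p) j"
  proof safe
    fix w assume w: "w \<in> W"
    then have "D (\<phi> \<circ> w) = 0" by (simp add: W_def D_\<phi> chain_N_iff)
    with w show "\<phi> \<circ> w \<in> kcycles N' (Suc p) j" by (simp add: W_def kcycles_def \<phi>_chain)
  next
    fix z assume z: "z \<in> kcycles N' (Suc p) j"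
    then obtain w where w: "w \<in> K F (Suc p) j" "\<phi> \<circ> w = z" by (auto simp: kcycles_def elim: lift_chain)
    have "D w \<in> K N p j" unfolding chain_N_iff using z w D_chain[OF F] by (simp add: kcycles_def flip: D_\<phi>)
    with w show "z \<in> (\<lambda>c. \<phi> \<circ> c) ` W" by (auto simp: W_def)
  qed
  have iff: "D w \<in> kbounds N p j \<longleftrightarrow> \<phi> \<circ> w \<in> kbounds N' (Suc p) j" if w: "w \<in> W" for w
  proof
    assume "D w \<in> kbounds N p j"
    then obtain u where u: "u \<in> K N (Suc p) j" "D w = D u" by (auto simp: kbounds_def)
    then have "w - u \<in> K F (Suc p) j" "D (w - u) = 0"
      using w by (auto simp: W_def chain_N_iff D_diff intro: diff_chain)
    then have "w - u \<in> kbounds F (Suc p) j" by (rule exact)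
    then obtain v where v: "v \<in> K F (Suc (Suc p)) j" "w - u = D v" by (auto simp: kbounds_def)
    have "\<phi> \<circ> w = \<phi> \<circ> (w - u)" using u by (simp add: \<phi>_diff chain_N_iff)
    also have "\<dots> = D (\<phi> \<circ> v)" by (simp add: v D_\<phi>)
    finally show "\<phi> \<circ> w \<in> kbounds N' (Suc p) j" using \<phi>_chain[OF v(1)] by (simp add: kbounds_def)
  next
    assume "\<phi> \<circ> w \<in> kbounds N' (Suc p) j"
    then obtain z where z: "z \<in> K N' (Suc (Suc p)) j" "\<phi> \<circ> w = D z" by (auto simp: kbounds_def)
    then obtain v where v: "v \<in> K F (Suc (Suc p)) j" "\<phi> \<circ> v = z" by (auto elim: lift_chain)
    have "w - D v \<in> K N (Suc p) j" unfolding chain_N_iff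
      using w v z D_chain[OF F v(1)] by (auto simp: W_def \<phi>_diff simp flip: D_\<phi> intro: diff_chain)
    moreover have "D (w - D v) = D w" using D_D_chain[OF v(1)] by (simp add: D_diff)
    ultimately show "D w \<in> kbounds N p j" unfolding kbounds_def by (metis image_eqI)
  qed
  have "khom N p j n \<longleftrightarrow> has_qdim (fscale s) W {w. D w \<in> kbounds N p j} n"
    unfolding khom_def by (rule has_qdim_transfer[symmetric, OF linear_D subW img1]) simp
  also have "\<dots> \<longleftrightarrow> khom N' (Suc p) j n"
    unfolding khom_def by (rule has_qdim_transfer[OF linear_\<phi> subW img2]) (simp add: iff)
  finally show ?thesis .
qed

text \<open>Since the kernel of \<phi> lies in the irrelevant ideal times F, passing to N'
  identifies no further classes in homological degree 0: minimal generators of N' correspond to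
  those of F.\<close>

lemma khom_0: "khom F 0 j n \<longleftrightarrow> khom N' 0 j n"
  unfolding khom_def
proof (rule has_qdim_transfer[OF linear_\<phi> subspace_cycles[OF F]])
  show "(\<lambda>c. \<phi> \<circ> c) ` kcycles F 0 j = kcycles N' 0 j"
  proof safe
    fix c assume "c \<in> kcycles F 0 j"
    then show "\<phi> \<circ> c \<in> kcycles N' 0 j" by (auto simp: kcycles_def \<phi>_chain D_chain_0[OF \<phi>_chain])
  next
    fix z assume "z \<in> kcycles N' 0 j"
    then obtain w where "w \<in> K F 0 j" "\<phi> \<circ> w = z" by (auto simp: kcycles_def elim: lift_chain)
    then show "z \<in> (\<lambda>c. \<phi> \<circ> c) ` kcycles F 0 j" by (auto simp: kcycles_def D_chain_0)
  qed
  fix c assume "c \<in> kcycles F 0 j"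
  then have c: "c \<in> K F 0 j" by (simp add: kcycles_def)
  show "c \<in> kbounds F 0 j \<longleftrightarrow> \<phi> \<circ> c \<in> kbounds N' 0 j"
  proof
    assume "c \<in> kbounds F 0 j"
    then obtain w where "w \<in> K F (Suc 0) j" "c = D w" by (auto simp: kbounds_def)
    then show "\<phi> \<circ> c \<in> kbounds N' 0 j"
      using \<phi>_chain by (auto simp: kbounds_def simp flip: D_\<phi>)
  next
    assume "\<phi> \<circ> c \<in> kbounds N' 0 j"
    then obtain z where "z \<in> K N' (Suc 0) j" "\<phi> \<circ> c = D z" by (auto simp: kbounds_def)
    then obtain w where w: "w \<in> K F (Suc 0) j" "\<phi> \<circ> c = \<phi> \<circ> D w" by (metis lift_chain D_\<phi>)
    then have "\<phi> \<circ> (c - D w) = 0" by (simp add: \<phi>_diff)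
    then have "\<phi> ((c - D w) {}) = 0" by (metis comp_apply zero_fun_apply)
    then have "c - D w \<in> kbounds F 0 j"
      using c w(1) D_chain[OF F w(1)] by (intro minimal diff_chain) auto
    moreover have "D w \<in> kbounds F 0 j" using w by (simp add: kbounds_def)
    ultimately have "c - D w + D w \<in> kbounds F 0 j"
      by (rule chains.subspace_add[OF subspace_bounds[OF F]])
    then show "c \<in> kbounds F 0 j" by simp
  qed
qed

end

section \<open>Simplicial chains and cones\<close>

abbreviation sdiff :: "'v set \<Rightarrow> ('v \<Rightarrow> nat) \<Rightarrow> ('v set \<Rightarrow> 'k::field) \<Rightarrow> 'v set \<Rightarrow> 'k" where
  "sdiff V f \<equiv> kdiff V f (*) (\<lambda>_ b. b)"

definition schains :: "'v set set \<Rightarrow> nat \<Rightarrow> ('v set \<Rightarrow> 'k::field) set" where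
  "schains \<S> p = {g. \<forall>S. g S \<noteq> 0 \<longrightarrow> S \<in> \<S> \<and> card S = p}"

text \<open>\<open>w\<close> is the cone with apex v over the part of g that avoids v, the standard
  contracting homotopy; adding v never leaves the family. Chains on the empty set are included, so
  exactness holds in degree 0 as well.\<close>

lemma cone_exact:
  fixes g :: "'v set \<Rightarrow> 'k::field"
  assumes V: "finite V" "inj_on f V" and \<S>: "\<S> \<subseteq> Pow V"
    and cone: "v \<in> V" "\<And>S. S \<in> \<S> \<Longrightarrow> insert v S \<in> \<S>"
    and g: "g \<in> schains \<S> p" "sdiff V f g = 0"
  obtains w where "w \<in> schains \<S> (Suc p)" "sdiff V f w = g"
proof -
  define w where "w S = (if v \<in> S then ksign f v (S - {v}) * g (S - {v}) else 0)" for S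
  have fin: "finite S" if "S \<in> \<S>" for S using that \<S> V(1) by (meson PowD finite_subset subsetD)
  have "w \<in> schains \<S> (Suc p)" unfolding schains_def
  proof (intro CollectI allI impI)
    fix S assume "w S \<noteq> 0"
    then have "v \<in> S" "g (S - {v}) \<noteq> 0" by (auto simp: w_def split: if_splits)
    then have "S - {v} \<in> \<S>" "card (S - {v}) = p" using g(1) by (auto simp: schains_def)
    then have "insert v (S - {v}) \<in> \<S>" using cone(2) by blast
    moreover have "card (insert v (S - {v})) = Suc p"
      using fin[OF \<open>S - {v} \<in> \<S>\<close>] \<open>card (S - {v}) = p\<close> by (subst card_insert_disjoint) auto
    ultimately show "S \<in> \<S> \<and> card S = Suc p" using \<open>v \<in> S\<close> by (simp add: insert_absorb)
  qed
  moreover have "sdiff V f w = g"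
  proof
    fix T
    show "sdiff V f w T = g T"
    proof (cases "T \<subseteq> V")
      case False
      then have "g T = 0" "g (insert x T - {v}) = 0" for x
        using g(1) \<S> cone(1) by (auto simp: schains_def)
      then show ?thesis by (auto simp: kdiff_def w_def intro!: sum.neutral)
    next
      case True
      then have fT: "finite T" using V(1) finite_subset by blast
      show ?thesis
      proof (cases "v \<in> T")
        case False
        have "sdiff V f w T = (\<Sum>x\<in>V - T. if x = v then g T else 0)"
          unfolding kdiff_def using False by (intro sum.cong) (auto simp: w_def)
        also have "\<dots> = g T" using False cone(1) V(1) by simp
        finally show ?thesis .
      next
        \<comment> \<open>At a set containing v, the value of g is recovered from the vanishing
          boundary at \<open>T - {v}\<close>, in which \<open>g T\<close> is one of the
          terms.\<close>
        case vT: True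
        define T' where "T' = T - {v}"
        have T: "T = insert v T'" "v \<notin> T'" "finite T'" using vT fT by (auto simp: T'_def)
        have *: "ksign f x T * w (insert x T) = - ksign f v T' * (ksign f x T' * g (insert x T'))"
          if "x \<in> V - T" for x
        proof -
          have x: "x \<notin> T'" "x \<noteq> v" using that T by auto
          have "insert x T - {v} = insert x T'" using T x by auto
          then have w: "w (insert x T) = ksign f v (insert x T') * g (insert x T')"
            using vT by (simp add: w_def)
          have "f v \<noteq> f x" using V(2) cone(1) that x by (auto simp: inj_on_def)
          then have "ksign f v T' * ksign f x T = - (ksign f x T' * ksign f v (insert x T') :: 'k)"
            unfolding T(1) using T x by (intro ksign_anticommute) auto
          then have "ksign f v T' * (ksign f v T' * ksign f x T) * ksign f v (insert x T') =
            - ksign f v T' * ksign f x T' * (ksign f v (insert x T') * ksign f v (insert x T') :: 'k)"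
            by simp
          then have "ksign f x T * ksign f v (insert x T') = - ksign f v T' * (ksign f x T' :: 'k)"
            by simp
          then have "(ksign f x T * ksign f v (insert x T')) * g (insert x T') =
              (- ksign f v T' * ksign f x T') * g (insert x T')" by simp
          then show ?thesis unfolding w by (simp only: mult.assoc)
        qed
        have "sdiff V f w T = - ksign f v T' * (\<Sum>x\<in>V - T. ksign f x T' * g (insert x T'))"
          unfolding kdiff_def sum_distrib_left using * by (intro sum.cong) auto
        also have "(\<Sum>x\<in>V - T. ksign f x T' * g (insert x T')) = sdiff V f g T' - ksign f v T' * g T"
        proof -
          have "V - T' = insert v (V - T)" using T cone(1) by auto
          then show ?thesis unfolding kdiff_def using V(1) vT by (simp flip: T(1))
        qed
        finally show ?thesis using g(2) by simp
      qed
    qed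
  qed
  ultimately show thesis by (rule that)
qed


section \<open>Koszul homology of free modules over a polynomial ring\<close>

abbreviation lookup where "lookup \<equiv> Poly_Mapping.lookup"
abbreviation keys where "keys \<equiv> Poly_Mapping.keys"
abbreviation single where "single \<equiv> Poly_Mapping.single"

definition sqf_mon :: "'v set \<Rightarrow> 'v \<Rightarrow>\<^sub>0 nat" where
  "sqf_mon W = (\<Sum>x\<in>W. single x 1)"

lemma lookup_sqf_mon: "finite W \<Longrightarrow> lookup (sqf_mon W) x = (if x \<in> W then 1 else 0)"
  by (simp add: sqf_mon_def lookup_sum lookup_single when_def)

lemma keys_sqf_mon: "finite W \<Longrightarrow> keys (sqf_mon W) = W"
  by (auto simp: in_keys_iff lookup_sqf_mon split: if_splits)

lemma mon_degree_alt: "finite A \<Longrightarrow> keys m \<subseteq> A \<Longrightarrow> mon_degree m = (\<Sum>x\<in>A. lookup m x)"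
  unfolding mon_degree_def by (intro sum.mono_neutral_left) (auto simp: in_keys_iff)

lemma mon_degree_add: "mon_degree (m + m') = mon_degree m + mon_degree m'"
proof -
  have "keys (m + m') \<subseteq> keys m \<union> keys m'" by (rule keys_add)
  then show ?thesis
    using mon_degree_alt[of "keys m \<union> keys m'" m] mon_degree_alt[of "keys m \<union> keys m'" m']
      mon_degree_alt[of "keys m \<union> keys m'" "m + m'"] by (simp add: lookup_add sum.distrib)
qed

lemma mon_degree_0 [simp]: "mon_degree 0 = 0"
  by (simp add: mon_degree_def)

lemma mon_degree_eq_0_iff: "mon_degree m = 0 \<longleftrightarrow> m = 0"
  by (auto simp: mon_degree_def in_keys_iff intro!: poly_mapping_eqI)

lemma mon_degree_sqf_mon: "finite W \<Longrightarrow> mon_degree (sqf_mon W) = card W"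
  by (simp add: mon_degree_def keys_sqf_mon lookup_sqf_mon)

lemma mon_degree_single: "mon_degree (single x n) = n"
  by (cases "n = 0") (simp_all add: mon_degree_def)

lemma keys_plus_nat: "keys (m + m' :: 'v \<Rightarrow>\<^sub>0 nat) = keys m \<union> keys m'"
  by (auto simp: in_keys_iff lookup_add)

lemma minus_sqf_mon_add: "S \<subseteq> keys \<alpha> \<Longrightarrow> \<alpha> - sqf_mon S + sqf_mon S = \<alpha>"
proof (rule poly_mapping_eqI)
  fix x assume S: "S \<subseteq> keys \<alpha>"
  then have "finite S" by (rule finite_subset) simp
  then show "lookup (\<alpha> - sqf_mon S + sqf_mon S) x = lookup \<alpha> x"
    using S by (auto simp: lookup_add lookup_minus lookup_sqf_mon in_keys_iff Suc_diff_1)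
qed

text \<open>Degrees are integers, since twists can make them negative; in that case there are no
  monomials.\<close>

definition monomials :: "'v set \<Rightarrow> int \<Rightarrow> ('v \<Rightarrow>\<^sub>0 nat) set" where
  "monomials V e = {m. keys m \<subseteq> V \<and> int (mon_degree m) = e}"

lemma finite_monomials:
  assumes "finite V" shows "finite (monomials V e)"
proof -
  have "lookup m x \<le> nat e" if "m \<in> monomials V e" for m x
  proof (cases "x \<in> keys m")
    case True
    then have "lookup m x \<le> mon_degree m" unfolding mon_degree_def by (intro member_le_sum) auto
    then show ?thesis using that by (auto simp: monomials_def)
  qed (simp add: in_keys_iff)
  moreover have "lookup m x = 0" if "m \<in> monomials V e" "x \<notin> V" for m x
  proof -
    have "x \<notin> keys m" using that by (auto simp: monomials_def)
    then show ?thesis by (simp add: in_keys_iff)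
  qed
  ultimately have "lookup ` monomials V e \<subseteq> {g. \<forall>x. (x \<in> V \<longrightarrow> g x \<in> {..nat e}) \<and> (x \<notin> V \<longrightarrow> g x = 0)}"
    by (intro image_subsetI CollectI allI conjI impI) simp_all
  moreover have "finite \<dots>" using assms by (intro finite_set_of_finite_funs) auto
  ultimately have "finite (lookup ` monomials V e)" by (rule finite_subset)
  then show ?thesis by (rule finite_imageD) (rule inj_onI, simp flip: poly_mapping_eq_iff)
qed

lemma lookup_single_mult_add:
  fixes p :: "('v, 'k::field) mpoly"
  shows "lookup (single m c * p) (m + k) = c * lookup p k"
  by (simp add: lookup_mult lookup_single when_mult)

lemma lookup_single_mult_not:
  fixes p :: "('v, 'k::field) mpoly"
  assumes "\<And>q. k \<noteq> m + q"
  shows "lookup (single m c * p) k = 0"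
  using assms by (simp add: lookup_mult lookup_single when_mult)

lemma lookup_const_mult: "lookup (single 0 c * p) m = (c :: 'k::field) * lookup (p :: ('v, 'k) mpoly) m"
  using lookup_single_mult_add[of 0 c p m] by simp

lemma lookup_indet_mult:
  fixes p :: "('v, 'k::field) mpoly"
  shows "lookup (indet x * p) m = (if x \<in> keys m then lookup p (m - single x 1) else 0)"
proof (cases "x \<in> keys m")
  case True
  then have "m = single x 1 + (m - single x 1)"
    by (intro poly_mapping_eqI) (auto simp: lookup_add lookup_minus lookup_single when_def in_keys_iff)
  then show ?thesis using True lookup_single_mult_add[of "single x 1" 1 p "m - single x 1"]
    by (simp add: indet_def)
next
  case False
  then have "m \<noteq> single x 1 + q" for q
    by (metis UnI1 keys_plus_nat keys_single one_neq_zero singletonI)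
  then show ?thesis using False by (simp add: indet_def lookup_single_mult_not)
qed

lemma prod_indet: "finite A \<Longrightarrow> (\<Prod>x\<in>A. indet x) = (single (sqf_mon A) 1 :: ('v, 'k::field) mpoly)"
  by (induction A rule: finite_induct) (simp_all add: sqf_mon_def indet_def mult_single)

section \<open>Free modules as functions into the polynomial ring\<close>

definition pscale :: "'k \<Rightarrow> ('v, 'k::field) mpoly \<Rightarrow> ('v, 'k) mpoly" where
  "pscale c p = single 0 c * p"

lemma lookup_pscale: "lookup (pscale c p) m = c * lookup p m"
  by (simp add: pscale_def lookup_const_mult)

lemma vector_space_pscale: "vector_space (pscale :: 'k::field \<Rightarrow> ('v, 'k) mpoly \<Rightarrow> _)"
  by unfold_locales (auto simp: pscale_def algebra_simps single_add mult_single simp flip: mult.assoc)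

definition vscale :: "'k \<Rightarrow> (nat \<Rightarrow> ('v, 'k::field) mpoly) \<Rightarrow> nat \<Rightarrow> ('v, 'k) mpoly" where
  "vscale = fscale pscale"

definition var_act :: "'v \<Rightarrow> (nat \<Rightarrow> ('v, 'k::field) mpoly) \<Rightarrow> nat \<Rightarrow> ('v, 'k) mpoly" where
  "var_act x g = (\<lambda>a. indet x * g a)"

lemma vscale_apply [simp]: "vscale c g a = pscale c (g a)"
  by (simp add: vscale_def)

lemma vector_space_vscale: "vector_space (vscale :: 'k::field \<Rightarrow> (nat \<Rightarrow> ('v, 'k) mpoly) \<Rightarrow> _)"
  unfolding vscale_def by (rule vector_space_fscale) (rule vector_space_pscale)

lemma koszul_poly:
  assumes "finite V" "inj_on f V"
  shows "koszul (vscale :: 'k::field \<Rightarrow> (nat \<Rightarrow> ('v, 'k) mpoly) \<Rightarrow> _) V f var_act"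
proof -
  interpret vector_space "vscale :: 'k \<Rightarrow> (nat \<Rightarrow> ('v, 'k) mpoly) \<Rightarrow> _" by (rule vector_space_vscale)
  show ?thesis
    by unfold_locales (auto simp: assms var_act_def fun_eq_iff pscale_def algebra_simps)
qed

lemma koszul_scalar:
  assumes "finite V" "inj_on f V"
  shows "koszul ((*) :: 'k::field \<Rightarrow> 'k \<Rightarrow> 'k) V f (\<lambda>_ b. b)"
proof -
  interpret vector_space "(*) :: 'k \<Rightarrow> 'k \<Rightarrow> 'k" by (rule vector_space_times)
  show ?thesis
    by unfold_locales (auto simp: assms algebra_simps)
qed

text \<open>Degree j of the free module of rank n with twists d. Vectors are functions that vanish
  from n on, so modules of all ranks live in one type and one interpretation of the Koszul locale
  covers them all.\<close>

definition free_piece :: "'v set \<Rightarrow> nat \<Rightarrow> (nat \<Rightarrow> int) \<Rightarrow> int \<Rightarrow> (nat \<Rightarrow> ('v, 'k::field) mpoly) set" where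
  "(free_piece V n d j :: (nat \<Rightarrow> ('v, 'k::field) mpoly) set) = {g. (\<forall>a<n. g a \<in> poly_ring V \<and> homogeneous (j - d a) (g a)) \<and> (\<forall>a\<ge>n. g a = 0)}"

lemma poly_ring_homogeneous_iff:
  "p \<in> poly_ring V \<and> homogeneous e p \<longleftrightarrow> (\<forall>m. lookup p m \<noteq> 0 \<longrightarrow> m \<in> monomials V e)"
  by (auto simp: poly_ring_def homogeneous_def monomials_def in_keys_iff)

lemma free_piece_alt:
  "(free_piece V n d j :: (nat \<Rightarrow> ('v, 'k::field) mpoly) set) = {g. \<forall>a m. lookup (g a) m \<noteq> 0 \<longrightarrow> a < n \<and> m \<in> monomials V (j - d a)}"
proof (rule Set.set_eqI)
  fix g :: "nat \<Rightarrow> ('v, 'k) mpoly"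
  have "g a = 0 \<longleftrightarrow> (\<forall>m. lookup (g a) m = 0)" for a
    by (auto intro: poly_mapping_eqI)
  then show "g \<in> free_piece V n d j \<longleftrightarrow> g \<in> {g. \<forall>a m. lookup (g a) m \<noteq> 0 \<longrightarrow> a < n \<and> m \<in> monomials V (j - d a)}"
    unfolding free_piece_def poly_ring_homogeneous_iff mem_Collect_eq
    by (metis not_le)
qed

lemma minus_single_monomial:
  assumes "x \<in> keys m" "m - single x 1 \<in> monomials V e"
  shows "keys m \<subseteq> insert x V" "int (mon_degree m) = e + 1"
proof -
  have eq: "m = (m - single x 1) + single x 1"
    using assms(1) by (intro poly_mapping_eqI) (auto simp: lookup_add lookup_minus lookup_single when_def in_keys_iff)
  show "keys m \<subseteq> insert x V" using assms(2) by (subst eq) (auto simp: keys_plus_nat monomials_def)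
  show "int (mon_degree m) = e + 1"
    using assms(2) by (subst eq) (auto simp: mon_degree_add mon_degree_single monomials_def)
qed

section \<open>Decomposition by multidegree\<close>

text \<open>A monomial m at the set S has multidegree \<open>m + sqf_mon S\<close>; the strand of
  multidegree \<alpha> is therefore a scalar function on subsets of the support of \<alpha>. The
  guard is there because subtraction of exponents is truncated.\<close>

definition multi_part :: "nat \<Rightarrow> ('v \<Rightarrow>\<^sub>0 nat) \<Rightarrow> ('v set \<Rightarrow> nat \<Rightarrow> ('v, 'k::field) mpoly) \<Rightarrow> 'v set \<Rightarrow> 'k" where
  "multi_part a \<alpha> c S = (if S \<subseteq> keys \<alpha> then lookup (c S a) (\<alpha> - sqf_mon S) else 0)"

lemma lookup_multi_part:
  "finite S \<Longrightarrow> lookup (c S a) m = multi_part a (m + sqf_mon S) c S"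
  by (auto simp: multi_part_def keys_plus_nat keys_sqf_mon)

text \<open>The differential moves a vertex x from the index set into the monomial. Multidegrees are
  preserved and only signs remain as coefficients, so each strand is a simplicial chain over the
  field.\<close>

lemma multi_part_diff: "multi_part a \<alpha> (kdiff V f vscale var_act c) = sdiff V f (multi_part a \<alpha> c)"
proof
  fix T
  show "multi_part a \<alpha> (kdiff V f vscale var_act c) T = sdiff V f (multi_part a \<alpha> c) T"
  proof (cases "T \<subseteq> keys \<alpha>")
    case False
    then show ?thesis by (auto simp: multi_part_def kdiff_def intro!: sum.neutral)
  next
    case True
    then have fT: "finite T" by (rule finite_subset) simp
    have "lookup (indet x * c (insert x T) a) (\<alpha> - sqf_mon T) = multi_part a \<alpha> c (insert x T)"
      if "x \<in> V - T" for x
    proof -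
      have "x \<in> keys (\<alpha> - sqf_mon T) \<longleftrightarrow> x \<in> keys \<alpha>"
        using that fT by (simp add: in_keys_iff lookup_minus lookup_sqf_mon)
      moreover have "\<alpha> - sqf_mon T - single x 1 = \<alpha> - sqf_mon (insert x T)"
        using that fT by (simp add: sqf_mon_def add.commute diff_diff_eq)
      ultimately show ?thesis using True by (simp add: lookup_indet_mult multi_part_def)
    qed
    then show ?thesis using True
      by (simp add: multi_part_def[of a \<alpha> "kdiff _ _ _ _ _"] kdiff_def sum_fun_apply lookup_sum
          var_act_def lookup_pscale)
  qed
qed

text \<open>The inverse of taking multigraded strands. The monomials have degree
  \<open>j - d a - int p\<close>, because p of the total degree is carried by the set S.\<close>

definition assemble :: "'v set \<Rightarrow> nat \<Rightarrow> (nat \<Rightarrow> int) \<Rightarrow> nat \<Rightarrow> int \<Rightarrow> (nat \<Rightarrow> ('v \<Rightarrow>\<^sub>0 nat) \<Rightarrow> 'v set \<Rightarrow> 'k) \<Rightarrow>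
    'v set \<Rightarrow> nat \<Rightarrow> ('v, 'k::field) mpoly" where
  "assemble V n d p j g S a = (if S \<subseteq> V \<and> card S = p \<and> a < n
     then \<Sum>m\<in>monomials V (j - d a - int p). single m (g a (m + sqf_mon S) S) else 0)"

text \<open>The parameter \<open>coeff_type\<close> only fixes the field \<open>'k\<close>, which \<open>V\<close> and \<open>f\<close> do not determine.\<close>

locale poly_koszul =
  fixes V :: "'v set" and f :: "'v \<Rightarrow> nat" and coeff_type :: "'k::field itself"
  assumes fin: "finite V" and inj: "inj_on f V"
begin

sublocale koszul "vscale :: 'k \<Rightarrow> (nat \<Rightarrow> ('v, 'k) mpoly) \<Rightarrow> _" V f var_act
  by (rule koszul_poly[OF fin inj])

sublocale sc: koszul "(*) :: 'k \<Rightarrow> 'k \<Rightarrow> 'k" V f "\<lambda>_ b. b"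
  by (rule koszul_scalar[OF fin inj])

lemma lookup_assemble: "lookup (assemble V n d p j g S a) m =
   (if S \<subseteq> V \<and> card S = p \<and> a < n \<and> m \<in> monomials V (j - d a - int p) then g a (m + sqf_mon S) S else 0)"
  using finite_monomials[OF fin, of "j - d a - int p"]
  by (simp add: assemble_def lookup_sum lookup_single when_def)

lemma graded_free_piece: "graded_sub (free_piece V n d)"
  unfolding graded_sub_def
proof (intro conjI allI ballI)
  show "subspace (free_piece V n d j)" for j
  proof (unfold subspace_def, intro conjI ballI allI)
    show "0 \<in> free_piece V n d j" by (simp add: free_piece_alt)
    fix g :: "nat \<Rightarrow> ('v, 'k) mpoly" assume g: "g \<in> free_piece V n d j"
    { fix h :: "nat \<Rightarrow> ('v, 'k) mpoly" assume h: "h \<in> free_piece V n d j"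
      have "lookup (g a) m \<noteq> 0 \<or> lookup (h a) m \<noteq> 0" if "lookup (g a + h a) m \<noteq> 0" for a m
        using that by (auto simp: lookup_add)
      then show "g + h \<in> free_piece V n d j"
        using g h unfolding free_piece_alt by fastforce }
    show "vscale c g \<in> free_piece V n d j" for c using g by (auto simp: free_piece_alt lookup_pscale)
  qed
  fix x j and g :: "nat \<Rightarrow> ('v, 'k) mpoly" assume "x \<in> V" "g \<in> free_piece V n d j"
  then show "var_act x g \<in> free_piece V n d (j + 1)"
    using minus_single_monomial[of x _ V]
    by (auto simp: free_piece_alt var_act_def lookup_indet_mult monomials_def insert_absorb split: if_splits)
qed

lemma multi_part_chain:
  assumes "c \<in> K (free_piece V n d) p j"
  shows "multi_part a \<alpha> c \<in> schains (Pow (keys \<alpha>)) p"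
  unfolding schains_def
proof (intro CollectI allI impI)
  fix S assume "multi_part a \<alpha> c S \<noteq> 0"
  then have "S \<subseteq> keys \<alpha>" "c S \<noteq> 0" by (auto simp: multi_part_def split: if_splits)
  then show "S \<in> Pow (keys \<alpha>) \<and> card S = p" using assms by (auto simp: kchains_def)
qed

text \<open>Component a of a chain of degree j has only multidegrees of total degree
  \<open>j - d a\<close>, so comparing these finitely many strands suffices.\<close>

lemma chain_eqI:
  assumes c: "c \<in> K (free_piece V n d) p j" "c' \<in> K (free_piece V n d) p j"
    and eq: "\<And>a \<alpha>. a < n \<Longrightarrow> \<alpha> \<in> monomials V (j - d a) \<Longrightarrow> multi_part a \<alpha> c = multi_part a \<alpha> c'"
  shows "c = c'"
proof (intro ext poly_mapping_eqI)
  fix S a m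
  have "lookup (e S a) m = 0" if "e \<in> K (free_piece V n d) p j"
      "\<not> (S \<subseteq> V \<and> card S = p \<and> a < n \<and> m \<in> monomials V (j - d a - int p))" for e
  proof (rule ccontr)
    assume "lookup (e S a) m \<noteq> 0"
    moreover from this have "e S \<noteq> 0" by auto
    ultimately show False using that by (auto simp: kchains_def free_piece_alt algebra_simps)
  qed
  moreover have "lookup (c S a) m = lookup (c' S a) m"
    if *: "S \<subseteq> V" "card S = p" "a < n" "m \<in> monomials V (j - d a - int p)"
  proof -
    have "finite S" using * fin finite_subset by blast
    moreover have "m + sqf_mon S \<in> monomials V (j - d a)"
      using * \<open>finite S\<close> by (auto simp: monomials_def keys_plus_nat keys_sqf_mon mon_degree_add mon_degree_sqf_mon)
    ultimately show ?thesis using eq * by (simp add: lookup_multi_part)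
  qed
  ultimately show "lookup (c S a) m = lookup (c' S a) m" using c by metis
qed

lemma assemble_chain: "assemble V n d p j g \<in> K (free_piece V n d) p j"
  unfolding kchains_def
proof (intro CollectI allI impI)
  fix S assume nz: "assemble V n d p j g S \<noteq> 0"
  then have "S \<subseteq> V \<and> card S = p" by (auto simp: assemble_def fun_eq_iff split: if_splits)
  moreover have "assemble V n d p j g S \<in> free_piece V n d (j - int p)"
    by (auto simp: free_piece_alt lookup_assemble algebra_simps split: if_splits)
  ultimately show "S \<subseteq> V \<and> card S = p \<and> assemble V n d p j g S \<in> free_piece V n d (j - int p)" by simp
qed

lemma multi_part_assemble:
  assumes g: "g a \<alpha> \<in> schains (Pow (keys \<alpha>)) p" and "a < n" and \<alpha>: "\<alpha> \<in> monomials V (j - d a)"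
  shows "multi_part a \<alpha> (assemble V n d p j g) = g a \<alpha>"
proof
  fix S
  show "multi_part a \<alpha> (assemble V n d p j g) S = g a \<alpha> S"
  proof (cases "S \<subseteq> keys \<alpha> \<and> card S = p")
    case False
    then show ?thesis using g by (auto simp: multi_part_def schains_def lookup_assemble)
  next
    case True
    then have "finite S" by (meson finite_keys finite_subset)
    have eq: "\<alpha> - sqf_mon S + sqf_mon S = \<alpha>" using True by (simp add: minus_sqf_mon_add)
    then have "keys (\<alpha> - sqf_mon S) \<subseteq> keys \<alpha>" "mon_degree (\<alpha> - sqf_mon S) + p = mon_degree \<alpha>"
      by (metis Un_upper1 keys_plus_nat, metis \<open>finite S\<close> True mon_degree_add mon_degree_sqf_mon)
    then have "\<alpha> - sqf_mon S \<in> monomials V (j - d a - int p)" "keys \<alpha> \<subseteq> V"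
      using \<alpha> by (auto simp: monomials_def)
    then show ?thesis using True \<open>a < n\<close> by (auto simp: multi_part_def lookup_assemble eq)
  qed
qed

text \<open>In a multidegree \<alpha> \<noteq> 0 the strand lives on the full simplex on the support
  of \<alpha>, a cone over any of its vertices. Multidegree 0 contains only the empty set, which
  matters for p = 0 alone, and there \<open>const\<close> makes the strand vanish.\<close>

lemma free_exact:
  assumes c: "c \<in> K (free_piece V n d) p j" "D c = (0 :: 'v set \<Rightarrow> nat \<Rightarrow> ('v, 'k) mpoly)"
    and const: "\<And>a. p = 0 \<Longrightarrow> a < n \<Longrightarrow> lookup (c {} a) 0 = 0"
  shows "c \<in> kbounds (free_piece V n d) p j"
proof -
  have "\<exists>w. w \<in> schains (Pow (keys \<alpha>)) (Suc p) \<and> sdiff V f w = multi_part a \<alpha> c"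
    if a: "a < n" and \<alpha>: "\<alpha> \<in> monomials V (j - d a)" for a \<alpha>
  proof (cases "\<alpha> = 0")
    case True
    have "multi_part a \<alpha> c = 0"
    proof
      fix S show "multi_part a \<alpha> c S = 0 S"
      proof (cases "S = {} \<and> p = 0")
        case True
        then show ?thesis using const[OF _ a] \<open>\<alpha> = 0\<close> by (simp add: multi_part_def sqf_mon_def)
      next
        case False
        then show ?thesis using multi_part_chain[OF c(1), of a \<alpha>] \<open>\<alpha> = 0\<close> by (auto simp: schains_def)
      qed
    qed
    then show ?thesis by (intro exI[of _ 0]) (simp add: schains_def kdiff_def fun_eq_iff)
  next
    case False
    then have "\<exists>v. v \<in> keys \<alpha>" by (simp flip: keys_eq_empty add: ex_in_conv)
    then obtain v where v: "v \<in> keys \<alpha>" by blast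
    have sub: "keys \<alpha> \<subseteq> V" using \<alpha> by (simp add: monomials_def)
    have "sdiff V f (multi_part a \<alpha> c) = 0"
      using c(2) by (simp flip: multi_part_diff) (auto simp: multi_part_def fun_eq_iff)
    then show ?thesis
      using cone_exact[OF fin inj, of "Pow (keys \<alpha>)" v "multi_part a \<alpha> c" p] v sub multi_part_chain[OF c(1)]
      by (metis Pow_iff Pow_mono insert_subset subsetD)
  qed
  then obtain g where g: "\<And>a \<alpha>. a < n \<Longrightarrow> \<alpha> \<in> monomials V (j - d a) \<Longrightarrow>
     g a \<alpha> \<in> schains (Pow (keys \<alpha>)) (Suc p) \<and> sdiff V f (g a \<alpha>) = multi_part a \<alpha> c" by metis
  define w :: "'v set \<Rightarrow> nat \<Rightarrow> ('v, 'k) mpoly" where "w = assemble V n d (Suc p) j g"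
  have w: "w \<in> K (free_piece V n d) (Suc p) j" unfolding w_def by (rule assemble_chain)
  have "D w = c"
  proof (rule chain_eqI[OF D_chain[OF graded_free_piece w] c(1)])
    fix a \<alpha> assume "a < n" "\<alpha> \<in> monomials V (j - d a)"
    then show "multi_part a \<alpha> (D w) = multi_part a \<alpha> c"
      using g unfolding multi_part_diff w_def by (simp add: multi_part_assemble)
  qed
  with w show ?thesis unfolding kbounds_def by blast
qed

text \<open>\<open>L\<close> reads off constant terms. Boundaries have none, and by
  \<open>free_exact\<close> a chain without constant terms is a boundary; a constant in component b
  occurs in degree \<open>d b\<close> only.\<close>

lemma khom_free:
  "khom (free_piece V n d) 0 j (card {b\<in>{..<n}. d b = j})"
proof -
  let ?A = "{b\<in>{..<n}. d b = j}"
  define L where "L c = (\<lambda>b. if b \<in> ?A then lookup (c {} b) 0 else 0)" for c :: "'v set \<Rightarrow> nat \<Rightarrow> ('v, 'k) mpoly"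
  have lin: "Vector_Spaces.linear (fscale vscale) (fscale (*)) L"
    by (rule linearI[OF chains.vector_space_axioms vector_space_fscale[OF vector_space_times]])
      (auto simp: L_def fun_eq_iff lookup_add lookup_pscale)
  have Z: "kcycles (free_piece V n d) 0 j = K (free_piece V n d) 0 j"
    using D_chain_0 by (auto simp: kcycles_def)
  have "khom (free_piece V n d) 0 j (card ?A) \<longleftrightarrow>
      has_qdim (fscale (*)) {g. \<forall>a. g a \<noteq> (0::'k) \<longrightarrow> a \<in> ?A} {0} (card ?A)"
    unfolding khom_def
  proof (rule has_qdim_transfer[OF lin subspace_cycles[OF graded_free_piece]], unfold Z)
    show "L ` K (free_piece V n d) 0 j = {g. \<forall>a. g a \<noteq> 0 \<longrightarrow> a \<in> ?A}"
    proof safe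
      fix h :: "nat \<Rightarrow> 'k" assume h: "\<forall>a. h a \<noteq> 0 \<longrightarrow> a \<in> ?A"
      define c :: "'v set \<Rightarrow> nat \<Rightarrow> ('v, 'k) mpoly" where "c S b = (if S = {} then single 0 (h b) else 0)" for S b
      have "c \<in> K (free_piece V n d) 0 j" unfolding kchains_def
      proof (intro CollectI allI impI)
        fix S assume "c S \<noteq> 0"
        then have "S = {}" by (auto simp: c_def fun_eq_iff split: if_splits)
        moreover have "c {} \<in> free_piece V n d (j - int 0)"
          using h by (auto simp: free_piece_alt c_def lookup_single when_def monomials_def split: if_splits)
        ultimately show "S \<subseteq> V \<and> card S = 0 \<and> c S \<in> free_piece V n d (j - int 0)" by simp
      qed
      moreover have "L c = h" using h by (auto simp: L_def c_def fun_eq_iff)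
      ultimately show "h \<in> L ` K (free_piece V n d) 0 j" by blast
    qed (auto simp: L_def split: if_splits)
    fix c :: "'v set \<Rightarrow> nat \<Rightarrow> ('v, 'k) mpoly" assume c: "c \<in> K (free_piece V n d) 0 j"
    have const: "lookup (c {} a) 0 = 0" if "a < n" "d a \<noteq> j" for a
    proof (rule ccontr)
      assume "lookup (c {} a) 0 \<noteq> 0"
      then have "0 \<in> monomials V (j - d a)"
        using chain_mem[OF graded_free_piece c, of "{}"] by (simp add: free_piece_alt)
      then show False using that by (simp add: monomials_def)
    qed
    show "c \<in> kbounds (free_piece V n d) 0 j \<longleftrightarrow> L c \<in> {0}"
    proof
      assume "c \<in> kbounds (free_piece V n d) 0 j"
      then obtain w where "c = D w" by (auto simp: kbounds_def)
      then have "lookup (c {} a) 0 = 0" for a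
        by (simp add: kdiff_def sum_fun_apply lookup_sum lookup_pscale var_act_def lookup_indet_mult)
      then show "L c \<in> {0}" by (auto simp: L_def fun_eq_iff)
    next
      assume "L c \<in> {0}"
      then have L0: "L c b = 0" for b by simp
      have "lookup (c {} b) 0 = 0" if "b < n" for b
        using const[OF that] that L0[of b] by (cases "d b = j") (simp_all add: L_def)
      then show "c \<in> kbounds (free_piece V n d) 0 j"
        using c D_chain_0[OF c] by (intro free_exact) auto
    qed
  qed
  then show ?thesis using has_qdim_functions[of ?A] by simp
qed

end


section \<open>Koszul homology of monomial ideals\<close>

text \<open>The upper Koszul simplicial complex of the ideal in degree \<alpha>: the sets S for
  which the monomial \<alpha> divided by the product of S still lies in the ideal.\<close>

definition nonface_complex :: "'v set set \<Rightarrow> ('v \<Rightarrow>\<^sub>0 nat) \<Rightarrow> 'v set set" where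
  "nonface_complex \<G> \<alpha> = {S. S \<subseteq> keys \<alpha> \<and> (\<exists>A\<in>\<G>. A \<subseteq> keys (\<alpha> - sqf_mon S))}"

text \<open>The ideal generated by squarefree monomials, described by the supports of its monomials;
  this form makes the multigraded strands visible. Agreement with \<open>ideal_gen\<close> is the
  content of \<open>ideal_gen_squarefree\<close>.\<close>

definition mon_ideal :: "'v set \<Rightarrow> 'v set set \<Rightarrow> ('v, 'k::field) mpoly set" where
  "mon_ideal V \<G> = {p \<in> poly_ring V. \<forall>m\<in>keys p. \<exists>A\<in>\<G>. A \<subseteq> keys m}"

text \<open>The ideal as a graded submodule of the free module of rank one. Homology is taken of the
  ideal instead of its quotient, which later shifts homological degrees by one.\<close>

definition ideal_piece :: "'v set \<Rightarrow> 'v set set \<Rightarrow> int \<Rightarrow> (nat \<Rightarrow> ('v, 'k::field) mpoly) set" where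
  "ideal_piece V \<G> j = {g \<in> free_piece V 1 (\<lambda>_. 0) j. g 0 \<in> mon_ideal V \<G>}"

lemma ideal_piece_alt:
  "ideal_piece V \<G> j = {g. \<forall>a m. lookup (g a) m \<noteq> 0 \<longrightarrow> a = 0 \<and> m \<in> monomials V j \<and> (\<exists>A\<in>\<G>. A \<subseteq> keys m)}"
proof (rule Set.set_eqI)
  fix g
  have "g \<in> ideal_piece V \<G> j \<longleftrightarrow> (\<forall>a m. lookup (g a) m \<noteq> 0 \<longrightarrow> a = 0 \<and> m \<in> monomials V j) \<and>
     (\<forall>m. lookup (g 0) m \<noteq> 0 \<longrightarrow> keys m \<subseteq> V \<and> (\<exists>A\<in>\<G>. A \<subseteq> keys m))"
    by (auto simp: ideal_piece_def free_piece_alt mon_ideal_def poly_ring_def in_keys_iff)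
  also have "\<dots> \<longleftrightarrow> (\<forall>a m. lookup (g a) m \<noteq> 0 \<longrightarrow> a = 0 \<and> m \<in> monomials V j \<and> (\<exists>A\<in>\<G>. A \<subseteq> keys m))"
    unfolding monomials_def by blast
  finally show "g \<in> ideal_piece V \<G> j \<longleftrightarrow> g \<in> {g. \<forall>a m. lookup (g a) m \<noteq> 0 \<longrightarrow> a = 0 \<and> m \<in> monomials V j \<and> (\<exists>A\<in>\<G>. A \<subseteq> keys m)}"
    by simp
qed

lemma nonface_complex_mono:
  assumes "S \<in> nonface_complex \<G> \<alpha>" "S' \<subseteq> S" shows "S' \<in> nonface_complex \<G> \<alpha>"
proof -
  from assms(1) obtain A where A: "A \<in> \<G>" "A \<subseteq> keys (\<alpha> - sqf_mon S)" and S: "S \<subseteq> keys \<alpha>"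
    by (auto simp: nonface_complex_def)
  then have "finite S" "finite S'" using assms(2) by (meson finite_keys finite_subset)+
  then have "keys (\<alpha> - sqf_mon S) \<subseteq> keys (\<alpha> - sqf_mon S')"
    using assms(2) by (auto simp: in_keys_iff lookup_minus lookup_sqf_mon split: if_splits)
  then show ?thesis using A S assms(2) by (auto simp: nonface_complex_def)
qed

text \<open>Removing one copy of x from an exponent of at least 2 keeps x in the support, so
  divisibility by the generator survives.\<close>

lemma nonface_complex_cone:
  assumes x: "lookup \<alpha> x \<ge> 2" and S: "S \<in> nonface_complex \<G> \<alpha>"
  shows "insert x S \<in> nonface_complex \<G> \<alpha>"
proof -
  from S obtain A where A: "A \<in> \<G>" "A \<subseteq> keys (\<alpha> - sqf_mon S)" and S: "S \<subseteq> keys \<alpha>"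
    by (auto simp: nonface_complex_def)
  then have "finite S" by (meson finite_keys finite_subset)
  then have "keys (\<alpha> - sqf_mon S) \<subseteq> keys (\<alpha> - sqf_mon (insert x S))"
    using x by (auto simp: in_keys_iff lookup_minus lookup_sqf_mon split: if_splits)
  moreover have "x \<in> keys \<alpha>" using x by (simp add: in_keys_iff)
  ultimately show ?thesis using A S unfolding nonface_complex_def by blast
qed

lemma nonface_complex_sqf_mon:
  assumes "finite W"
  shows "nonface_complex \<G> (sqf_mon W) = {S. S \<subseteq> W \<and> (\<exists>A\<in>\<G>. A \<subseteq> W - S)}"
proof -
  have "keys (sqf_mon W - sqf_mon S) = W - S" if "S \<subseteq> W" for S
    using assms finite_subset[OF that assms]
    by (auto simp: in_keys_iff lookup_minus lookup_sqf_mon split: if_splits)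
  then show ?thesis unfolding nonface_complex_def keys_sqf_mon[OF assms]
    by (intro Collect_cong conj_cong refl) simp
qed

section \<open>Simplicial homology and complementary cochains\<close>

definition scycles :: "'v set \<Rightarrow> ('v \<Rightarrow> nat) \<Rightarrow> 'v set set \<Rightarrow> nat \<Rightarrow> ('v set \<Rightarrow> 'k::field) set" where
  "scycles V f \<S> p = {g \<in> schains \<S> p. sdiff V f g = 0}"

definition sbounds :: "'v set \<Rightarrow> ('v \<Rightarrow> nat) \<Rightarrow> 'v set set \<Rightarrow> nat \<Rightarrow> ('v set \<Rightarrow> 'k::field) set" where
  "sbounds V f \<S> p = sdiff V f ` schains \<S> (Suc p)"

text \<open>The simplicial coboundary with signs counted in the complement \<open>W - T\<close>, the
  form into which complementation turns \<open>sdiff\<close>. It differs from the usual convention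
  by rescaling each T with a sign.\<close>

definition codiff :: "('v \<Rightarrow> nat) \<Rightarrow> 'v set \<Rightarrow> ('v set \<Rightarrow> 'k::field) \<Rightarrow> 'v set \<Rightarrow> 'k" where
  "codiff f W g T = (\<Sum>x\<in>T. ksign f x (W - T) * g (T - {x}))"

text \<open>The index d is the number of vertices, so this belongs to reduced cohomology in degree d
  - 1. Closedness is tested on faces only, since nonfaces do not belong to the complex.\<close>

definition cocycles :: "('v \<Rightarrow> nat) \<Rightarrow> 'v set \<Rightarrow> 'v set set \<Rightarrow> nat \<Rightarrow> ('v set \<Rightarrow> 'k::field) set" where
  "cocycles f W \<Delta> d = {g. (\<forall>T. g T \<noteq> 0 \<longrightarrow> T \<subseteq> W \<and> T \<in> \<Delta> \<and> card T = d) \<and>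
     (\<forall>T. T \<subseteq> W \<longrightarrow> T \<in> \<Delta> \<longrightarrow> codiff f W g T = 0)}"

definition face_part :: "'v set \<Rightarrow> 'v set set \<Rightarrow> ('v set \<Rightarrow> 'k::field) \<Rightarrow> 'v set \<Rightarrow> 'k" where
  "face_part W \<Delta> g T = (if T \<subseteq> W \<and> T \<in> \<Delta> then g T else 0)"

text \<open>The primitive u ranges over cochains of the full simplex on W. For a complex closed
  under subsets this gives the same coboundaries, as facets of faces are faces, and it makes them
  truncations of the coboundaries of the simplex.\<close>

definition coboundaries :: "('v \<Rightarrow> nat) \<Rightarrow> 'v set \<Rightarrow> 'v set set \<Rightarrow> nat \<Rightarrow> ('v set \<Rightarrow> 'k::field) set" where
  "coboundaries f W \<Delta> d = {face_part W \<Delta> (codiff f W u) | u. \<forall>T. u T \<noteq> 0 \<longrightarrow> T \<subseteq> W \<and> Suc (card T) = d}"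

definition co_part :: "'v set \<Rightarrow> ('v set \<Rightarrow> 'k::field) \<Rightarrow> 'v set \<Rightarrow> 'k" where
  "co_part W g T = (if T \<subseteq> W then g (W - T) else 0)"

lemma co_part_co_part: "(\<And>T. g T \<noteq> 0 \<Longrightarrow> T \<subseteq> W) \<Longrightarrow> co_part W (co_part W g) = g"
  by (auto simp: co_part_def fun_eq_iff double_diff)

text \<open>Complementation exchanges removing x from T with adding x to \<open>W - T\<close>;
  vertices of V outside W contribute nothing because g lives on W.\<close>

lemma sdiff_co_part:
  assumes "finite V" "W \<subseteq> V" "T \<subseteq> W" and g: "\<And>T. g T \<noteq> 0 \<Longrightarrow> T \<subseteq> W"
  shows "sdiff V f g (W - T) = codiff f W (co_part W g) T"
proof -
  have "codiff f W (co_part W g) T = (\<Sum>x\<in>T. ksign f x (W - T) * g (insert x (W - T)))"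
    unfolding codiff_def
  proof (intro sum.cong refl)
    fix x assume "x \<in> T"
    then have "T - {x} \<subseteq> W" "W - (T - {x}) = insert x (W - T)" using assms(3) by auto
    then show "ksign f x (W - T) * co_part W g (T - {x}) = ksign f x (W - T) * g (insert x (W - T))"
      by (simp add: co_part_def)
  qed
  also have "\<dots> = (\<Sum>x\<in>V - (W - T). ksign f x (W - T) * g (insert x (W - T)))"
  proof (intro sum.mono_neutral_left ballI)
    fix x assume "x \<in> V - (W - T) - T"
    then have "g (insert x (W - T)) = 0" using g by blast
    then show "ksign f x (W - T) * g (insert x (W - T)) = 0" by simp
  qed (use assms in auto)
  finally show ?thesis by (simp add: kdiff_def)
qed

context poly_koszul
begin

lemma graded_ideal_piece: "graded_sub (ideal_piece V \<G>)"
  unfolding graded_sub_def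
proof (intro conjI allI ballI)
  show "subspace (ideal_piece V \<G> j)" for j
  proof (unfold subspace_def, intro conjI ballI allI)
    show "0 \<in> ideal_piece V \<G> j" by (simp add: ideal_piece_alt)
    fix g :: "nat \<Rightarrow> ('v, 'k) mpoly" assume g: "g \<in> ideal_piece V \<G> j"
    { fix h :: "nat \<Rightarrow> ('v, 'k) mpoly" assume h: "h \<in> ideal_piece V \<G> j"
      have "lookup (g a) m \<noteq> 0 \<or> lookup (h a) m \<noteq> 0" if "lookup ((g + h) a) m \<noteq> 0" for a m
        using that by (auto simp: lookup_add)
      then show "g + h \<in> ideal_piece V \<G> j"
        using g h unfolding ideal_piece_alt mem_Collect_eq by meson }
    show "vscale c g \<in> ideal_piece V \<G> j" for c using g by (auto simp: ideal_piece_alt lookup_pscale)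
  qed
  fix x j and g :: "nat \<Rightarrow> ('v, 'k) mpoly" assume x: "x \<in> V" and g: "g \<in> ideal_piece V \<G> j"
  show "var_act x g \<in> ideal_piece V \<G> (j + 1)"
    unfolding ideal_piece_alt
  proof (intro CollectI allI impI)
    fix a m assume "lookup (var_act x g a) m \<noteq> 0"
    then have m: "x \<in> keys m" "lookup (g a) (m - single x 1) \<noteq> 0"
      by (auto simp: var_act_def lookup_indet_mult split: if_splits)
    then have "a = 0" "m - single x 1 \<in> monomials V j" "\<exists>A\<in>\<G>. A \<subseteq> keys (m - single x 1)"
      using g by (auto simp: ideal_piece_alt)
    moreover have "keys (m - single x 1) \<subseteq> keys m" by (auto simp: in_keys_iff lookup_minus)
    ultimately show "a = 0 \<and> m \<in> monomials V (j + 1) \<and> (\<exists>A\<in>\<G>. A \<subseteq> keys m)"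
      using minus_single_monomial[OF m(1), of V j] x by (auto simp: monomials_def insert_absorb)
  qed
qed

lemma linear_sdiff: "Vector_Spaces.linear (fscale (*)) (fscale (*)) (sdiff V f :: ('v set \<Rightarrow> 'k) \<Rightarrow> _)"
  by (rule sc.linear_D)

lemma subspace_schains: "sc.chains.subspace (schains \<S> p)"
  by (auto simp: sc.chains.subspace_def schains_def) (metis add_0)+

lemma sdiff_schains:
  assumes \<S>: "\<S> \<subseteq> Pow V" "\<And>S S'. S \<in> \<S> \<Longrightarrow> S' \<subseteq> S \<Longrightarrow> S' \<in> \<S>" and g: "g \<in> schains \<S> (Suc p)"
  shows "sdiff V f g \<in> schains \<S> p"
  unfolding schains_def
proof (intro CollectI allI impI)
  fix T assume "sdiff V f g T \<noteq> 0"
  then obtain x where x: "x \<in> V - T" "ksign f x T * g (insert x T) \<noteq> 0"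
    unfolding kdiff_def by (rule sum.not_neutral_contains_not_neutral)
  then have T: "insert x T \<in> \<S>" "card (insert x T) = Suc p" using g by (auto simp: schains_def)
  then have "finite T" by (metis card.infinite finite_insert nat.distinct(1))
  then show "T \<in> \<S> \<and> card T = p" using T x \<S>(2)[OF T(1), of T] by auto
qed

lemma sdiff_sdiff:
  assumes "\<S> \<subseteq> Pow V" "g \<in> schains \<S> p" shows "sdiff V f (sdiff V f g) = (0 :: 'v set \<Rightarrow> 'k)"
  by (rule sc.D_D) (use assms in \<open>auto simp: schains_def\<close>)

lemma subspace_scycles: "sc.chains.subspace (scycles V f \<S> p)"
proof -
  interpret L: Vector_Spaces.linear "fscale (*)" "fscale (*)" "sdiff V f :: ('v set \<Rightarrow> 'k) \<Rightarrow> _"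
    by (rule linear_sdiff)
  show ?thesis using subspace_schains[of \<S> p]
    by (auto simp: scycles_def sc.chains.subspace_def L.zero L.add L.scale)
qed

lemma subspace_sbounds: "sc.chains.subspace (sbounds V f \<S> p)"
proof -
  interpret L: Vector_Spaces.linear "fscale (*)" "fscale (*)" "sdiff V f :: ('v set \<Rightarrow> 'k) \<Rightarrow> _"
    by (rule linear_sdiff)
  show ?thesis unfolding sbounds_def by (intro L.subspace_image subspace_schains)
qed

definition sdim :: "'v set set \<Rightarrow> nat \<Rightarrow> nat" where
  "sdim \<S> p = (THE n. has_qdim (fscale (*)) (scycles V f \<S> p) (sbounds V f \<S> p :: ('v set \<Rightarrow> 'k) set) n)"

lemma sdim_eqI:
  assumes "has_qdim (fscale (*)) (scycles V f \<S> p) (sbounds V f \<S> p :: ('v set \<Rightarrow> 'k) set) n"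
  shows "sdim \<S> p = n"
  unfolding sdim_def
  using assms has_qdim_unique[OF sc.chains.vector_space_axioms subspace_sbounds] by blast

lemma sdim:
  assumes "\<S> \<subseteq> Pow V"
  shows "has_qdim (fscale (*)) (scycles V f \<S> p) (sbounds V f \<S> p :: ('v set \<Rightarrow> 'k) set) (sdim \<S> p)"
proof -
  have "scycles V f \<S> p \<subseteq> {g. \<forall>a. g a \<noteq> (0::'k) \<longrightarrow> a \<in> Pow V}"
    using assms by (auto simp: scycles_def schains_def)
  then have "\<exists>n. has_qdim (fscale (*)) (scycles V f \<S> p) (sbounds V f \<S> p :: ('v set \<Rightarrow> 'k) set) n"
    using fin by (intro has_qdim_exists[OF sc.chains.vector_space_axioms subspace_scycles subspace_sbounds _
        has_qdim_functions[of "Pow V"]]) auto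
  then show ?thesis using sdim_eqI by blast
qed

lemma sdim_cone:
  assumes "\<S> \<subseteq> Pow V" "\<And>S S'. S \<in> \<S> \<Longrightarrow> S' \<subseteq> S \<Longrightarrow> S' \<in> \<S>"
    and "v \<in> V" "\<And>S. S \<in> \<S> \<Longrightarrow> insert v S \<in> \<S>"
  shows "sdim \<S> p = 0"
proof (rule sdim_eqI)
  have "scycles V f \<S> p = (sbounds V f \<S> p :: ('v set \<Rightarrow> 'k) set)"
  proof safe
    fix g :: "'v set \<Rightarrow> 'k" assume "g \<in> scycles V f \<S> p"
    then show "g \<in> sbounds V f \<S> p"
      using cone_exact[OF fin inj assms(1,3,4), of g p] by (auto simp: scycles_def sbounds_def)
  next
    fix g :: "'v set \<Rightarrow> 'k" assume "g \<in> sbounds V f \<S> p"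
    then show "g \<in> scycles V f \<S> p"
      using sdiff_schains[OF assms(1,2)] sdiff_sdiff[OF assms(1)] by (auto simp: scycles_def sbounds_def)
  qed
  then show "has_qdim (fscale (*)) (scycles V f \<S> p) (sbounds V f \<S> p :: ('v set \<Rightarrow> 'k) set) 0"
    using has_qdim_self[OF sc.chains.vector_space_axioms subspace_sbounds] by metis
qed

section \<open>Homology of the ideal by multidegree\<close>

lemma multi_part_ideal_chain:
  assumes "c \<in> K (ideal_piece V \<G>) p j"
  shows "multi_part 0 \<alpha> c \<in> schains (nonface_complex \<G> \<alpha>) p"
  unfolding schains_def
proof (intro CollectI allI impI)
  fix S assume "multi_part 0 \<alpha> c S \<noteq> 0"
  then have *: "S \<subseteq> keys \<alpha>" "lookup (c S 0) (\<alpha> - sqf_mon S) \<noteq> 0"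
    by (auto simp: multi_part_def split: if_splits)
  then have "c S \<noteq> 0" by auto
  then have "card S = p" "c S \<in> ideal_piece V \<G> (j - int p)" using assms by (auto simp: kchains_def)
  then show "S \<in> nonface_complex \<G> \<alpha> \<and> card S = p"
    using * by (auto simp: ideal_piece_alt nonface_complex_def)
qed

lemma ideal_chain_free: "K (ideal_piece V \<G>) p j \<subseteq> (K (free_piece V 1 (\<lambda>_. 0)) p j :: ('v set \<Rightarrow> nat \<Rightarrow> ('v, 'k) mpoly) set)"
  by (auto simp: kchains_def ideal_piece_def)

lemma assemble_ideal_chain:
  assumes g: "\<And>\<alpha>. \<alpha> \<in> monomials V j \<Longrightarrow> g \<alpha> \<in> schains (nonface_complex \<G> \<alpha>) p"
  shows "assemble V 1 (\<lambda>_. 0) p j (\<lambda>_. g) \<in> (K (ideal_piece V \<G>) p j :: ('v set \<Rightarrow> nat \<Rightarrow> ('v, 'k) mpoly) set)"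
  unfolding kchains_def
proof (intro CollectI allI impI)
  fix S assume nz: "assemble V 1 (\<lambda>_. 0) p j (\<lambda>_. g) S \<noteq> (0 :: nat \<Rightarrow> ('v, 'k) mpoly)"
  then have S: "S \<subseteq> V" "card S = p" and free: "assemble V 1 (\<lambda>_. 0) p j (\<lambda>_. g) S \<in> free_piece V 1 (\<lambda>_. 0) (j - int p)"
    using assemble_chain[of 1 "\<lambda>_. 0" p j "\<lambda>_. g"] by (auto simp: kchains_def)
  have fS: "finite S" using S(1) fin finite_subset by blast
  have "\<exists>A\<in>\<G>. A \<subseteq> keys m" if "lookup (assemble V 1 (\<lambda>_. 0) p j (\<lambda>_. g) S a) m \<noteq> 0" for a m
  proof -
    from that have m: "m \<in> monomials V (j - int p)" "g (m + sqf_mon S) S \<noteq> 0"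
      unfolding lookup_assemble by (auto split: if_splits)
    then have "m + sqf_mon S \<in> monomials V j"
      using S fS by (auto simp: monomials_def keys_plus_nat keys_sqf_mon mon_degree_add mon_degree_sqf_mon)
    then have "S \<in> nonface_complex \<G> (m + sqf_mon S)" using g m(2) by (auto simp: schains_def)
    then show ?thesis by (auto simp: nonface_complex_def)
  qed
  then show "S \<subseteq> V \<and> card S = p \<and> assemble V 1 (\<lambda>_. 0) p j (\<lambda>_. g) S \<in> ideal_piece V \<G> (j - int p)"
    using S free by (auto simp: ideal_piece_alt free_piece_alt)
qed

text \<open>\<open>M\<close> sends a chain to all its strands of total degree j at once, and
  \<open>assemble\<close> inverts it; the homology becomes a finite product of simplicial
  homologies.\<close>

lemma khom_ideal_multigraded:
  "khom (ideal_piece V \<G>) p j (\<Sum>\<alpha>\<in>monomials V j. sdim (nonface_complex \<G> \<alpha>) p)"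
proof -
  define M :: "('v set \<Rightarrow> nat \<Rightarrow> ('v, 'k) mpoly) \<Rightarrow> ('v \<Rightarrow>\<^sub>0 nat) \<Rightarrow> 'v set \<Rightarrow> 'k" where
    "M c = (\<lambda>\<alpha>. if \<alpha> \<in> monomials V j then multi_part 0 \<alpha> c else 0)" for c
  have lin: "Vector_Spaces.linear (fscale vscale) (fscale (fscale (*))) M"
    by (rule linearI[OF chains.vector_space_axioms vector_space_fscale[OF sc.chains.vector_space_axioms]])
      (auto simp: M_def fun_eq_iff multi_part_def lookup_add lookup_pscale)
  let ?\<S> = "nonface_complex \<G>"
  let ?Z = "\<lambda>\<alpha>. scycles V f (?\<S> \<alpha>) p :: ('v set \<Rightarrow> 'k) set"
  let ?B = "\<lambda>\<alpha>. sbounds V f (?\<S> \<alpha>) p :: ('v set \<Rightarrow> 'k) set"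
  let ?A = "monomials V j"
  have \<S>V: "?\<S> \<alpha> \<subseteq> Pow V" if "\<alpha> \<in> ?A" for \<alpha> using that by (auto simp: nonface_complex_def monomials_def)
  have asm_eq: "multi_part 0 \<alpha> (assemble V 1 (\<lambda>_. 0) q j (\<lambda>_. g)) = g \<alpha>"
    if "\<alpha> \<in> ?A" "\<And>\<alpha>. \<alpha> \<in> ?A \<Longrightarrow> g \<alpha> \<in> schains (?\<S> \<alpha>) q" for \<alpha> q and g :: "_ \<Rightarrow> 'v set \<Rightarrow> 'k"
    using that(1) that(2)[OF that(1)]
    by (intro multi_part_assemble) (auto simp: schains_def nonface_complex_def)
  have "khom (ideal_piece V \<G>) p j n \<longleftrightarrow>
     has_qdim (fscale (fscale (*))) {g. (\<forall>\<alpha>\<in>?A. g \<alpha> \<in> ?Z \<alpha>) \<and> (\<forall>\<alpha>. \<alpha> \<notin> ?A \<longrightarrow> g \<alpha> = 0)}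
       {g. (\<forall>\<alpha>\<in>?A. g \<alpha> \<in> ?B \<alpha>) \<and> (\<forall>\<alpha>. \<alpha> \<notin> ?A \<longrightarrow> g \<alpha> = 0)} n" for n
    unfolding khom_def
  proof (rule has_qdim_transfer[OF lin subspace_cycles[OF graded_ideal_piece]])
    show "M ` kcycles (ideal_piece V \<G>) p j = {g. (\<forall>\<alpha>\<in>?A. g \<alpha> \<in> ?Z \<alpha>) \<and> (\<forall>\<alpha>. \<alpha> \<notin> ?A \<longrightarrow> g \<alpha> = 0)}"
    proof (intro equalityI subsetI)
      fix g assume "g \<in> M ` kcycles (ideal_piece V \<G>) p j"
      then obtain c where c: "c \<in> K (ideal_piece V \<G>) p j" "D c = 0" "g = M c" by (auto simp: kcycles_def)
      have "sdiff V f (multi_part 0 \<alpha> c) = 0" for \<alpha>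
        using c(2) by (simp flip: multi_part_diff) (auto simp: multi_part_def fun_eq_iff)
      then show "g \<in> {g. (\<forall>\<alpha>\<in>?A. g \<alpha> \<in> ?Z \<alpha>) \<and> (\<forall>\<alpha>. \<alpha> \<notin> ?A \<longrightarrow> g \<alpha> = 0)}"
        using multi_part_ideal_chain[OF c(1)] by (auto simp: c(3) M_def scycles_def)
    next
      fix g assume g: "g \<in> {g. (\<forall>\<alpha>\<in>?A. g \<alpha> \<in> ?Z \<alpha>) \<and> (\<forall>\<alpha>. \<alpha> \<notin> ?A \<longrightarrow> g \<alpha> = 0)}"
      define c :: "'v set \<Rightarrow> nat \<Rightarrow> ('v, 'k) mpoly" where "c = assemble V 1 (\<lambda>_. 0) p j (\<lambda>_. g)"
      have gs: "\<And>\<alpha>. \<alpha> \<in> ?A \<Longrightarrow> g \<alpha> \<in> schains (?\<S> \<alpha>) p" using g by (auto simp: scycles_def)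
      have c: "c \<in> K (ideal_piece V \<G>) p j" unfolding c_def by (rule assemble_ideal_chain[OF gs])
      have Mc: "M c = g" using g asm_eq[OF _ gs] by (auto simp: M_def fun_eq_iff c_def)
      have "D c = 0"
      \<comment> \<open>For p = 0 every chain is closed; for positive p the chain \<open>D c\<close>
        has a homological degree q in which its strands can be compared with those of 0.\<close>
      proof (cases p)
        case 0 then show ?thesis using D_chain_0 c by simp
      next
        case (Suc q)
        have cF: "c \<in> K (free_piece V 1 (\<lambda>_. 0)) (Suc q) j" using c ideal_chain_free Suc by blast
        have "multi_part a \<alpha> (D c) = multi_part a \<alpha> 0" if "a < 1" "\<alpha> \<in> monomials V (j - 0)" for a \<alpha>
        proof -
          have "multi_part 0 \<alpha> (D c) = sdiff V f (g \<alpha>)"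
            using that asm_eq[OF _ gs] unfolding multi_part_diff c_def by simp
          then show ?thesis using g that by (auto simp: scycles_def multi_part_def fun_eq_iff)
        qed
        then show ?thesis
          using D_chain[OF graded_free_piece cF] by (intro chain_eqI[of "D c" 1 "\<lambda>_. 0" q j 0]) (auto simp: kchains_def)
      qed
      then show "g \<in> M ` kcycles (ideal_piece V \<G>) p j" using c Mc by (auto simp: kcycles_def)
    qed
    fix c assume "c \<in> kcycles (ideal_piece V \<G>) p j"
    then have c: "c \<in> K (ideal_piece V \<G>) p j" by (simp add: kcycles_def)
    show "c \<in> kbounds (ideal_piece V \<G>) p j \<longleftrightarrow> M c \<in> {g. (\<forall>\<alpha>\<in>?A. g \<alpha> \<in> ?B \<alpha>) \<and> (\<forall>\<alpha>. \<alpha> \<notin> ?A \<longrightarrow> g \<alpha> = 0)}"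
    proof
      assume "c \<in> kbounds (ideal_piece V \<G>) p j"
      then obtain w where "w \<in> K (ideal_piece V \<G>) (Suc p) j" "c = D w" by (auto simp: kbounds_def)
      then show "M c \<in> {g. (\<forall>\<alpha>\<in>?A. g \<alpha> \<in> ?B \<alpha>) \<and> (\<forall>\<alpha>. \<alpha> \<notin> ?A \<longrightarrow> g \<alpha> = 0)}"
        by (auto simp: M_def sbounds_def multi_part_diff intro!: imageI multi_part_ideal_chain)
    next
      assume "M c \<in> {g. (\<forall>\<alpha>\<in>?A. g \<alpha> \<in> ?B \<alpha>) \<and> (\<forall>\<alpha>. \<alpha> \<notin> ?A \<longrightarrow> g \<alpha> = 0)}"
      then have "\<forall>\<alpha>\<in>?A. \<exists>w. w \<in> schains (?\<S> \<alpha>) (Suc p) \<and> multi_part 0 \<alpha> c = sdiff V f w"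
        by (fastforce simp: M_def sbounds_def)
      then obtain g where g: "\<And>\<alpha>. \<alpha> \<in> ?A \<Longrightarrow> g \<alpha> \<in> schains (?\<S> \<alpha>) (Suc p)"
         "\<And>\<alpha>. \<alpha> \<in> ?A \<Longrightarrow> multi_part 0 \<alpha> c = sdiff V f (g \<alpha>)" by metis
      define w :: "'v set \<Rightarrow> nat \<Rightarrow> ('v, 'k) mpoly" where "w = assemble V 1 (\<lambda>_. 0) (Suc p) j (\<lambda>_. g)"
      have w: "w \<in> K (ideal_piece V \<G>) (Suc p) j" unfolding w_def by (rule assemble_ideal_chain[OF g(1)])
      have "multi_part a \<alpha> (D w) = multi_part a \<alpha> c" if "a < 1" "\<alpha> \<in> monomials V (j - 0)" for a \<alpha>
        using that g(2) asm_eq[OF _ g(1)] unfolding multi_part_diff w_def by simp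
      moreover have "D w \<in> K (free_piece V 1 (\<lambda>_. 0)) p j"
        using w ideal_chain_free by (intro D_chain[OF graded_free_piece]) blast
      moreover have "c \<in> K (free_piece V 1 (\<lambda>_. 0)) p j" using c ideal_chain_free by blast
      ultimately have "D w = c"
        using chain_eqI[of "D w" 1 "\<lambda>_. 0" p j c] by blast
      then show "c \<in> kbounds (ideal_piece V \<G>) p j" using w by (auto simp: kbounds_def)
    qed
  qed
  moreover have "has_qdim (fscale (fscale (*))) {g. (\<forall>\<alpha>\<in>?A. g \<alpha> \<in> ?Z \<alpha>) \<and> (\<forall>\<alpha>. \<alpha> \<notin> ?A \<longrightarrow> g \<alpha> = 0)}
       {g. (\<forall>\<alpha>\<in>?A. g \<alpha> \<in> ?B \<alpha>) \<and> (\<forall>\<alpha>. \<alpha> \<notin> ?A \<longrightarrow> g \<alpha> = 0)} (\<Sum>\<alpha>\<in>?A. sdim (?\<S> \<alpha>) p)"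
  proof (rule has_qdim_product[OF sc.chains.vector_space_axioms finite_monomials[OF fin]])
    fix \<alpha> assume \<alpha>: "\<alpha> \<in> ?A"
    have "?B \<alpha> \<subseteq> ?Z \<alpha>"
      using sdiff_schains[OF \<S>V[OF \<alpha>] nonface_complex_mono] sdiff_sdiff[OF \<S>V[OF \<alpha>]]
      by (auto simp: scycles_def sbounds_def)
    then show "sc.chains.subspace (?Z \<alpha>) \<and> sc.chains.subspace (?B \<alpha>) \<and> ?B \<alpha> \<subseteq> ?Z \<alpha> \<and>
        has_qdim (fscale (*)) (?Z \<alpha>) (?B \<alpha>) (sdim (?\<S> \<alpha>) p)"
      using subspace_scycles subspace_sbounds sdim[OF \<S>V[OF \<alpha>]] by blast
  qed
  ultimately show ?thesis by blast
qed

lemma khom_ideal: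
  "khom (ideal_piece V \<G>) p j (\<Sum>W | W \<subseteq> V \<and> int (card W) = j. sdim {S. S \<subseteq> W \<and> (\<exists>A\<in>\<G>. A \<subseteq> W - S)} p)"
proof -
  let ?P = "{W. W \<subseteq> V \<and> int (card W) = j}"
  have finW: "finite W" if "W \<subseteq> V" for W using that fin finite_subset by blast
  have sub: "sqf_mon ` ?P \<subseteq> monomials V j"
    using finW by (auto simp: monomials_def keys_sqf_mon mon_degree_sqf_mon)
  have "(\<Sum>\<alpha>\<in>monomials V j. sdim (nonface_complex \<G> \<alpha>) p) = (\<Sum>\<alpha>\<in>sqf_mon ` ?P. sdim (nonface_complex \<G> \<alpha>) p)"
  proof (rule sum.mono_neutral_right[OF finite_monomials[OF fin] sub], intro ballI)
    fix \<alpha> assume \<alpha>: "\<alpha> \<in> monomials V j - sqf_mon ` ?P"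
    \<comment> \<open>A multidegree with all exponents at most 1 would be the squarefree monomial of
      its own support.\<close>
    have "\<exists>x. lookup \<alpha> x \<ge> 2"
    proof (rule ccontr)
      assume "\<nexists>x. lookup \<alpha> x \<ge> 2"
      then have "\<not> 2 \<le> lookup \<alpha> x" for x by blast
      then have le1: "lookup \<alpha> x \<le> 1" for x by (simp add: not_le less_Suc_eq_le numeral_2_eq_2)
      then have "\<alpha> = sqf_mon (keys \<alpha>)"
        using le1 by (intro poly_mapping_eqI) (simp add: lookup_sqf_mon in_keys_iff le_antisym Suc_leI)
      moreover have "keys \<alpha> \<in> ?P" using \<alpha> calculation finW
        by (metis (mono_tags, lifting) DiffD1 finite_keys mem_Collect_eq mon_degree_sqf_mon monomials_def)
      ultimately show False using \<alpha> by blast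
    qed
    then obtain x where x: "lookup \<alpha> x \<ge> 2" by blast
    then have "x \<in> V" using \<alpha> by (auto simp: monomials_def in_keys_iff)
    moreover have "nonface_complex \<G> \<alpha> \<subseteq> Pow V" using \<alpha> by (auto simp: nonface_complex_def monomials_def)
    ultimately show "sdim (nonface_complex \<G> \<alpha>) p = 0"
      using nonface_complex_mono nonface_complex_cone[OF x] by (intro sdim_cone) auto
  qed
  also have "\<dots> = (\<Sum>W\<in>?P. sdim (nonface_complex \<G> (sqf_mon W)) p)"
    by (rule sum.reindex_cong[OF _ refl refl]) (metis (mono_tags, lifting) finW inj_onI keys_sqf_mon mem_Collect_eq)
  also have "\<dots> = (\<Sum>W\<in>?P. sdim {S. S \<subseteq> W \<and> (\<exists>A\<in>\<G>. A \<subseteq> W - S)} p)"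
    using finW by (intro sum.cong) (auto simp: nonface_complex_sqf_mon)
  finally show ?thesis using khom_ideal_multigraded by metis
qed

end


section \<open>Cohomology of the complex of faces\<close>

definition cochains :: "'v set \<Rightarrow> nat \<Rightarrow> ('v set \<Rightarrow> 'k::field) set" where
  "cochains W d = {g. \<forall>T. g T \<noteq> 0 \<longrightarrow> T \<subseteq> W \<and> card T = d}"

definition cohdim :: "'k::field itself \<Rightarrow> ('v \<Rightarrow> nat) \<Rightarrow> 'v set \<Rightarrow> 'v set set \<Rightarrow> nat \<Rightarrow> nat" where
  "cohdim _ f W \<Delta> d = (THE n. has_qdim (fscale (*)) (cocycles f W \<Delta> d) (coboundaries f W \<Delta> d :: ('v set \<Rightarrow> 'k) set) n)"

lemma vector_space_cochain: "vector_space (fscale (*) :: 'k::field \<Rightarrow> ('v set \<Rightarrow> 'k) \<Rightarrow> _)"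
  by (rule vector_space_fscale) (rule vector_space_times)

interpretation cochain: vector_space "fscale (*) :: 'k::field \<Rightarrow> ('v set \<Rightarrow> 'k) \<Rightarrow> _"
  by (rule vector_space_cochain)

lemma codiff_add: "codiff f W (g + h) T = codiff f W g T + codiff f W h T"
  and codiff_scale: "codiff f W (fscale (*) c g) T = c * codiff f W g T"
  and codiff_0: "codiff f W 0 T = 0"
  by (simp_all add: codiff_def distrib_left sum.distrib sum_distrib_left mult.left_commute)

lemma codiff_cong: "(\<And>x. x \<in> T \<Longrightarrow> g (T - {x}) = h (T - {x})) \<Longrightarrow> codiff f W g T = codiff f W h T"
  unfolding codiff_def by (intro sum.cong) auto

lemma linear_face_codiff: "Vector_Spaces.linear (fscale (*)) (fscale (*)) (\<lambda>g. face_part W \<Delta> (codiff f W (g :: 'v set \<Rightarrow> 'k::field)))"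
  by (rule linearI[OF vector_space_cochain vector_space_cochain])
    (auto simp: face_part_def codiff_add codiff_scale fun_eq_iff)

lemma subspace_support: "cochain.subspace {g :: 'v set \<Rightarrow> 'k::field. \<forall>T. g T \<noteq> 0 \<longrightarrow> P T}"
  unfolding cochain.subspace_def
proof (intro conjI ballI allI)
  fix g h :: "'v set \<Rightarrow> 'k"
  assume gh: "g \<in> {g. \<forall>T. g T \<noteq> 0 \<longrightarrow> P T}" "h \<in> {g. \<forall>T. g T \<noteq> 0 \<longrightarrow> P T}"
  show "g + h \<in> {g. \<forall>T. g T \<noteq> 0 \<longrightarrow> P T}"
  proof (intro CollectI allI impI)
    fix T assume "(g + h) T \<noteq> 0"
    then have "g T \<noteq> 0 \<or> h T \<noteq> 0" by auto
    then show "P T" using gh by blast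
  qed
qed auto

lemma subspace_cochains: "cochain.subspace (cochains W d)"
  unfolding cochains_def by (rule subspace_support)

lemma cocycles_alt: "cocycles f W \<Delta> d = {g \<in> cochains W d. (\<forall>T. g T \<noteq> 0 \<longrightarrow> T \<in> \<Delta>) \<and>
    (\<forall>T. T \<subseteq> W \<longrightarrow> T \<in> \<Delta> \<longrightarrow> codiff f W g T = 0)}"
  by (auto simp: cocycles_def cochains_def)

lemma subspace_cocycles: "cochain.subspace (cocycles f W \<Delta> d :: ('v set \<Rightarrow> 'k::field) set)"
proof -
  have "cochain.subspace {g :: 'v set \<Rightarrow> 'k::field. \<forall>T. T \<subseteq> W \<longrightarrow> T \<in> \<Delta> \<longrightarrow> codiff f W g T = 0}"
    by (simp add: cochain.subspace_def codiff_add codiff_scale codiff_0)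
  with subspace_support have "cochain.subspace ({g. \<forall>T. g T \<noteq> 0 \<longrightarrow> T \<subseteq> W \<and> T \<in> \<Delta> \<and> card T = d} \<inter>
      {g :: 'v set \<Rightarrow> 'k::field. \<forall>T. T \<subseteq> W \<longrightarrow> T \<in> \<Delta> \<longrightarrow> codiff f W g T = 0})"
    by (rule cochain.subspace_inter)
  then show ?thesis unfolding cocycles_def Collect_conj_eq .
qed

lemma coboundaries_image: "coboundaries f W \<Delta> d = (\<lambda>g. face_part W \<Delta> (codiff f W g)) ` {u. \<forall>T. u T \<noteq> 0 \<longrightarrow> T \<subseteq> W \<and> Suc (card T) = d}"
  by (auto simp: coboundaries_def)

lemma subspace_coboundaries: "cochain.subspace (coboundaries f W \<Delta> d :: ('v set \<Rightarrow> 'k::field) set)"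
proof -
  interpret L: Vector_Spaces.linear "fscale (*)" "fscale (*)" "\<lambda>g. face_part W \<Delta> (codiff f W (g :: 'v set \<Rightarrow> 'k::field))"
    by (rule linear_face_codiff)
  show ?thesis unfolding coboundaries_image by (rule L.subspace_image[OF subspace_support])
qed

lemma has_qdim_cochains:
  assumes "finite W"
  shows "has_qdim (fscale (*)) (cochains W d) {0 :: 'v set \<Rightarrow> 'k::field} (card W choose d)"
proof -
  have "cochains W d = {g :: 'v set \<Rightarrow> 'k. \<forall>T. g T \<noteq> 0 \<longrightarrow> T \<in> {T. T \<subseteq> W \<and> card T = d}}"
    by (auto simp: cochains_def)
  then show ?thesis
    using has_qdim_functions[of "{T. T \<subseteq> W \<and> card T = d}"] assms n_subsets[OF assms, of d] by simp
qed

lemma cohdim_eqI: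
  assumes "has_qdim (fscale (*)) (cocycles f W \<Delta> d) (coboundaries f W \<Delta> d :: ('v set \<Rightarrow> 'k::field) set) n"
  shows "cohdim TYPE('k) f W \<Delta> d = n"
  unfolding cohdim_def
  using assms has_qdim_unique[OF vector_space_cochain subspace_coboundaries] by blast

lemma cohdim:
  assumes "finite W"
  shows "has_qdim (fscale (*)) (cocycles f W \<Delta> d) (coboundaries f W \<Delta> d :: ('v set \<Rightarrow> 'k::field) set) (cohdim TYPE('k) f W \<Delta> d)"
proof -
  have "\<exists>n. has_qdim (fscale (*)) (cocycles f W \<Delta> d) (coboundaries f W \<Delta> d :: ('v set \<Rightarrow> 'k) set) n"
    by (rule has_qdim_exists[OF vector_space_cochain subspace_cocycles subspace_coboundaries _
        has_qdim_cochains[OF assms, of d]]) (auto simp: cocycles_alt)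
  then show ?thesis using cohdim_eqI by blast
qed

lemma codiff_support:
  assumes "codiff f W u T \<noteq> 0" "finite T"
  obtains x where "x \<in> T" "u (T - {x}) \<noteq> 0" "card T = Suc (card (T - {x}))"
proof -
  from assms(1) obtain x where "x \<in> T" "ksign f x (W - T) * u (T - {x}) \<noteq> 0"
    unfolding codiff_def by (rule sum.not_neutral_contains_not_neutral)
  then show thesis using that assms(2) by (metis card_Suc_Diff1 mult_zero_right)
qed

lemma coboundariesI:
  "(\<And>T. u T \<noteq> 0 \<Longrightarrow> T \<subseteq> W \<and> Suc (card T) = d) \<Longrightarrow> g = face_part W \<Delta> (codiff f W u) \<Longrightarrow> g \<in> coboundaries f W \<Delta> d"
  unfolding coboundaries_image by (rule image_eqI[OF _ CollectI]) blast+

lemma coboundariesE: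
  assumes "g \<in> coboundaries f W \<Delta> d"
  obtains u where "\<forall>T. u T \<noteq> 0 \<longrightarrow> T \<subseteq> W \<and> Suc (card T) = d" "g = face_part W \<Delta> (codiff f W u)"
proof -
  from assms obtain u where "g = face_part W \<Delta> (codiff f W u)" "u \<in> {u. \<forall>T. u T \<noteq> 0 \<longrightarrow> T \<subseteq> W \<and> Suc (card T) = d}"
    unfolding coboundaries_image by (rule imageE)
  then show thesis using that[of u] by blast
qed

lemma coboundary_cochain:
  assumes "finite W" "g \<in> coboundaries f W \<Delta> d"
  shows "g \<in> cochains W d" "g T \<noteq> 0 \<Longrightarrow> T \<in> \<Delta>"
proof -
  obtain u where u: "\<forall>T. u T \<noteq> 0 \<longrightarrow> T \<subseteq> W \<and> Suc (card T) = d"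
    "g = face_part W \<Delta> (codiff f W u)" by (rule coboundariesE[OF assms(2)])
  show "g T \<noteq> 0 \<Longrightarrow> T \<in> \<Delta>" by (auto simp: u face_part_def split: if_splits)
  show "g \<in> cochains W d" unfolding cochains_def
  proof (intro CollectI allI impI)
    fix T assume "g T \<noteq> 0"
    then have T: "T \<subseteq> W" "codiff f W u T \<noteq> 0" by (auto simp: u face_part_def split: if_splits)
    then have "finite T" using assms(1) finite_subset by blast
    then obtain x where "u (T - {x}) \<noteq> 0" "card T = Suc (card (T - {x}))"
      using T(2) by (elim codiff_support)
    with T u(1) show "T \<subseteq> W \<and> card T = d" by simp
  qed
qed

lemma co_part_chain:
  assumes "finite W" "g \<in> cochains W d" "d \<le> card W"
  shows "co_part W g \<in> schains (Pow W) (card W - d)"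
  unfolding schains_def
proof (intro CollectI allI impI)
  fix S assume "co_part W g S \<noteq> 0"
  then have S: "S \<subseteq> W" "card (W - S) = d" using assms(2) by (auto simp: co_part_def cochains_def split: if_splits)
  moreover have "finite S" using S assms(1) finite_subset by blast
  ultimately show "S \<in> Pow W \<and> card S = card W - d"
    using card_mono[OF assms(1) S(1)] by (auto simp: card_Diff_subset)
qed

lemma schain_co_part:
  assumes "finite W" "w \<in> schains \<S> q" "\<S> \<subseteq> Pow W" "co_part W w T \<noteq> 0"
  shows "T \<subseteq> W" "card T + q = card W" "W - T \<in> \<S>"
proof -
  have T: "T \<subseteq> W" "W - T \<in> \<S>" "card (W - T) = q"
    using assms by (auto simp: co_part_def schains_def split: if_splits)
  then show "T \<subseteq> W" "W - T \<in> \<S>" by auto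
  have "finite T" using T(1) assms(1) finite_subset by blast
  then show "card T + q = card W" using T card_mono[OF assms(1) T(1)] by (auto simp: card_Diff_subset)
qed

lemma schain_supp: "g \<in> schains \<S> p \<Longrightarrow> \<S> \<subseteq> Pow W \<Longrightarrow> g T \<noteq> 0 \<Longrightarrow> T \<subseteq> W"
  by (auto simp: schains_def)

section \<open>The full simplex: exactness and dimensions\<close>

text \<open>The complement of a cocycle is a cycle of the full simplex on W, which is a cone over
  any vertex; the complement of its filling is the required primitive.\<close>

lemma simplex_exact:
  assumes W: "finite W" "inj_on f W" "W \<noteq> {}" and g: "g \<in> cocycles f W UNIV d"
  shows "g \<in> coboundaries f W UNIV d"
proof (cases "d \<le> card W")
  case False
  have "g = 0"
  proof
    fix T show "g T = 0 T"
      using g False card_mono[OF W(1), of T] by (auto simp: cocycles_def)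
  qed
  then show ?thesis using cochain.subspace_0[OF subspace_coboundaries] by simp
next
  case True
  from W(3) obtain v where v: "v \<in> W" by auto
  have gW: "g \<in> cochains W d" "\<And>T. g T \<noteq> 0 \<Longrightarrow> T \<subseteq> W" "\<And>T. T \<subseteq> W \<Longrightarrow> codiff f W g T = 0"
    using g by (auto simp: cocycles_def cochains_def)
  have sch: "co_part W g \<in> schains (Pow W) (card W - d)" by (rule co_part_chain[OF W(1) gW(1) True])
  have z: "sdiff W f (co_part W g) S = 0" for S
  proof (cases "S \<subseteq> W")
    case True
    have "sdiff W f (co_part W g) (W - (W - S)) = codiff f W (co_part W (co_part W g)) (W - S)"
      using W(1) schain_supp[OF sch] by (intro sdiff_co_part) auto
    then show ?thesis using True gW by (simp add: co_part_co_part double_diff)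
  next
    case False
    then have "co_part W g (insert x S) = 0" for x by (auto simp: co_part_def)
    then show ?thesis by (simp add: kdiff_def)
  qed
  obtain w where w: "w \<in> schains (Pow W) (Suc (card W - d))" "sdiff W f w = co_part W g"
    using cone_exact[OF W(1,2), of "Pow W" v "co_part W g" "card W - d"] v sch z
    by (auto simp: fun_eq_iff)
  have ws: "\<And>T. w T \<noteq> 0 \<Longrightarrow> T \<subseteq> W" using schain_supp[OF w(1)] by blast
  have "g = face_part W UNIV (codiff f W (co_part W w))"
  proof
    fix T show "g T = face_part W UNIV (codiff f W (co_part W w)) T"
    proof (cases "T \<subseteq> W")
      case True
      have "codiff f W (co_part W w) T = sdiff W f w (W - T)"
        using sdiff_co_part[of W W T w f] True W(1) ws by simp
      also have "\<dots> = g T" using True unfolding w(2) by (simp add: co_part_def double_diff)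
      finally show ?thesis using True by (simp add: face_part_def)
    qed (use gW in \<open>auto simp: face_part_def\<close>)
  qed
  moreover have "\<forall>T. co_part W w T \<noteq> 0 \<longrightarrow> T \<subseteq> W \<and> Suc (card T) = d"
    using schain_co_part[OF W(1) w(1)] True by fastforce
  ultimately show ?thesis by (intro coboundariesI) auto
qed

text \<open>Complementation carries \<open>codiff\<close> to the Koszul differential, whose square
  vanishes. The cut by \<open>face_part\<close> discards the values of \<open>codiff\<close> at sets
  not inside W, which need not be zero.\<close>

lemma codiff_codiff:
  assumes W: "finite W" "inj_on f W" and u: "\<And>T. u T \<noteq> 0 \<Longrightarrow> T \<subseteq> W" and T: "T \<subseteq> W"
  shows "codiff f W (face_part W UNIV (codiff f W u)) T = (0 :: 'k::field)"
proof -
  interpret koszul "(*) :: 'k \<Rightarrow> 'k \<Rightarrow> 'k" W f "\<lambda>_ b. b" by (rule koszul_scalar[OF W])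
  let ?w = "co_part W u"
  have wW: "\<And>S. ?w S \<noteq> 0 \<Longrightarrow> S \<subseteq> W" by (auto simp: co_part_def split: if_splits)
  have "face_part W UNIV (codiff f W u) = co_part W (D ?w)"
  proof
    fix S show "face_part W UNIV (codiff f W u) S = co_part W (D ?w) S"
      using sdiff_co_part[of W W S ?w f] W(1) wW u
      by (auto simp: face_part_def co_part_def[of W "D ?w"] co_part_co_part)
  qed
  moreover have Dw: "S \<subseteq> W" if "D ?w S \<noteq> 0" for S
  proof (rule ccontr)
    assume "\<not> S \<subseteq> W"
    then have "?w (insert x S) = 0" for x by (auto simp: co_part_def)
    then show False using that by (simp add: kdiff_def)
  qed
  ultimately have "codiff f W (face_part W UNIV (codiff f W u)) T = D (D ?w) (W - T)"
    using sdiff_co_part[of W W T "D ?w" f] W(1) T Dw by simp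
  also have "\<dots> = 0" using D_D[OF wW] by simp
  finally show ?thesis .
qed

lemma simplex_coboundaries:
  assumes W: "finite W" "inj_on f W" "W \<noteq> {}"
  shows "coboundaries f W UNIV d = (cocycles f W UNIV d :: ('v set \<Rightarrow> 'k::field) set)"
proof (intro equalityI subsetI)
  fix g :: "'v set \<Rightarrow> 'k" assume g: "g \<in> coboundaries f W UNIV d"
  obtain u where u: "\<forall>T. u T \<noteq> 0 \<longrightarrow> T \<subseteq> W \<and> Suc (card T) = d" "g = face_part W UNIV (codiff f W u)"
    by (rule coboundariesE[OF g])
  have "codiff f W g T = 0" if "T \<subseteq> W" for T
    unfolding u(2) using u(1) by (intro codiff_codiff[OF W(1,2) _ that]) blast
  then show "g \<in> cocycles f W UNIV d" using coboundary_cochain[OF W(1) g] by (auto simp: cocycles_alt)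
qed (rule simplex_exact[OF W])

text \<open>By exactness, cochains modulo cocycles of size d are isomorphic to the cocycles of size
  d + 1, and Pascal's rule performs the induction. This is the source of the binomials with top
  entry \<open>card W - 1\<close>.\<close>

lemma simplex_dims:
  assumes W: "finite W" "inj_on f W" "W \<noteq> {}"
  shows "has_qdim (fscale (*)) (cochains W d) (cocycles f W UNIV d :: ('v set \<Rightarrow> 'k::field) set) ((card W - 1) choose d)"
proof (induction d)
  case 0
  have "cocycles f W UNIV 0 = {0 :: 'v set \<Rightarrow> 'k}"
    unfolding simplex_coboundaries[OF W, symmetric] coboundaries_def
  proof (intro equalityI subsetI)
    fix g :: "'v set \<Rightarrow> 'k" assume "g \<in> {0}"
    then show "g \<in> {face_part W UNIV (codiff f W u) |u. \<forall>T. u T \<noteq> 0 \<longrightarrow> T \<subseteq> W \<and> Suc (card T) = 0}"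
      by (auto simp: face_part_def codiff_def fun_eq_iff intro!: exI[of _ 0])
  qed (auto simp: face_part_def codiff_def fun_eq_iff)
  then show ?case using has_qdim_cochains[OF W(1), of 0] unfolding binomial_n_0 by (simp only:)
next
  case (Suc d)
  let ?Z = "cocycles f W UNIV (Suc d) :: ('v set \<Rightarrow> 'k) set"
  have "has_qdim (fscale (*)) (cochains W d) (cocycles f W UNIV d :: ('v set \<Rightarrow> 'k) set) n \<longleftrightarrow>
      has_qdim (fscale (*)) ?Z {0} n" for n
  proof (rule has_qdim_transfer[OF linear_face_codiff[of W UNIV f] subspace_cochains])
    show "(\<lambda>g. face_part W UNIV (codiff f W g)) ` cochains W d = ?Z"
      unfolding simplex_coboundaries[OF W, symmetric] coboundaries_image
      by (rule arg_cong[where f = "image _"]) (auto simp: cochains_def)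
    show "g \<in> cocycles f W UNIV d \<longleftrightarrow> face_part W UNIV (codiff f W g) \<in> {0}" if "g \<in> cochains W d" for g
      using that by (auto simp: cocycles_alt face_part_def fun_eq_iff)
  qed
  with Suc.IH have Z: "has_qdim (fscale (*)) ?Z {0} ((card W - 1) choose d)" by blast
  have ZC: "?Z \<subseteq> cochains W (Suc d)" by (auto simp: cocycles_alt)
  obtain m where m: "has_qdim (fscale (*)) (cochains W (Suc d)) ?Z m"
    using has_qdim_exists[OF vector_space_cochain subspace_cochains subspace_cocycles order_refl has_qdim_cochains[OF W(1)]]
    by blast
  have "has_qdim (fscale (*)) (cochains W (Suc d)) {0 :: 'v set \<Rightarrow> 'k} (((card W - 1) choose d) + m)"
    by (rule has_qdim_chain[OF vector_space_cochain subspace_cocycles _ _ ZC subspace_cochains Z m])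
      (auto simp: subspace_cocycles[unfolded cochain.subspace_def])
  then have "((card W - 1) choose d) + m = card W choose Suc d"
    by (rule has_qdim_unique[OF vector_space_cochain cochain.subspace_single_0 _ has_qdim_cochains[OF W(1)]])
  moreover have "card W = Suc (card W - 1)" using W by (simp add: card_gt_0_iff)
  then have "card W choose Suc d = ((card W - 1) choose d) + ((card W - 1) choose Suc d)"
    by (metis binomial_Suc_Suc)
  ultimately have "m = (card W - 1) choose Suc d" by simp
  with m show ?case by (simp only:)
qed

text \<open>Complementation turns the chains of the nonfaces into cochains of the faces; the connecting
  map exists because the full simplex is exact.\<close>

lemma (in poly_koszul) sdim_eq_cohdim:
  assumes W: "W \<subseteq> V" "W \<noteq> {}" and card: "Suc p + d = card W"
    and \<Delta>: "\<And>T T'. T \<in> \<Delta> \<Longrightarrow> T' \<subseteq> T \<Longrightarrow> T' \<in> \<Delta>"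
  shows "sdim {S. S \<subseteq> W \<and> W - S \<notin> \<Delta>} p = cohdim TYPE('k) f W \<Delta> d"
proof -
  let ?\<S> = "{S. S \<subseteq> W \<and> W - S \<notin> \<Delta>}"
  \<comment> \<open>On chains of the simplex the kernel of \<rho> consists of the chains of
    nonfaces, so \<rho> realises the quotient of the simplex by the complex of nonfaces.\<close>
  define \<rho> :: "('v set \<Rightarrow> 'k) \<Rightarrow> 'v set \<Rightarrow> 'k" where "\<rho> w = face_part W \<Delta> (co_part W w)" for w
  have finW: "finite W" using W(1) fin finite_subset by blast
  have \<S>W: "?\<S> \<subseteq> Pow W" and \<S>V: "?\<S> \<subseteq> Pow V" and WV: "Pow W \<subseteq> Pow V" using W by auto
  have \<S>_mono: "S' \<in> ?\<S>" if "S \<in> ?\<S>" "S' \<subseteq> S" for S S' using that \<Delta>[of "W - S'" "W - S"] by auto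
  have lin: "Vector_Spaces.linear (fscale (*)) (fscale (*)) \<rho>"
    by (rule linearI[OF vector_space_cochain vector_space_cochain])
      (auto simp: \<rho>_def face_part_def co_part_def fun_eq_iff)
  interpret \<rho>: Vector_Spaces.linear "fscale (*)" "fscale (*)" \<rho> by (rule lin)
  interpret L: Vector_Spaces.linear "fscale (*)" "fscale (*)" "sdiff V f :: ('v set \<Rightarrow> 'k) \<Rightarrow> _"
    by (rule linear_sdiff)
  obtain v where v: "v \<in> W" using W by auto
  have exact: "\<exists>w\<in>schains (Pow W) (Suc q). sdiff V f w = g"
    if "g \<in> schains (Pow W) q" "sdiff V f g = 0" for q and g :: "'v set \<Rightarrow> 'k"
    using cone_exact[OF fin inj WV, of v g q] v W(1) that by (metis Pow_iff insert_subset subsetD)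
  have Pow_chain: "g \<in> schains (Pow W) q" if "g \<in> schains ?\<S> q" for q and g :: "'v set \<Rightarrow> 'k"
    using that by (auto simp: schains_def)
  have sdP: "sdiff V f w \<in> schains (Pow W) q" if "w \<in> schains (Pow W) (Suc q)" for q and w :: "'v set \<Rightarrow> 'k"
    by (rule sdiff_schains[OF WV _ that]) auto
  have cod: "codiff f W (co_part W w) T = sdiff V f w (W - T)"
    if "w \<in> schains (Pow W) q" "T \<subseteq> W" for q T and w :: "'v set \<Rightarrow> 'k"
    using sdiff_co_part[OF fin W(1) that(2), of w f] that(1) by (auto simp: schains_def)
  have \<rho>_sd: "\<rho> (sdiff V f w) = face_part W \<Delta> (codiff f W (co_part W w))"
    if "w \<in> schains (Pow W) q" for q and w :: "'v set \<Rightarrow> 'k"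
    using cod[OF that] by (auto simp: \<rho>_def face_part_def co_part_def[of W "sdiff V f w"] fun_eq_iff)
  have \<rho>0: "w \<in> schains ?\<S> q" if "w \<in> schains (Pow W) q" "\<rho> w = 0" for q and w :: "'v set \<Rightarrow> 'k"
  proof -
    have "w S = 0" if "S \<subseteq> W" "W - S \<in> \<Delta>" for S
    proof -
      have "\<rho> w (W - S) = w S" using that by (simp add: \<rho>_def face_part_def co_part_def double_diff)
      then show ?thesis using \<open>\<rho> w = 0\<close> by simp
    qed
    then show ?thesis using that(1) by (auto simp: schains_def)
  qed
  have \<rho>\<S>: "\<rho> u = 0" if "u \<in> schains ?\<S> q" for q and u :: "'v set \<Rightarrow> 'k"
    using that by (auto simp: \<rho>_def face_part_def co_part_def schains_def fun_eq_iff double_diff) 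
  have sd\<S>: "sdiff V f u \<in> schains ?\<S> q" if "u \<in> schains ?\<S> (Suc q)" for q and u :: "'v set \<Rightarrow> 'k"
    by (rule sdiff_schains[OF \<S>V \<S>_mono that])
  \<comment> \<open>Relative cycles of the simplex modulo the nonfaces. The boundary, which lowers p
    + 1 to p, and \<rho>, which complements p + 1 vertices to d, are the two legs of the connecting
    isomorphism.\<close>
  define W0 where "W0 = {w \<in> schains (Pow W) (Suc p). sdiff V f w \<in> (schains ?\<S> p :: ('v set \<Rightarrow> 'k) set)}"
  have subW0: "cochain.subspace W0"
    using subspace_schains[of "Pow W" "Suc p"] subspace_schains[of ?\<S> p]
    by (auto simp: W0_def cochain.subspace_def L.zero L.add L.scale)
  have diffP: "g - h \<in> schains (Pow W) q" if "g \<in> schains (Pow W) q" "h \<in> schains (Pow W) q"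
    for q and g h :: "'v set \<Rightarrow> 'k"
    using that cochain.subspace_diff[OF subspace_schains] by blast
  have img1: "sdiff V f ` W0 = scycles V f ?\<S> p"
  proof safe
    fix w assume "w \<in> W0" then show "sdiff V f w \<in> scycles V f ?\<S> p"
      using sdiff_sdiff[OF WV] by (auto simp: W0_def scycles_def)
  next
    fix g :: "'v set \<Rightarrow> 'k" assume g: "g \<in> scycles V f ?\<S> p"
    then obtain w where "w \<in> schains (Pow W) (Suc p)" "sdiff V f w = g"
      using exact[OF Pow_chain, of g p] by (auto simp: scycles_def)
    then show "g \<in> sdiff V f ` W0" using g by (auto simp: W0_def scycles_def)
  qed
  have img2: "\<rho> ` W0 = cocycles f W \<Delta> d"
  proof safe
    fix w assume w: "w \<in> W0"
    then have wP: "w \<in> schains (Pow W) (Suc p)" and sw: "sdiff V f w \<in> schains ?\<S> p" by (auto simp: W0_def)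
    have "T \<subseteq> W \<and> T \<in> \<Delta> \<and> card T = d" if "\<rho> w T \<noteq> 0" for T
      using that schain_co_part[OF finW wP order_refl, of T] card
      by (auto simp: \<rho>_def face_part_def split: if_splits)
    moreover have "codiff f W (\<rho> w) T = 0" if T: "T \<subseteq> W" "T \<in> \<Delta>" for T
    proof -
      have "codiff f W (\<rho> w) T = codiff f W (co_part W w) T"
        using T \<Delta> by (intro codiff_cong) (auto simp: \<rho>_def face_part_def)
      also have "\<dots> = sdiff V f w (W - T)" by (rule cod[OF wP T(1)])
      also have "\<dots> = 0"
      proof (rule ccontr)
        assume "sdiff V f w (W - T) \<noteq> 0"
        then have "W - (W - T) \<notin> \<Delta>" using sw by (auto simp: schains_def)
        then show False using T by (simp add: double_diff)
      qed
      finally show ?thesis .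
    qed
    ultimately show "\<rho> w \<in> cocycles f W \<Delta> d" by (auto simp: cocycles_def)
  next
    fix g :: "'v set \<Rightarrow> 'k" assume g: "g \<in> cocycles f W \<Delta> d"
    then have gW: "\<And>T. g T \<noteq> 0 \<Longrightarrow> T \<subseteq> W \<and> T \<in> \<Delta>" and gc: "g \<in> cochains W d"
      and gz: "\<And>T. T \<subseteq> W \<Longrightarrow> T \<in> \<Delta> \<Longrightarrow> codiff f W g T = 0"
      by (auto simp: cocycles_alt cochains_def)
    let ?w = "co_part W g"
    have Sp: "Suc p = card W - d" using card by simp
    have wP: "?w \<in> schains (Pow W) (Suc p)"
      unfolding Sp using card by (intro co_part_chain[OF finW gc]) simp
    have cc: "co_part W ?w = g" using gW by (intro co_part_co_part) blast
    have "\<rho> ?w = g" unfolding \<rho>_def cc using gW by (auto simp: face_part_def fun_eq_iff)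
    moreover have "sdiff V f ?w \<in> schains ?\<S> p" unfolding schains_def
    proof (intro CollectI allI impI)
      fix S assume nz: "sdiff V f ?w S \<noteq> 0"
      then have S: "S \<subseteq> W" "card S = p" using sdP[OF wP] by (auto simp: schains_def)
      then have "sdiff V f ?w S = codiff f W g (W - S)"
        using cod[OF wP, of "W - S"] unfolding cc by (simp add: double_diff)
      then have "W - S \<notin> \<Delta>" using nz gz by auto
      with S show "S \<in> ?\<S> \<and> card S = p" by simp
    qed
    ultimately show "g \<in> \<rho> ` W0" using wP unfolding W0_def by (metis (mono_tags, lifting) image_eqI mem_Collect_eq)
  qed
  have iff: "sdiff V f w \<in> sbounds V f ?\<S> p \<longleftrightarrow> \<rho> w \<in> coboundaries f W \<Delta> d" if w: "w \<in> W0" for w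
  proof
    have wP: "w \<in> schains (Pow W) (Suc p)" using w by (simp add: W0_def)
    {
      assume "sdiff V f w \<in> sbounds V f ?\<S> p"
      then obtain u where u: "u \<in> schains ?\<S> (Suc p)" "sdiff V f w = sdiff V f u" by (auto simp: sbounds_def)
      have "w - u \<in> schains (Pow W) (Suc p)" by (rule diffP[OF wP Pow_chain[OF u(1)]])
      moreover have "sdiff V f (w - u) = 0" using u by (simp add: L.diff)
      ultimately obtain y where y: "y \<in> schains (Pow W) (Suc (Suc p))" "sdiff V f y = w - u"
        using exact by blast
      have "\<rho> w = \<rho> (w - u)" using \<rho>\<S>[OF u(1)] by (simp add: \<rho>.diff)
      also have "\<dots> = face_part W \<Delta> (codiff f W (co_part W y))" using \<rho>_sd[OF y(1)] y(2) by simp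
      finally show "\<rho> w \<in> coboundaries f W \<Delta> d"
      proof (rule coboundariesI[rotated])
        fix T assume "co_part W y T \<noteq> 0"
        then show "T \<subseteq> W \<and> Suc (card T) = d"
          using schain_co_part[OF finW y(1) order_refl, of T] card by simp
      qed
    }
    assume "\<rho> w \<in> coboundaries f W \<Delta> d"
    then obtain u where "\<forall>T. u T \<noteq> 0 \<longrightarrow> T \<subseteq> W \<and> Suc (card T) = d"
      "\<rho> w = face_part W \<Delta> (codiff f W u)" by (rule coboundariesE)
    then have u: "\<And>T. u T \<noteq> 0 \<Longrightarrow> T \<subseteq> W \<and> Suc (card T) = d"
      "\<rho> w = face_part W \<Delta> (codiff f W u)" by blast+
    let ?y = "co_part W u"
    have yc: "co_part W ?y = u" using u(1) by (intro co_part_co_part) blast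
    have y: "?y \<in> schains (Pow W) (Suc (Suc p))" unfolding schains_def
    proof (intro CollectI allI impI)
      fix S assume "?y S \<noteq> 0"
      then have S: "S \<subseteq> W" "Suc (card (W - S)) = d" using u(1) by (auto simp: co_part_def split: if_splits)
      moreover have "card (W - S) = card W - card S"
        using S(1) finW finite_subset by (intro card_Diff_subset) blast+
      moreover have "card S \<le> card W" using S(1) finW by (intro card_mono)
      ultimately show "S \<in> Pow W \<and> card S = Suc (Suc p)" using card by auto
    qed
    have "\<rho> (w - sdiff V f ?y) = 0" using \<rho>_sd[OF y] u(2) by (simp add: \<rho>.diff yc)
    then have "w - sdiff V f ?y \<in> schains ?\<S> (Suc p)" by (intro \<rho>0 diffP wP sdP y)
    moreover have "sdiff V f w = sdiff V f (w - sdiff V f ?y)"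
      using sdiff_sdiff[OF WV y] by (simp add: L.diff)
    ultimately show "sdiff V f w \<in> sbounds V f ?\<S> p" unfolding sbounds_def by blast
  qed
  have "has_qdim (fscale (*)) (scycles V f ?\<S> p) (sbounds V f ?\<S> p :: ('v set \<Rightarrow> 'k) set) n \<longleftrightarrow>
      has_qdim (fscale (*)) W0 {w. sdiff V f w \<in> sbounds V f ?\<S> p} n" for n
    by (rule has_qdim_transfer[symmetric, OF linear_sdiff subW0 img1]) simp
  moreover have "has_qdim (fscale (*)) W0 {w. sdiff V f w \<in> sbounds V f ?\<S> p} n \<longleftrightarrow> has_qdim (fscale (*)) (cocycles f W \<Delta> d) (coboundaries f W \<Delta> d :: ('v set \<Rightarrow> 'k) set) n" for n
    by (rule has_qdim_transfer[OF lin subW0 img2]) (simp add: iff)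
  ultimately have "has_qdim (fscale (*)) (scycles V f ?\<S> p) (sbounds V f ?\<S> p :: ('v set \<Rightarrow> 'k) set) (cohdim TYPE('k) f W \<Delta> d)"
    using cohdim[OF finW] by blast
  then show ?thesis by (rule sdim_eqI)
qed


section \<open>Cohomology of a join\<close>

text \<open>The properties of a join that determine its cohomology: all sets of at most r vertices
  are faces, and a larger face lies on one side. \<open>sign1\<close> and \<open>sign2\<close> make
  the coboundary of W, on subsets of one side, a nonzero multiple of the coboundary of that
  side.\<close>

locale face_join =
  fixes f :: "'v \<Rightarrow> nat" and W1 W2 :: "'v set" and \<Delta> :: "'v set set" and r :: nat
    and \<epsilon>1 \<epsilon>2 :: "'k::field"
  assumes fin: "finite W1" "finite W2" and inj: "inj_on f (W1 \<union> W2)" and disj: "W1 \<inter> W2 = {}"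
    and sign1: "x \<in> T \<Longrightarrow> T \<subseteq> W1 \<Longrightarrow> ksign f x (W1 \<union> W2 - T) = \<epsilon>1 * ksign f x (W1 - T)" and \<epsilon>1: "\<epsilon>1 \<noteq> 0"
    and sign2: "x \<in> T \<Longrightarrow> T \<subseteq> W2 \<Longrightarrow> ksign f x (W1 \<union> W2 - T) = \<epsilon>2 * ksign f x (W2 - T)" and \<epsilon>2: "\<epsilon>2 \<noteq> 0"
    and r: "1 \<le> r"
    and small: "T \<subseteq> W1 \<union> W2 \<Longrightarrow> card T \<le> r \<Longrightarrow> T \<in> \<Delta>"
    and pure: "T \<in> \<Delta> \<Longrightarrow> T \<subseteq> W1 \<union> W2 \<Longrightarrow> r < card T \<Longrightarrow> T \<subseteq> W1 \<or> T \<subseteq> W2"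
begin

abbreviation W where "W \<equiv> W1 \<union> W2"

definition restr :: "'v set \<Rightarrow> ('v set \<Rightarrow> 'k) \<Rightarrow> 'v set \<Rightarrow> 'k" where
  "restr U g T = (if T \<subseteq> U then g T else 0)"

lemma linear_restr: "Vector_Spaces.linear (fscale (*)) (fscale (*)) (restr U)"
  by (rule linearI[OF vector_space_cochain vector_space_cochain]) (auto simp: restr_def fun_eq_iff)

lemma codiff1: "T \<subseteq> W1 \<Longrightarrow> codiff f W g T = \<epsilon>1 * codiff f W1 g T"
  unfolding codiff_def sum_distrib_left by (intro sum.cong refl) (simp add: sign1)

lemma codiff2: "T \<subseteq> W2 \<Longrightarrow> codiff f W g T = \<epsilon>2 * codiff f W2 g T"
  unfolding codiff_def sum_distrib_left by (intro sum.cong refl) (simp add: sign2)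

text \<open>The two sides play the same role, so each fact about \<open>W1\<close> yields its mirror
  image by interpreting the locale a second time.\<close>

lemma swap: "face_join f W2 W1 \<Delta> r \<epsilon>2 \<epsilon>1"
proof (unfold_locales, unfold Un_commute[of W2 W1] Int_commute[of W2 W1])
  show "T \<subseteq> W2 \<or> T \<subseteq> W1" if "T \<in> \<Delta>" "T \<subseteq> W" "r < card T" for T
    using pure[OF that] by blast
qed (fact fin inj disj sign1 sign2 \<epsilon>1 \<epsilon>2 r small)+

lemma codiff_restr: "T \<subseteq> U \<Longrightarrow> codiff f W' (restr U g) T = codiff f W' g T"
  by (intro codiff_cong) (auto simp: restr_def)

text \<open>A facet of a set on the other side can lie in \<open>W1\<close> only by being empty, and
  g vanishes on the empty set.\<close>

lemma codiff_mixed: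
  assumes g: "\<And>T. g T \<noteq> 0 \<Longrightarrow> T \<subseteq> W1 \<and> 1 \<le> card T" and T: "T \<subseteq> W2" "T \<noteq> {}"
  shows "codiff f W' g T = 0"
  unfolding codiff_def
proof (intro sum.neutral ballI)
  fix x assume "x \<in> T"
  have "g (T - {x}) = 0"
  proof (rule ccontr)
    assume "g (T - {x}) \<noteq> 0"
    then have *: "T - {x} \<subseteq> W1" "1 \<le> card (T - {x})" using g by auto
    then have "T - {x} = {}" using T(1) disj by blast
    with * show False by (metis card.empty not_one_le_zero)
  qed
  then show "ksign f x (W' - T) * g (T - {x}) = 0" by simp
qed

lemma restr_cocycle:
  assumes "g \<in> cocycles f W \<Delta> d"
  shows "restr W1 g \<in> cocycles f W1 \<Delta> d"
  unfolding cocycles_def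
proof (intro CollectI conjI allI impI)
  fix T assume "restr W1 g T \<noteq> 0"
  then have "T \<subseteq> W1" "g T \<noteq> 0" by (auto simp: restr_def split: if_splits)
  then show "T \<subseteq> W1" "T \<in> \<Delta>" "card T = d" using assms by (auto simp: cocycles_def)
next
  fix T assume T: "T \<subseteq> W1" "T \<in> \<Delta>"
  then have "codiff f W g T = 0" using assms by (auto simp: cocycles_def)
  then show "codiff f W1 (restr W1 g) T = 0"
    using T \<epsilon>1 by (simp add: codiff_restr codiff1)
qed

text \<open>A nonzero coboundary could occur only at faces with d + 1 > r vertices, which lie on one
  side: on \<open>W1\<close> the cochain is closed already, and on \<open>W2\<close>
  \<open>codiff_mixed\<close> applies.\<close>

lemma extend_cocycle:
  fixes g :: "'v set \<Rightarrow> 'k"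
  assumes g: "g \<in> cocycles f W1 \<Delta> d" and d: "r \<le> d"
  shows "g \<in> cocycles f W \<Delta> d"
  unfolding cocycles_def
proof (intro CollectI conjI allI impI)
  fix T assume "g T \<noteq> 0"
  then show "T \<subseteq> W" "T \<in> \<Delta>" "card T = d" using g by (auto simp: cocycles_def)
next
  fix T assume T: "T \<subseteq> W" "T \<in> \<Delta>"
  show "codiff f W g T = 0"
  proof (rule ccontr)
    assume nz: "codiff f W g T \<noteq> 0"
    have fT: "finite T" using T fin finite_subset by blast
    from nz fT obtain x where x: "x \<in> T" "g (T - {x}) \<noteq> 0" "card T = Suc (card (T - {x}))"
      by (rule codiff_support)
    then have "r < card T" using g d by (auto simp: cocycles_def)
    with T have "T \<subseteq> W1 \<or> T \<subseteq> W2" by (intro pure)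
    then show False
    proof
      assume "T \<subseteq> W1"
      then show False using nz g T by (auto simp: codiff1 cocycles_def)
    next
      assume "T \<subseteq> W2"
      moreover have "T' \<subseteq> W1 \<and> 1 \<le> card T'" if "g T' \<noteq> 0" for T' using g that d r by (auto simp: cocycles_def)
      ultimately show False using codiff_mixed[of g T W] nz x by blast
    qed
  qed
qed

lemma restr_id: "g \<in> cochains W1 d \<Longrightarrow> restr W1 g = g"
  by (auto simp: restr_def cochains_def fun_eq_iff)

lemma restr_other: "g \<in> cochains W2 d \<Longrightarrow> 1 \<le> d \<Longrightarrow> restr W1 g = 0"
proof
  fix T assume g: "g \<in> cochains W2 d" "1 \<le> d"
  show "restr W1 g T = 0 T"
  proof (rule ccontr)
    assume "restr W1 g T \<noteq> 0 T"
    then have "T \<subseteq> W1" "T \<subseteq> W2" "card T = d" using g by (auto simp: restr_def cochains_def split: if_splits)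
    moreover from this have "T = {}" using disj by blast
    ultimately show False using g(2) by simp
  qed
qed

lemma restr_coboundary:
  assumes "g \<in> coboundaries f W \<Delta> d"
  shows "restr W1 g \<in> coboundaries f W1 \<Delta> d"
proof -
  obtain u where u: "\<forall>T. u T \<noteq> 0 \<longrightarrow> T \<subseteq> W \<and> Suc (card T) = d" "g = face_part W \<Delta> (codiff f W u)"
    by (rule coboundariesE[OF assms])
  show ?thesis
  \<comment> \<open>The factor \<epsilon>1 absorbs the difference between the coboundaries of W and
    of \<open>W1\<close>.\<close>
  proof (rule coboundariesI[where u = "fscale (*) \<epsilon>1 (restr W1 u)"])
    show "T \<subseteq> W1 \<and> Suc (card T) = d" if "fscale (*) \<epsilon>1 (restr W1 u) T \<noteq> 0" for T
      using that u(1) by (auto simp: restr_def split: if_splits)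
    show "restr W1 g = face_part W1 \<Delta> (codiff f W1 (fscale (*) \<epsilon>1 (restr W1 u)))"
    proof
      fix T show "restr W1 g T = face_part W1 \<Delta> (codiff f W1 (fscale (*) \<epsilon>1 (restr W1 u))) T"
        unfolding u(2) by (auto simp: face_part_def restr_def[of W1 "face_part _ _ _"] codiff_scale codiff_restr codiff1)
    qed
  qed
qed

text \<open>Primitives on the two sides add up to one on W: a face with d > r vertices lies on one
  side, and there the primitive of the other side contributes nothing, as it lives on nonempty
  sets.\<close>

lemma coboundary_join:
  assumes g: "g \<in> cocycles f W \<Delta> d" and d: "r < d"
    and g1: "restr W1 g \<in> coboundaries f W1 \<Delta> d" and g2: "restr W2 g \<in> coboundaries f W2 \<Delta> d"
  shows "g \<in> coboundaries f W \<Delta> d"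
proof -
  interpret S: face_join f W2 W1 \<Delta> r \<epsilon>2 \<epsilon>1 by (rule swap)
  obtain u1 where u1: "\<forall>T. u1 T \<noteq> 0 \<longrightarrow> T \<subseteq> W1 \<and> Suc (card T) = d" "restr W1 g = face_part W1 \<Delta> (codiff f W1 u1)"
    by (rule coboundariesE[OF g1])
  obtain u2 where u2: "\<forall>T. u2 T \<noteq> 0 \<longrightarrow> T \<subseteq> W2 \<and> Suc (card T) = d" "restr W2 g = face_part W2 \<Delta> (codiff f W2 u2)"
    by (rule coboundariesE[OF g2])
  have c1: "T \<subseteq> W1 \<and> 1 \<le> card T" if "u1 T \<noteq> 0" for T using u1(1) that d r by force
  have c2: "T \<subseteq> W2 \<and> 1 \<le> card T" if "u2 T \<noteq> 0" for T using u2(1) that d r by force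
  \<comment> \<open>Dividing by the sign constants cancels the factors that \<open>codiff1\<close>
    and \<open>codiff2\<close> introduce.\<close>
  let ?u = "fscale (*) (inverse \<epsilon>1) u1 + fscale (*) (inverse \<epsilon>2) u2"
  have usupp: "T \<subseteq> W \<and> Suc (card T) = d" if "?u T \<noteq> 0" for T
  proof -
    have "u1 T \<noteq> 0 \<or> u2 T \<noteq> 0" using that by auto
    then show ?thesis using u1(1) u2(1) by auto
  qed
  have "g = face_part W \<Delta> (codiff f W ?u)"
  proof
    fix T show "g T = face_part W \<Delta> (codiff f W ?u) T"
    proof (cases "T \<subseteq> W \<and> T \<in> \<Delta> \<and> card T = d")
      case False
      have "face_part W \<Delta> (codiff f W ?u) \<in> coboundaries f W \<Delta> d"
        by (rule coboundariesI[OF usupp refl])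
      then have "face_part W \<Delta> (codiff f W ?u) T = 0"
        using coboundary_cochain[of W] fin False unfolding cochains_def by blast
      moreover have "g T = 0" using g False by (auto simp: cocycles_def)
      ultimately show ?thesis by simp
    next
      case True
      then have "T \<noteq> {}" using d by auto
      from True have "T \<subseteq> W1 \<or> T \<subseteq> W2" using d by (intro pure) auto
      then show ?thesis
      proof
        assume T: "T \<subseteq> W1"
        have "codiff f W1 u2 T = 0" by (rule S.codiff_mixed[OF c2 T \<open>T \<noteq> {}\<close>])
        then have "codiff f W ?u T = codiff f W1 u1 T"
          using T \<epsilon>1 by (simp add: codiff1 codiff_add codiff_scale)
        also have "\<dots> = restr W1 g T" using True T unfolding u1(2) by (simp add: face_part_def)
        finally show ?thesis using True T by (simp add: face_part_def restr_def)
      next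
        assume T: "T \<subseteq> W2"
        have "codiff f W2 u1 T = 0" by (rule codiff_mixed[OF c1 T \<open>T \<noteq> {}\<close>])
        then have "codiff f W ?u T = codiff f W2 u2 T"
          using T \<epsilon>2 by (simp add: codiff2 codiff_add codiff_scale)
        also have "\<dots> = restr W2 g T" using True T unfolding u2(2) by (simp add: face_part_def)
        finally show ?thesis using True T by (simp add: face_part_def restr_def)
      qed
    qed
  qed
  then show ?thesis by (intro coboundariesI[where u = ?u] usupp)
qed

text \<open>On the facets of a face the truncated coboundary agrees with that of the full simplex,
  so closedness is inherited from \<open>codiff_codiff\<close>.\<close>

lemma coboundary_subset_cocycles:
  assumes "finite U" "inj_on f U" "\<And>T T'. T \<subseteq> U \<Longrightarrow> T \<in> \<Delta> \<Longrightarrow> T' \<subseteq> T \<Longrightarrow> T' \<in> \<Delta>"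
  shows "coboundaries f U \<Delta> d \<subseteq> (cocycles f U \<Delta> d :: ('v set \<Rightarrow> 'k) set)"
proof
  fix g :: "'v set \<Rightarrow> 'k" assume g: "g \<in> coboundaries f U \<Delta> d"
  obtain u where u: "\<forall>T. u T \<noteq> 0 \<longrightarrow> T \<subseteq> U \<and> Suc (card T) = d" "g = face_part U \<Delta> (codiff f U u)"
    by (rule coboundariesE[OF g])
  have "codiff f U g T = 0" if T: "T \<subseteq> U" "T \<in> \<Delta>" for T
  proof -
    have "codiff f U g T = codiff f U (face_part U UNIV (codiff f U u)) T"
      unfolding u(2) using T assms(3)[OF T] by (intro codiff_cong) (auto simp: face_part_def)
    also have "\<dots> = 0" using u(1) by (intro codiff_codiff[OF assms(1,2) _ T(1)]) blast
    finally show ?thesis .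
  qed
  then show "g \<in> cocycles f U \<Delta> d"
    using coboundary_cochain[OF assms(1) g] by (auto simp: cocycles_alt)
qed

text \<open>A two-step filtration through the cocycles \<open>M\<close> whose restriction to
  \<open>W1\<close> is a coboundary: cocycles modulo \<open>M\<close> give the cohomology of
  \<open>W1\<close>, and \<open>M\<close> modulo coboundaries that of \<open>W2\<close>. The
  restrictions are onto because cocycles of one side extend by zero.\<close>

lemma cohdim_join_high:
  assumes d: "r < d" and down: "\<And>T T'. T \<subseteq> W \<Longrightarrow> T \<in> \<Delta> \<Longrightarrow> T' \<subseteq> T \<Longrightarrow> T' \<in> \<Delta>"
  shows "cohdim TYPE('k) f W \<Delta> d = cohdim TYPE('k) f W1 \<Delta> d + cohdim TYPE('k) f W2 \<Delta> d"
proof -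
  interpret S: face_join f W2 W1 \<Delta> r \<epsilon>2 \<epsilon>1 by (rule swap)
  interpret R1: Vector_Spaces.linear "fscale (*)" "fscale (*)" "restr W1" by (rule linear_restr)
  let ?Z = "cocycles f W \<Delta> d :: ('v set \<Rightarrow> 'k) set"
  let ?B = "coboundaries f W \<Delta> d :: ('v set \<Rightarrow> 'k) set"
  define M where "M = {g \<in> ?Z. restr W1 g \<in> coboundaries f W1 \<Delta> d}"
  have finW: "finite W" using fin by simp
  have subM: "cochain.subspace M"
    using subspace_cocycles[of f W \<Delta> d] subspace_coboundaries[of f W1 \<Delta> d]
    by (auto simp: M_def cochain.subspace_def R1.zero R1.add R1.scale)
  have BM: "?B \<subseteq> M"
  proof
    fix g assume g: "g \<in> ?B"
    have "?B \<subseteq> ?Z" by (rule coboundary_subset_cocycles[OF finW inj]) (rule down)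
    then show "g \<in> M" using g restr_coboundary[OF g] unfolding M_def by blast
  qed
  have cW1: "g \<in> cochains W1 d" if "g \<in> cocycles f W1 \<Delta> d" for g :: "'v set \<Rightarrow> 'k" using that by (simp add: cocycles_alt)
  have cW2: "g \<in> cochains W2 d" if "g \<in> cocycles f W2 \<Delta> d" for g :: "'v set \<Rightarrow> 'k" using that by (simp add: cocycles_alt)
  have "has_qdim (fscale (*)) ?Z M (cohdim TYPE('k) f W1 \<Delta> d)"
  proof (rule has_qdim_transfer[THEN iffD2, OF linear_restr subspace_cocycles _ _ cohdim[OF fin(1)]])
    show "restr W1 ` ?Z = cocycles f W1 \<Delta> d"
    proof safe
      fix g :: "'v set \<Rightarrow> 'k" assume g: "g \<in> cocycles f W1 \<Delta> d"
      then have "g \<in> ?Z" using d by (intro extend_cocycle) auto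
      moreover have "g = restr W1 g" using restr_id[OF cW1[OF g]] by simp
      ultimately show "g \<in> restr W1 ` ?Z" by (intro image_eqI[where x = g])
    qed (rule restr_cocycle)
  qed (simp add: M_def)
  moreover have "has_qdim (fscale (*)) M ?B (cohdim TYPE('k) f W2 \<Delta> d)"
  proof (rule has_qdim_transfer[THEN iffD2, OF linear_restr subM _ _ cohdim[OF fin(2)]])
    show "restr W2 ` M = cocycles f W2 \<Delta> d"
    proof safe
      fix g :: "'v set \<Rightarrow> 'k" assume g: "g \<in> cocycles f W2 \<Delta> d"
      then have "g \<in> ?Z" using S.extend_cocycle[OF g] d by (simp add: Un_commute)
      moreover have "restr W1 g = 0" using restr_other[OF cW2[OF g]] d by simp
      ultimately have "g \<in> M" using cochain.subspace_0[OF subspace_coboundaries] by (simp add: M_def)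
      moreover have "g = restr W2 g" using S.restr_id[OF cW2[OF g]] by simp
      ultimately show "g \<in> restr W2 ` M" by (intro image_eqI[where x = g])
    qed (use S.restr_cocycle in \<open>simp add: M_def Un_commute\<close>)
    fix g :: "'v set \<Rightarrow> 'k" assume "g \<in> M"
    then show "g \<in> ?B \<longleftrightarrow> restr W2 g \<in> coboundaries f W2 \<Delta> d"
      using S.restr_coboundary[of g d] coboundary_join[OF _ d] unfolding M_def Un_commute[of W2 W1] by blast
  qed
  ultimately have "has_qdim (fscale (*)) ?Z ?B (cohdim TYPE('k) f W2 \<Delta> d + cohdim TYPE('k) f W1 \<Delta> d)"
    using M_def by (intro has_qdim_chain[OF vector_space_cochain subM subspace_coboundaries BM _ subspace_cocycles]) auto
  then show ?thesis using cohdim_eqI by (metis add.commute)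
qed

section \<open>The critical size r\<close>

text \<open>All sets of size r are faces, so the coboundaries of this size are those of the full
  simplex on U, and the dimension of cochains modulo coboundaries is known. It splits into the
  cohomology and cochains modulo cocycles.\<close>

lemma qdim_critical:
  assumes U: "finite U" "inj_on f U" and small: "\<And>T. T \<subseteq> U \<Longrightarrow> card T = r \<Longrightarrow> T \<in> \<Delta>"
    and m: "has_qdim (fscale (*)) (cochains U r) (cocycles f U \<Delta> r :: ('v set \<Rightarrow> 'k) set) m"
  shows "cohdim TYPE('k) f U \<Delta> r + m = (card U - 1) choose r"
proof (cases "U = {}")
  case True
  have "g = 0" if "g \<in> cochains U r" for g :: "'v set \<Rightarrow> 'k"
  proof
    fix T show "g T = 0 T" using that True r by (auto simp: cochains_def)
  qed
  then have C: "cochains U r = {0 :: 'v set \<Rightarrow> 'k}" by (auto simp: cochains_def)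
  then have Z: "cocycles f U \<Delta> r = {0 :: 'v set \<Rightarrow> 'k}"
    using cochain.subspace_0[OF subspace_cocycles[of f U \<Delta> r]] by (auto simp: cocycles_alt)
  have B: "coboundaries f U \<Delta> r = {0 :: 'v set \<Rightarrow> 'k}"
    using cochain.subspace_0[OF subspace_coboundaries[of f U \<Delta> r]] coboundary_cochain(1)[OF U(1), of _ f \<Delta> r] C by auto
  have "has_qdim (fscale (*)) {0 :: 'v set \<Rightarrow> 'k} {0} 0"
    by (rule has_qdim_self[OF vector_space_cochain cochain.subspace_single_0])
  then have "cohdim TYPE('k) f U \<Delta> r = 0" "m = 0"
    using cohdim_eqI[of f U \<Delta> r 0, where 'k = 'k] m Z B C has_qdim_unique[OF vector_space_cochain cochain.subspace_single_0] by (simp, metis)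
  \<comment> \<open>Truncated subtraction makes \<open>card U - 1\<close> equal to 0, and
    \<open>0 choose r\<close> vanishes because r is positive.\<close>
  then show ?thesis using True r by (simp add: binomial_eq_0)
next
  case False
  have B: "coboundaries f U \<Delta> r = (coboundaries f U UNIV r :: ('v set \<Rightarrow> 'k) set)"
    unfolding coboundaries_image
  proof (rule image_cong[OF refl])
    fix u :: "'v set \<Rightarrow> 'k" assume u: "u \<in> {u. \<forall>T. u T \<noteq> 0 \<longrightarrow> T \<subseteq> U \<and> Suc (card T) = r}"
    show "face_part U \<Delta> (codiff f U u) = face_part U UNIV (codiff f U u)"
    proof
      fix T show "face_part U \<Delta> (codiff f U u) T = face_part U UNIV (codiff f U u) T"
      proof (cases "T \<subseteq> U \<and> codiff f U u T \<noteq> 0")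
        case True
        then have "finite T" using U(1) finite_subset by blast
        with True obtain x where "u (T - {x}) \<noteq> 0" "card T = Suc (card (T - {x}))"
          by (metis codiff_support)
        then have "T \<in> \<Delta>" using u True by (intro small) auto
        then show ?thesis by (simp add: face_part_def)
      qed (auto simp: face_part_def)
    qed
  qed
  have "has_qdim (fscale (*)) (cochains U r) (coboundaries f U \<Delta> r :: ('v set \<Rightarrow> 'k) set) (cohdim TYPE('k) f U \<Delta> r + m)"
  proof (rule has_qdim_chain[OF vector_space_cochain subspace_cocycles subspace_coboundaries _ _ subspace_cochains cohdim[OF U(1)] m])
    show "cocycles f U \<Delta> r \<subseteq> (cochains U r :: ('v set \<Rightarrow> 'k) set)" by (auto simp: cocycles_alt)
    show "coboundaries f U \<Delta> r \<subseteq> (cocycles f U \<Delta> r :: ('v set \<Rightarrow> 'k) set)"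
    proof
      fix g :: "'v set \<Rightarrow> 'k" assume g: "g \<in> coboundaries f U \<Delta> r"
      then have "g \<in> cocycles f U UNIV r" unfolding B simplex_coboundaries[OF U False] .
      then show "g \<in> cocycles f U \<Delta> r" using coboundary_cochain(2)[OF U(1) g] by (auto simp: cocycles_def)
    qed
  qed
  moreover have "has_qdim (fscale (*)) (cochains U r) (coboundaries f U \<Delta> r :: ('v set \<Rightarrow> 'k) set) ((card U - 1) choose r)"
    unfolding B simplex_coboundaries[OF U False] by (rule simplex_dims[OF U False])
  ultimately show ?thesis
    using has_qdim_unique[OF vector_space_cochain subspace_coboundaries] by blast
qed

text \<open>Closedness is a condition on faces with r + 1 vertices, which lie on one side; hence
  cochains modulo cocycles are additive over the two sides, although the cochains themselves are
  not. The three instances of \<open>qdim_critical\<close> then leave the binomials.\<close>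

lemma cohdim_join_critical:
  "int (cohdim TYPE('k) f W \<Delta> r) = int (cohdim TYPE('k) f W1 \<Delta> r) + int (cohdim TYPE('k) f W2 \<Delta> r)
     + (int ((card W - 1) choose r) - int ((card W1 - 1) choose r) - int ((card W2 - 1) choose r))"
proof -
  interpret S: face_join f W2 W1 \<Delta> r \<epsilon>2 \<epsilon>1 by (rule swap)
  interpret R1: Vector_Spaces.linear "fscale (*)" "fscale (*)" "restr W1" by (rule linear_restr)
  let ?Z = "cocycles f W \<Delta> r :: ('v set \<Rightarrow> 'k) set"
  let ?C = "cochains W r :: ('v set \<Rightarrow> 'k) set"
  define M where "M = {g \<in> ?C. restr W1 g \<in> cocycles f W1 \<Delta> r}"
  have subM: "cochain.subspace M"
    using subspace_cochains[of W r] subspace_cocycles[of f W1 \<Delta> r]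
    by (auto simp: M_def cochain.subspace_def R1.zero R1.add R1.scale)
  have ZM: "?Z \<subseteq> M"
  proof
    fix g assume "g \<in> ?Z"
    then show "g \<in> M" using restr_cocycle[of g r] unfolding M_def cocycles_alt[of f W] by simp
  qed
  have ex: "\<exists>m. has_qdim (fscale (*)) (cochains U r) (cocycles f U \<Delta> r :: ('v set \<Rightarrow> 'k) set) m" if "finite U" for U
    by (rule has_qdim_exists[OF vector_space_cochain subspace_cochains subspace_cocycles order_refl has_qdim_cochains[OF that]])
  obtain m1 where m1: "has_qdim (fscale (*)) (cochains W1 r) (cocycles f W1 \<Delta> r :: ('v set \<Rightarrow> 'k) set) m1" using ex[OF fin(1)] ..
  obtain m2 where m2: "has_qdim (fscale (*)) (cochains W2 r) (cocycles f W2 \<Delta> r :: ('v set \<Rightarrow> 'k) set) m2" using ex[OF fin(2)] ..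
  have rC: "restr U g \<in> cochains U r" if "g \<in> ?C" for U g using that by (auto simp: restr_def cochains_def)
  have sub1: "g \<in> ?C" if "g \<in> cochains W1 r" for g :: "'v set \<Rightarrow> 'k" using that by (auto simp: cochains_def)
  have sub2: "g \<in> ?C" if "g \<in> cochains W2 r" for g :: "'v set \<Rightarrow> 'k" using that by (auto simp: cochains_def)
  have "has_qdim (fscale (*)) ?C M m1"
  proof (rule has_qdim_transfer[THEN iffD2, OF linear_restr subspace_cochains _ _ m1])
    show "restr W1 ` ?C = cochains W1 r"
    proof safe
      fix g :: "'v set \<Rightarrow> 'k" assume g: "g \<in> cochains W1 r"
      show "g \<in> restr W1 ` ?C" using sub1[OF g] by (intro image_eqI[where x = g]) (simp add: restr_id[OF g])
    qed (rule rC)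
  qed (simp add: M_def)
  moreover have "has_qdim (fscale (*)) M ?Z m2"
  proof (rule has_qdim_transfer[THEN iffD2, OF linear_restr subM _ _ m2])
    show "restr W2 ` M = cochains W2 r"
    proof safe
      fix g :: "'v set \<Rightarrow> 'k" assume g: "g \<in> cochains W2 r"
      then have "g \<in> M" using restr_other[OF g r] sub2[OF g] cochain.subspace_0[OF subspace_cocycles] by (simp add: M_def)
      then show "g \<in> restr W2 ` M" by (intro image_eqI[where x = g]) (simp add: S.restr_id[OF g])
    qed (simp add: M_def rC)
    fix g :: "'v set \<Rightarrow> 'k" assume g: "g \<in> M"
    then have gC: "g \<in> ?C" and g1: "restr W1 g \<in> cocycles f W1 \<Delta> r" by (auto simp: M_def)
    show "g \<in> ?Z \<longleftrightarrow> restr W2 g \<in> cocycles f W2 \<Delta> r"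
    proof
      assume "g \<in> ?Z" then show "restr W2 g \<in> cocycles f W2 \<Delta> r" using S.restr_cocycle by (simp add: Un_commute)
    next
      assume g2: "restr W2 g \<in> cocycles f W2 \<Delta> r"
      have "codiff f W g T = 0" if T: "T \<subseteq> W" "T \<in> \<Delta>" for T
      proof (rule ccontr)
        assume nz: "codiff f W g T \<noteq> 0"
        have fT: "finite T" using T fin finite_subset by blast
        from nz fT obtain x where "g (T - {x}) \<noteq> 0" "card T = Suc (card (T - {x}))"
          by (rule codiff_support)
        then have "r < card T" using gC by (auto simp: cochains_def)
        with T have "T \<subseteq> W1 \<or> T \<subseteq> W2" by (intro pure)
        then show False
        proof
          assume "T \<subseteq> W1"
          then have "codiff f W1 (restr W1 g) T = 0" using g1 T by (auto simp: cocycles_def)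
          then show False using nz \<open>T \<subseteq> W1\<close> by (simp add: codiff_restr codiff1)
        next
          assume "T \<subseteq> W2"
          then have "codiff f W2 (restr W2 g) T = 0" using g2 T by (auto simp: cocycles_def)
          then show False using nz \<open>T \<subseteq> W2\<close> by (simp add: codiff_restr codiff2)
        qed
      qed
      moreover have "T \<in> \<Delta>" if "g T \<noteq> 0" for T using gC that by (intro small) (auto simp: cochains_def)
      ultimately show "g \<in> ?Z" using gC by (simp add: cocycles_alt)
    qed
  qed
  ultimately have m: "has_qdim (fscale (*)) ?C ?Z (m2 + m1)"
    by (intro has_qdim_chain[OF vector_space_cochain subM subspace_cocycles ZM _ subspace_cochains]) (auto simp: M_def)
  have "cohdim TYPE('k) f W \<Delta> r + (m2 + m1) = (card W - 1) choose r"
    using fin by (intro qdim_critical[OF _ inj _ m] small) auto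
  moreover have "cohdim TYPE('k) f W1 \<Delta> r + m1 = (card W1 - 1) choose r"
    using inj by (intro qdim_critical[OF fin(1) _ _ m1] small) (auto intro: inj_on_subset)
  moreover have "cohdim TYPE('k) f W2 \<Delta> r + m2 = (card W2 - 1) choose r"
    using inj by (intro qdim_critical[OF fin(2) _ _ m2] small) (auto intro: inj_on_subset)
  ultimately show ?thesis by linarith
qed

end

text \<open>Seen from x in \<open>W1\<close> no vertex of \<open>W2\<close> is counted, and seen
  from x in \<open>W2\<close> all of \<open>W1\<close> is counted; hence the constants 1 and
  \<open>(- 1) ^ card W1\<close>.\<close>

lemma ksign_join:
  assumes fin: "finite W1" "finite W2" and less: "\<And>x y. x \<in> W1 \<Longrightarrow> y \<in> W2 \<Longrightarrow> f x < f y"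
  shows "x \<in> T \<Longrightarrow> T \<subseteq> W1 \<Longrightarrow> ksign f x (W1 \<union> W2 - T) = (1 * ksign f x (W1 - T) :: 'k::field)"
    and "x \<in> T \<Longrightarrow> T \<subseteq> W2 \<Longrightarrow> ksign f x (W1 \<union> W2 - T) = ((- 1) ^ card W1 * ksign f x (W2 - T) :: 'k::field)"
proof -
  assume x: "x \<in> T" "T \<subseteq> W1"
  have "\<not> f y < f x" if "y \<in> W2" for y using less[of x y] x that by auto
  then have "{y \<in> W1 \<union> W2 - T. f y < f x} = {y \<in> W1 - T. f y < f x}" by blast
  then show "ksign f x (W1 \<union> W2 - T) = (1 * ksign f x (W1 - T) :: 'k)" by (simp add: ksign_def)
next
  assume x: "x \<in> T" "T \<subseteq> W2"
  have "W1 \<inter> W2 = {}" using less by (meson disjoint_iff less_irrefl)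
  moreover have "f y < f x" if "y \<in> W1" for y using less[of y x] x that by auto
  ultimately have "{y \<in> W1 \<union> W2 - T. f y < f x} = W1 \<union> {y \<in> W2 - T. f y < f x}" using x by blast
  moreover have "card (W1 \<union> {y \<in> W2 - T. f y < f x}) = card W1 + card {y \<in> W2 - T. f y < f x}"
    using fin \<open>W1 \<inter> W2 = {}\<close> by (intro card_Un_disjoint) auto
  ultimately show "ksign f x (W1 \<union> W2 - T) = ((- 1) ^ card W1 * ksign f x (W2 - T) :: 'k)"
    by (simp add: ksign_def power_add)
qed


section \<open>Graded matrices and syzygies\<close>

definition hcomp :: "int \<Rightarrow> ('v, 'k::field) mpoly \<Rightarrow> ('v, 'k) mpoly" where
  "hcomp e p = (\<Sum>m | m \<in> keys p \<and> int (mon_degree m) = e. single m (lookup p m))"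

lemma lookup_hcomp: "lookup (hcomp e p) m = (if int (mon_degree m) = e then lookup p m else 0)"
  by (auto simp: hcomp_def lookup_sum lookup_single when_def in_keys_iff)

definition hom_in :: "'v set \<Rightarrow> int \<Rightarrow> ('v, 'k::field) mpoly \<Rightarrow> bool" where
  "hom_in V e p \<longleftrightarrow> (\<forall>m. lookup p m \<noteq> 0 \<longrightarrow> m \<in> monomials V e)"

lemma hom_in_iff: "hom_in V e p \<longleftrightarrow> p \<in> poly_ring V \<and> homogeneous e p"
  by (simp add: hom_in_def poly_ring_homogeneous_iff)

lemma poly_ring_iff: "p \<in> poly_ring V \<longleftrightarrow> (\<forall>m. lookup p m \<noteq> 0 \<longrightarrow> keys m \<subseteq> V)"
  by (auto simp: poly_ring_def in_keys_iff)

lemma lookup_mult_neq_0: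
  fixes p q :: "('v, 'k::field) mpoly"
  assumes "lookup (p * q) m \<noteq> 0"
  obtains m1 m2 where "m = m1 + m2" "lookup p m1 \<noteq> 0" "lookup q m2 \<noteq> 0"
proof -
  have "m \<in> keys (p * q)" using assms by (simp add: in_keys_iff)
  then have "m \<in> {a + b |a b. a \<in> keys p \<and> b \<in> keys q}" using keys_mult[of p q] by blast
  then show thesis using that by (auto simp: in_keys_iff)
qed

lemma hom_in_mult: "hom_in V e p \<Longrightarrow> hom_in V e' q \<Longrightarrow> hom_in V (e + e') (p * q)"
  unfolding hom_in_def
proof (intro allI impI)
  fix m assume pq: "\<forall>m. lookup p m \<noteq> 0 \<longrightarrow> m \<in> monomials V e" "\<forall>m. lookup q m \<noteq> 0 \<longrightarrow> m \<in> monomials V e'"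
    and "lookup (p * q) m \<noteq> 0"
  then obtain m1 m2 where "m = m1 + m2" "lookup p m1 \<noteq> 0" "lookup q m2 \<noteq> 0" by (elim lookup_mult_neq_0)
  with pq have "m = m1 + m2" "m1 \<in> monomials V e" "m2 \<in> monomials V e'" by auto
  then show "m \<in> monomials V (e + e')" by (auto simp: monomials_def keys_plus_nat mon_degree_add)
qed

lemma hom_in_add: "hom_in V e p \<Longrightarrow> hom_in V e q \<Longrightarrow> hom_in V e (p + q)"
  unfolding hom_in_def by (metis add.right_neutral lookup_add)

lemma hom_in_sum: "(\<And>b. b \<in> B \<Longrightarrow> hom_in V e (p b)) \<Longrightarrow> hom_in V e (\<Sum>b\<in>B. p b)"
  by (induction B rule: infinite_finite_induct) (auto simp: hom_in_add, auto simp: hom_in_def)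

lemma poly_ring_mult: "p \<in> poly_ring V \<Longrightarrow> q \<in> poly_ring V \<Longrightarrow> p * q \<in> poly_ring V"
  unfolding poly_ring_iff
proof (intro allI impI)
  fix m assume pq: "\<forall>m. lookup p m \<noteq> 0 \<longrightarrow> keys m \<subseteq> V" "\<forall>m. lookup q m \<noteq> 0 \<longrightarrow> keys m \<subseteq> V"
    and "lookup (p * q) m \<noteq> 0"
  then obtain m1 m2 where "m = m1 + m2" "lookup p m1 \<noteq> 0" "lookup q m2 \<noteq> 0" by (elim lookup_mult_neq_0)
  with pq show "keys m \<subseteq> V" by (auto simp: keys_plus_nat)
qed

lemma poly_ring_add: "p \<in> poly_ring V \<Longrightarrow> q \<in> poly_ring V \<Longrightarrow> p + q \<in> poly_ring V"
  unfolding poly_ring_iff by (metis add.right_neutral lookup_add)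

lemma poly_ring_sum: "(\<And>b. b \<in> B \<Longrightarrow> p b \<in> poly_ring V) \<Longrightarrow> (\<Sum>b\<in>B. p b) \<in> poly_ring V"
  by (induction B rule: infinite_finite_induct) (auto simp: poly_ring_add, auto simp: poly_ring_iff)

lemma hcomp_mult:
  fixes p q :: "('v, 'k::field) mpoly"
  assumes q: "homogeneous e q"
  shows "hcomp (e + e') (q * p) = q * hcomp e' p"
proof (rule poly_mapping_eqI)
  fix m
  have q': "int (mon_degree m1) = e" if "lookup q m1 \<noteq> 0" for m1
    using q that by (auto simp: homogeneous_def in_keys_iff)
  define p' where "p' = p - hcomp e' p"
  have p': "int (mon_degree m2) \<noteq> e'" if "lookup p' m2 \<noteq> 0" for m2
    using that by (auto simp: p'_def lookup_minus lookup_hcomp)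
  have split: "lookup (q * p) m = lookup (q * hcomp e' p) m + lookup (q * p') m"
    by (simp add: p'_def algebra_simps flip: lookup_add)
  have "lookup (q * p') m = 0" if "int (mon_degree m) = e + e'"
  proof (rule ccontr)
    assume "lookup (q * p') m \<noteq> 0"
    then obtain m1 m2 where "m = m1 + m2" "lookup q m1 \<noteq> 0" "lookup p' m2 \<noteq> 0" by (rule lookup_mult_neq_0)
    with q'[of m1] p'[of m2] that show False by (simp add: mon_degree_add)
  qed
  moreover have "lookup (q * hcomp e' p) m = 0" if "int (mon_degree m) \<noteq> e + e'"
  proof (rule ccontr)
    assume "lookup (q * hcomp e' p) m \<noteq> 0"
    then obtain m1 m2 where "m = m1 + m2" "lookup q m1 \<noteq> 0" "lookup (hcomp e' p) m2 \<noteq> 0" by (rule lookup_mult_neq_0)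
    with q'[of m1] that show False by (simp add: mon_degree_add lookup_hcomp split: if_splits)
  qed
  ultimately show "lookup (hcomp (e + e') (q * p)) m = lookup (q * hcomp e' p) m"
    using split by (simp add: lookup_hcomp)
qed

lemma hcomp_sum: "hcomp e (\<Sum>b\<in>B. p b) = (\<Sum>b\<in>B. hcomp e (p b))"
  by (rule poly_mapping_eqI) (simp add: lookup_hcomp lookup_sum)

lemma hcomp_hom: "homogeneous e p \<Longrightarrow> hcomp e' p = (if e = e' then p else 0)"
  by (rule poly_mapping_eqI) (auto simp: lookup_hcomp homogeneous_def in_keys_iff)

text \<open>Exponents add without cancellation, so only the constant terms contribute to the
  constant term of a product.\<close>

lemma lookup_mult_0: "lookup (p * q :: ('v, 'k::field) mpoly) 0 = lookup p 0 * lookup q 0"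
proof -
  define p' where "p' = p - single 0 (lookup p 0)"
  have "lookup (p' * q) 0 = 0"
  proof (rule ccontr)
    assume "lookup (p' * q) 0 \<noteq> 0"
    then obtain m1 m2 where m: "0 = m1 + m2" "lookup p' m1 \<noteq> 0" by (rule lookup_mult_neq_0)
    have "mon_degree (m1 + m2) = 0" using m(1) by (metis mon_degree_0)
    then have "m1 = 0" by (simp add: mon_degree_add mon_degree_eq_0_iff)
    with m(2) show False by (simp add: p'_def lookup_minus)
  qed
  moreover have "p * q = single 0 (lookup p 0) * q + p' * q" by (simp add: p'_def algebra_simps)
  ultimately show ?thesis by (simp add: lookup_add lookup_const_mult)
qed

section \<open>Graded matrices and their images\<close>

definition mat_act :: "nat \<Rightarrow> (nat \<Rightarrow> nat \<Rightarrow> ('v, 'k::field) mpoly) \<Rightarrow> (nat \<Rightarrow> ('v, 'k) mpoly) \<Rightarrow> nat \<Rightarrow> ('v, 'k) mpoly" where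
  "mat_act n A g a = (\<Sum>b<n. A a b * g b)"

text \<open>The degree \<open>d b - d' a\<close> of an entry makes the map preserve degrees. Entries
  outside the format are 0, so that images are again functions vanishing beyond the rank.\<close>

definition graded_mat :: "'v set \<Rightarrow> nat \<Rightarrow> (nat \<Rightarrow> int) \<Rightarrow> nat \<Rightarrow> (nat \<Rightarrow> int) \<Rightarrow> (nat \<Rightarrow> nat \<Rightarrow> ('v, 'k::field) mpoly) \<Rightarrow> bool" where
  "graded_mat V n' d' n d A \<longleftrightarrow> (\<forall>a b. a < n' \<longrightarrow> b < n \<longrightarrow> hom_in V (d b - d' a) (A a b)) \<and>
     (\<forall>a b. \<not> (a < n' \<and> b < n) \<longrightarrow> A a b = 0)"

definition free_all :: "'v set \<Rightarrow> nat \<Rightarrow> (nat \<Rightarrow> ('v, 'k::field) mpoly) set" where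
  "free_all V n = {g. (\<forall>a<n. g a \<in> poly_ring V) \<and> (\<forall>a\<ge>n. g a = 0)}"

definition deg_part :: "(nat \<Rightarrow> int) \<Rightarrow> int \<Rightarrow> (nat \<Rightarrow> ('v, 'k::field) mpoly) \<Rightarrow> nat \<Rightarrow> ('v, 'k) mpoly" where
  "deg_part d j g a = hcomp (j - d a) (g a)"

text \<open>The ungraded module whose homogeneous parts lie in the given pieces. It connects the
  degreewise Koszul arguments with the exactness condition of a resolution, which speaks of all
  elements at once.\<close>

definition all_degrees :: "'v set \<Rightarrow> nat \<Rightarrow> (nat \<Rightarrow> int) \<Rightarrow> (int \<Rightarrow> (nat \<Rightarrow> ('v, 'k::field) mpoly) set) \<Rightarrow> (nat \<Rightarrow> ('v, 'k) mpoly) set" where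
  "all_degrees V n d N = {g \<in> free_all V n. \<forall>j. deg_part d j g \<in> N j}"

lemma free_piece_hom: "free_piece V n d j = {g. (\<forall>a<n. hom_in V (j - d a) (g a)) \<and> (\<forall>a\<ge>n. g a = 0)}"
  unfolding free_piece_def hom_in_iff ..

lemma free_piece_subset: "free_piece V n d j \<subseteq> free_all V n"
  by (auto simp: free_piece_def free_all_def)

lemma deg_part_free_piece: "g \<in> free_all V n \<Longrightarrow> deg_part d j g \<in> free_piece V n d j"
  by (auto simp: free_piece_hom free_all_def deg_part_def hom_in_def lookup_hcomp monomials_def poly_ring_iff
      intro!: poly_mapping_eqI split: if_splits)

lemma deg_part_homogeneous:
  assumes "g \<in> free_piece V n d j"
  shows "deg_part d j' g = (if j = j' then g else 0)"
proof
  fix a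
  show "deg_part d j' g a = (if j = j' then g else 0) a"
  proof (cases "a < n")
    case True
    then have "homogeneous (j - d a) (g a)" using assms by (simp add: free_piece_def)
    then show ?thesis by (simp add: deg_part_def hcomp_hom)
  next
    case False
    then have "g a = 0" using assms by (simp add: free_piece_def)
    then show ?thesis by (simp add: deg_part_def hcomp_def)
  qed
qed

lemma deg_part_sum:
  assumes g: "g \<in> free_all V n"
  obtains J where "finite J" "g = (\<Sum>j\<in>J. deg_part d j g)"
proof -
  define J where "J = (\<Union>a<n. (\<lambda>m. d a + int (mon_degree m)) ` keys (g a))"
  have finJ: "finite J" by (simp add: J_def)
  moreover have "g = (\<Sum>j\<in>J. deg_part d j g)"
  proof (intro ext poly_mapping_eqI)
    fix a m
    have "lookup ((\<Sum>j\<in>J. deg_part d j g) a) m = (\<Sum>j\<in>J. if j = d a + int (mon_degree m) then lookup (g a) m else 0)"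
      unfolding sum_fun_apply lookup_sum deg_part_def lookup_hcomp by (intro sum.cong) auto
    also have "\<dots> = (if d a + int (mon_degree m) \<in> J then lookup (g a) m else 0)" using finJ by simp
    also have "\<dots> = lookup (g a) m"
    proof (cases "lookup (g a) m = 0")
      case False
      then have "a < n" using g by (auto simp: free_all_def not_less intro: ccontr)
      moreover have "m \<in> keys (g a)" using False by (simp add: in_keys_iff)
      ultimately have "d a + int (mon_degree m) \<in> J" unfolding J_def by blast
      then show ?thesis by simp
    qed simp
    finally show "lookup (g a) m = lookup ((\<Sum>j\<in>J. deg_part d j g) a) m" ..
  qed
  ultimately show thesis by (rule that)
qed

lemma mat_act_sum: "mat_act n A (\<Sum>j\<in>J. g j) = (\<Sum>j\<in>J. mat_act n A (g j))"
proof
  fix a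
  have "mat_act n A (\<Sum>j\<in>J. g j) a = (\<Sum>b<n. \<Sum>j\<in>J. A a b * g j b)"
    by (simp add: mat_act_def sum_fun_apply sum_distrib_left)
  also have "\<dots> = (\<Sum>j\<in>J. mat_act n A (g j)) a" unfolding mat_act_def sum_fun_apply by (rule sum.swap)
  finally show "mat_act n A (\<Sum>j\<in>J. g j) a = (\<Sum>j\<in>J. mat_act n A (g j)) a" .
qed

lemma linear_mat_act: "Vector_Spaces.linear vscale vscale (mat_act n A :: (nat \<Rightarrow> ('v, 'k::field) mpoly) \<Rightarrow> _)"
  by (rule linearI[OF vector_space_vscale vector_space_vscale])
    (auto simp: mat_act_def fun_eq_iff algebra_simps sum.distrib pscale_def sum_distrib_left mult.left_commute)

lemma mat_act_var: "mat_act n A (var_act x g) = var_act x (mat_act n A g)"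
  by (auto simp: mat_act_def var_act_def fun_eq_iff sum_distrib_left mult.left_commute intro!: sum.cong)

context
  fixes V :: "'v set" and n n' :: nat and d d' :: "nat \<Rightarrow> int" and A :: "nat \<Rightarrow> nat \<Rightarrow> ('v, 'k::field) mpoly"
  assumes A: "graded_mat V n' d' n d A"
begin

lemma mat_act_piece: "g \<in> free_piece V n d j \<Longrightarrow> mat_act n A g \<in> free_piece V n' d' j"
  unfolding free_piece_hom
proof (intro CollectI conjI allI impI)
  fix a assume g: "g \<in> {g. (\<forall>a<n. hom_in V (j - d a) (g a)) \<and> (\<forall>a\<ge>n. g a = 0)}"
  { assume "a < n'"
    have "hom_in V ((d b - d' a) + (j - d b)) (A a b * g b)" if "b < n" for b
      using A g that \<open>a < n'\<close> by (intro hom_in_mult) (auto simp: graded_mat_def)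
    then show "hom_in V (j - d' a) (mat_act n A g a)"
      unfolding mat_act_def by (intro hom_in_sum) auto }
  { assume "n' \<le> a"
    then show "mat_act n A g a = 0" using A by (auto simp: mat_act_def graded_mat_def intro!: sum.neutral) }
qed

lemma mat_act_all: "g \<in> free_all V n \<Longrightarrow> mat_act n A g \<in> free_all V n'"
  unfolding free_all_def
proof (intro CollectI conjI allI impI)
  fix a assume g: "g \<in> {g. (\<forall>a<n. g a \<in> poly_ring V) \<and> (\<forall>a\<ge>n. g a = 0)}"
  { assume "a < n'"
    then show "mat_act n A g a \<in> poly_ring V"
      unfolding mat_act_def using A g by (intro poly_ring_sum poly_ring_mult) (auto simp: graded_mat_def hom_in_iff) }
  { assume "n' \<le> a"
    then show "mat_act n A g a = 0" using A by (auto simp: mat_act_def graded_mat_def intro!: sum.neutral) }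
qed

lemma deg_part_mat_act: "deg_part d' j (mat_act n A g) = mat_act n A (deg_part d j g)"
proof
  fix a
  have "hcomp (j - d' a) (A a b * g b) = A a b * hcomp (j - d b) (g b)" if "b < n" for b
  proof (cases "a < n'")
    case True
    then have "homogeneous (d b - d' a) (A a b)" using A that by (auto simp: graded_mat_def hom_in_iff)
    from hcomp_mult[OF this, of "j - d b" "g b"] show ?thesis by simp
  next
    case False
    then have "A a b = 0" using A by (auto simp: graded_mat_def)
    then show ?thesis by (simp add: hcomp_def)
  qed
  then show "deg_part d' j (mat_act n A g) a = mat_act n A (deg_part d j g) a"
    by (auto simp: deg_part_def mat_act_def hcomp_sum intro!: sum.cong)
qed

text \<open>A graded map commutes with taking homogeneous parts, and every vector is a finite sum of
  such parts; so exactness may be checked degree by degree.\<close>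

lemma image_piece_iff_all_degrees:
  assumes N: "\<And>j. N j \<subseteq> free_piece V n' d' j" "\<And>j. 0 \<in> N j"
  shows "(\<forall>j. mat_act n A ` free_piece V n d j = N j) \<longleftrightarrow> mat_act n A ` free_all V n = all_degrees V n' d' N"
proof
  assume img: "\<forall>j. mat_act n A ` free_piece V n d j = N j"
  show "mat_act n A ` free_all V n = all_degrees V n' d' N"
  proof (intro equalityI subsetI)
    fix h assume "h \<in> mat_act n A ` free_all V n"
    then obtain g where g: "g \<in> free_all V n" "h = mat_act n A g" by blast
    have "deg_part d' j h \<in> N j" for j
      using img deg_part_free_piece[OF g(1), of d j] unfolding g(2) deg_part_mat_act by blast
    then show "h \<in> all_degrees V n' d' N" using mat_act_all[OF g(1)] g(2) by (simp add: all_degrees_def)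
  next
    fix h assume "h \<in> all_degrees V n' d' N"
    then have h: "h \<in> free_all V n'" "\<And>j. deg_part d' j h \<in> N j" by (auto simp: all_degrees_def)
    obtain J where J: "finite J" "h = (\<Sum>j\<in>J. deg_part d' j h)" by (rule deg_part_sum[OF h(1)])
    have "\<exists>g. g \<in> free_piece V n d j \<and> mat_act n A g = deg_part d' j h" for j
    proof -
      have "deg_part d' j h \<in> mat_act n A ` free_piece V n d j" using h(2) img by simp
      then show ?thesis by (elim imageE) auto
    qed
    \<comment> \<open>Preimages are chosen in every degree; only those of the finitely many degrees
      in \<open>J\<close> are summed.\<close>
    then obtain G where G: "\<And>j. G j \<in> free_piece V n d j" "\<And>j. mat_act n A (G j) = deg_part d' j h" by metis
    have "(\<Sum>j\<in>J. G j) \<in> free_all V n"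
      unfolding free_all_def
    proof (intro CollectI conjI allI impI)
      fix a
      show "a < n \<Longrightarrow> (\<Sum>j\<in>J. G j) a \<in> poly_ring V"
        using G(1) unfolding sum_fun_apply by (intro poly_ring_sum) (auto simp: free_piece_def)
      show "n \<le> a \<Longrightarrow> (\<Sum>j\<in>J. G j) a = 0"
        using G(1) unfolding sum_fun_apply by (intro sum.neutral) (auto simp: free_piece_def)
    qed
    moreover have "mat_act n A (\<Sum>j\<in>J. G j) = h" unfolding mat_act_sum G(2) using J(2) by simp
    ultimately show "h \<in> mat_act n A ` free_all V n" by blast
  qed
next
  assume tot: "mat_act n A ` free_all V n = all_degrees V n' d' N"
  show "\<forall>j. mat_act n A ` free_piece V n d j = N j"
  proof (intro allI equalityI subsetI)
    fix j h assume "h \<in> mat_act n A ` free_piece V n d j"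
    then obtain g where g: "g \<in> free_piece V n d j" "h = mat_act n A g" by blast
    then have "h \<in> all_degrees V n' d' N" using tot free_piece_subset by blast
    then have "deg_part d' j h \<in> N j" by (simp add: all_degrees_def)
    then show "h \<in> N j" using deg_part_homogeneous[OF mat_act_piece[OF g(1)], of j] g(2) by simp
  next
    fix j h assume h: "h \<in> N j"
    then have hp: "h \<in> free_piece V n' d' j" using N by blast
    have "deg_part d' j' h \<in> N j'" for j' using deg_part_homogeneous[OF hp, of j'] h N(2) by auto
    moreover have "h \<in> free_all V n'" using hp free_piece_subset by blast
    ultimately have "h \<in> all_degrees V n' d' N" by (simp add: all_degrees_def)
    then obtain g where g: "g \<in> free_all V n" "h = mat_act n A g" using tot by blast
    have "h = deg_part d' j h" using deg_part_homogeneous[OF hp, of j] by simp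
    also have "\<dots> = mat_act n A (deg_part d j g)" unfolding g(2) by (rule deg_part_mat_act)
    finally show "h \<in> mat_act n A ` free_piece V n d j" using deg_part_free_piece[OF g(1)] by blast
  qed
qed

text \<open>The kernel of a graded map contains the homogeneous parts of its elements and is closed
  under sums.\<close>

lemma all_degrees_kernel:
  "all_degrees V n d (\<lambda>j. {g \<in> free_piece V n d j. mat_act n A g = 0}) = {g \<in> free_all V n. mat_act n A g = 0}"
proof (intro equalityI subsetI)
  fix g assume "g \<in> all_degrees V n d (\<lambda>j. {g \<in> free_piece V n d j. mat_act n A g = 0})"
  then have g: "g \<in> free_all V n" "\<And>j. mat_act n A (deg_part d j g) = 0" by (auto simp: all_degrees_def)
  obtain J where "g = (\<Sum>j\<in>J. deg_part d j g)" by (rule deg_part_sum[OF g(1)])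
  then have "mat_act n A g = (\<Sum>j\<in>J. mat_act n A (deg_part d j g))" by (metis mat_act_sum)
  then show "g \<in> {g \<in> free_all V n. mat_act n A g = 0}" using g by simp
next
  fix g assume "g \<in> {g \<in> free_all V n. mat_act n A g = 0}"
  then have g: "g \<in> free_all V n" "mat_act n A g = 0" by auto
  have "mat_act n A (deg_part d j g) = 0" for j
    unfolding deg_part_mat_act[symmetric] g(2) by (simp add: deg_part_def hcomp_def fun_eq_iff)
  then show "g \<in> all_degrees V n d (\<lambda>j. {g \<in> free_piece V n d j. mat_act n A g = 0})"
    using g deg_part_free_piece[OF g(1)] by (simp add: all_degrees_def)
qed

end

lemma all_degrees_ideal_piece:
  fixes V :: "'v set"
  shows "all_degrees V 1 (\<lambda>_. 0) (ideal_piece V \<G>) = {g \<in> free_all V 1. g 0 \<in> (mon_ideal V \<G> :: ('v, 'k::field) mpoly set)}"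
proof (intro Set.set_eqI)
  fix g :: "nat \<Rightarrow> ('v, 'k) mpoly"
  have "(\<forall>j. deg_part (\<lambda>_. 0) j g 0 \<in> mon_ideal V \<G>) \<longleftrightarrow> g 0 \<in> mon_ideal V \<G>"
    by (auto simp: mon_ideal_def poly_ring_iff deg_part_def lookup_hcomp in_keys_iff split: if_splits)
  then show "g \<in> all_degrees V 1 (\<lambda>_. 0) (ideal_piece V \<G>) \<longleftrightarrow> g \<in> {g \<in> free_all V 1. g 0 \<in> mon_ideal V \<G>}"
    using deg_part_free_piece[of g V 1 "\<lambda>_. 0"] by (auto simp: all_degrees_def ideal_piece_def)
qed

context poly_koszul
begin

text \<open>\<open>min\<close> is minimality in matrix form: elements of the kernel have no constant
  terms, hence by \<open>free_exact\<close> they lie in the irrelevant ideal times the free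
  module.\<close>

lemma koszul_surj_mat:
  assumes A: "graded_mat V n' d' n d A" and N': "graded_sub N'"
    and img: "\<And>j. mat_act n A ` free_piece V n d j = N' j"
    and min: "\<And>g j a. g \<in> free_piece V n d j \<Longrightarrow> mat_act n A g = 0 \<Longrightarrow> a < n \<Longrightarrow> lookup (g a) 0 = (0 :: 'k)"
  shows "koszul_surj vscale V f var_act (free_piece V n d) N' (mat_act n A)"
proof (intro koszul_surj.intro koszul_surj_axioms.intro koszul_axioms)
  show "graded_sub (free_piece V n d)" by (rule graded_free_piece)
  show "graded_sub N'" by (rule N')
  show "Vector_Spaces.linear vscale vscale (mat_act n A)" by (rule linear_mat_act)
  show "mat_act n A ` free_piece V n d j = N' j" for j by (rule img)
  show "c \<in> kbounds (free_piece V n d) (Suc p) j" if "c \<in> K (free_piece V n d) (Suc p) j" "D c = 0" for c :: "'v set \<Rightarrow> nat \<Rightarrow> ('v, 'k) mpoly" and p j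
    using that by (rule free_exact) simp
  show "c \<in> kbounds (free_piece V n d) 0 j"
    if c: "c \<in> K (free_piece V n d) 0 j" "mat_act n A (c {}) = 0" for c :: "'v set \<Rightarrow> nat \<Rightarrow> ('v, 'k) mpoly" and j
    using min[OF _ c(2)] chain_mem[OF graded_free_piece c(1), of "{}"]
    by (intro free_exact[OF c(1) D_chain_0[OF c(1)]]) simp
qed (simp add: mat_act_var)

lemma
  assumes A: "graded_mat V n' d' n d A" and N': "graded_sub N'"
    and img: "\<And>j. mat_act n A ` free_piece V n d j = N' j"
    and min: "\<And>g j a. g \<in> free_piece V n d j \<Longrightarrow> mat_act n A g = 0 \<Longrightarrow> a < n \<Longrightarrow> lookup (g a) 0 = (0 :: 'k)"
  shows graded_kernel: "graded_sub (\<lambda>j. {g \<in> free_piece V n d j. mat_act n A g = 0})"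
    and khom_syzygy: "khom (\<lambda>j. {g \<in> free_piece V n d j. mat_act n A g = 0}) p j k \<longleftrightarrow> khom N' (Suc p) j k"
    and khom_generators: "khom N' 0 j (card {b\<in>{..<n}. d b = j})"
proof -
  interpret S: koszul_surj "vscale :: 'k \<Rightarrow> _" V f var_act "free_piece V n d" N' "mat_act n A"
    by (rule koszul_surj_mat[OF A N']) (fact img, fact min)
  have N: "S.N = (\<lambda>j. {g \<in> free_piece V n d j. mat_act n A g = 0})" by (rule ext) (simp add: S.N_def)
  show "graded_sub (\<lambda>j. {g \<in> free_piece V n d j. mat_act n A g = 0})" using S.N unfolding N .
  show "khom (\<lambda>j. {g \<in> free_piece V n d j. mat_act n A g = 0}) p j k \<longleftrightarrow> khom N' (Suc p) j k"
    using S.khom_shift unfolding N .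
  show "khom N' 0 j (card {b\<in>{..<n}. d b = j})" using khom_free S.khom_0 by blast
qed

end


section \<open>Koszul homology reads off a minimal resolution\<close>

text \<open>Vectors of fixed length become functions that are 0 beyond it, the form of free modules
  in which the Koszul arguments are stated.\<close>

definition vec_fun :: "('v, 'k::field) mpoly vec \<Rightarrow> nat \<Rightarrow> ('v, 'k) mpoly" where
  "vec_fun v a = (if a < dim_vec v then v $ a else 0)"

definition mat_fun :: "('v, 'k::field) mpoly mat \<Rightarrow> nat \<Rightarrow> nat \<Rightarrow> ('v, 'k) mpoly" where
  "mat_fun M a b = (if a < dim_row M \<and> b < dim_col M then M $$ (a, b) else 0)"

lemma vec_fun_vec: "(\<And>a. n \<le> a \<Longrightarrow> g a = 0) \<Longrightarrow> vec_fun (vec n g) = g"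
  by (auto simp: vec_fun_def fun_eq_iff)

lemma inj_vec_fun: "inj_on vec_fun (carrier_vec n)"
proof (rule inj_onI)
  fix v w :: "('v, 'k::field) mpoly vec" assume vw: "v \<in> carrier_vec n" "w \<in> carrier_vec n" "vec_fun v = vec_fun w"
  show "v = w"
  proof (rule eq_vecI)
    fix a assume "a < dim_vec w"
    then show "v $ a = w $ a" using carrier_vecD[OF vw(1)] carrier_vecD[OF vw(2)] fun_cong[OF vw(3), of a]
      by (simp add: vec_fun_def)
  qed (use vw in simp)
qed

lemma vec_fun_image_free_mod: "vec_fun ` free_mod V n = free_all V n"
proof (intro equalityI subsetI)
  fix g assume "g \<in> free_all V n"
  then have "vec n g \<in> free_mod V n" "vec_fun (vec n g) = g"
    by (auto simp: free_mod_def free_all_def intro: vec_fun_vec)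
  then show "g \<in> vec_fun ` free_mod V n" by (metis image_eqI)
qed (auto simp: free_mod_def free_all_def vec_fun_def)

lemma vec_fun_mult_mat_vec:
  assumes "M \<in> carrier_mat n m" "v \<in> carrier_vec m"
  shows "vec_fun (M *\<^sub>v v) = mat_act m (mat_fun M) (vec_fun v)"
proof
  fix a
  show "vec_fun (M *\<^sub>v v) a = mat_act m (mat_fun M) (vec_fun v) a"
  proof (cases "a < n")
    case True
    then have "vec_fun (M *\<^sub>v v) a = (\<Sum>b = 0..<m. M $$ (a, b) * v $ b)"
      using assms by (simp add: vec_fun_def scalar_prod_def)
    also have "\<dots> = mat_act m (mat_fun M) (vec_fun v) a"
      unfolding mat_act_def atLeast0LessThan using assms True by (intro sum.cong) (auto simp: mat_fun_def vec_fun_def)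
    finally show ?thesis .
  next
    case False
    then show ?thesis using assms by (simp add: vec_fun_def mat_act_def mat_fun_def)
  qed
qed

lemma vec_fun_scalar_prod:
  assumes "v \<in> carrier_vec n" "w \<in> carrier_vec n"
  shows "scalar_prod v w = (\<Sum>a<n. vec_fun v a * vec_fun w a)"
  using assms unfolding scalar_prod_def by (auto simp: vec_fun_def atLeast0LessThan intro!: sum.cong)

lemma free_mod_carrier: "f \<in> free_mod V n \<Longrightarrow> f \<in> carrier_vec n"
  by (simp add: free_mod_def)

lemma vec_fun_image_mult:
  assumes "M \<in> carrier_mat n m"
  shows "vec_fun ` (\<lambda>g. M *\<^sub>v g) ` free_mod V m = mat_act m (mat_fun M) ` free_all V m"
proof -
  have "vec_fun ` (\<lambda>g. M *\<^sub>v g) ` free_mod V m = (\<lambda>v. mat_act m (mat_fun M) (vec_fun v)) ` free_mod V m"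
    unfolding image_image using vec_fun_mult_mat_vec[OF assms free_mod_carrier] by (intro image_cong) auto
  also have "\<dots> = mat_act m (mat_fun M) ` free_all V m"
    unfolding vec_fun_image_free_mod[symmetric] image_image ..
  finally show ?thesis .
qed

lemma vec_fun_eq_0_iff: "v \<in> carrier_vec n \<Longrightarrow> vec_fun v = 0 \<longleftrightarrow> v = 0\<^sub>v n"
  using inj_onD[OF inj_vec_fun[of n], of v "0\<^sub>v n"] by (auto simp: vec_fun_def fun_eq_iff)

text \<open>\<open>vec_fun\<close> is injective on vectors of fixed length, so an equality of sets
  of vectors can be tested after translation into functions.\<close>

lemma exact_iff_fun:
  assumes S: "S = {f \<in> free_mod V n. P (vec_fun f)}" and M: "M \<in> carrier_mat n m"
  shows "S = (\<lambda>g. M *\<^sub>v g) ` free_mod V m \<longleftrightarrow> {g \<in> free_all V n. P g} = mat_act m (mat_fun M) ` free_all V m"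
proof -
  have "S \<subseteq> carrier_vec n" "(\<lambda>g. M *\<^sub>v g) ` free_mod V m \<subseteq> carrier_vec n"
    using M by (auto simp: S free_mod_def)
  then have "S = (\<lambda>g. M *\<^sub>v g) ` free_mod V m \<longleftrightarrow> vec_fun ` S = vec_fun ` (\<lambda>g. M *\<^sub>v g) ` free_mod V m"
    by (simp add: inj_on_image_eq_iff[OF inj_vec_fun])
  moreover have "vec_fun ` S = {g \<in> free_all V n. P g}"
    unfolding S vec_fun_image_free_mod[symmetric] by blast
  ultimately show ?thesis by (simp add: vec_fun_image_mult[OF M])
qed

lemma exact_kernel_iff:
  assumes M: "M \<in> carrier_mat n m" and M': "M' \<in> carrier_mat m l"
  shows "{f \<in> free_mod V m. M *\<^sub>v f = 0\<^sub>v n} = (\<lambda>g. M' *\<^sub>v g) ` free_mod V l \<longleftrightarrow>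
    {g \<in> free_all V m. mat_act m (mat_fun M) g = 0} = mat_act l (mat_fun M') ` free_all V l"
proof (rule exact_iff_fun[OF _ M'])
  have "M *\<^sub>v v = 0\<^sub>v n \<longleftrightarrow> mat_act m (mat_fun M) (vec_fun v) = 0" if "v \<in> free_mod V m" for v
    using vec_fun_eq_0_iff[OF mult_mat_vec_carrier[OF M free_mod_carrier[OF that]]]
      vec_fun_mult_mat_vec[OF M free_mod_carrier[OF that]] by simp
  then show "{f \<in> free_mod V m. M *\<^sub>v f = 0\<^sub>v n} = {f \<in> free_mod V m. mat_act m (mat_fun M) (vec_fun f) = 0}"
    by (intro Collect_cong conj_cong refl) simp
qed

lemma exact_augmentation_iff:
  assumes w: "w \<in> carrier_vec n" and M: "M \<in> carrier_mat n m"
  shows "{f \<in> free_mod V n. scalar_prod w f \<in> I} = (\<lambda>g. M *\<^sub>v g) ` free_mod V m \<longleftrightarrow>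
    {g \<in> free_all V n. (\<Sum>a<n. vec_fun w a * g a) \<in> I} = mat_act m (mat_fun M) ` free_all V m"
proof (rule exact_iff_fun[OF _ M])
  show "{f \<in> free_mod V n. scalar_prod w f \<in> I} = {f \<in> free_mod V n. (\<Sum>a<n. vec_fun w a * vec_fun f a) \<in> I}"
    using vec_fun_scalar_prod[OF w free_mod_carrier] by (intro Collect_cong conj_cong refl) simp
qed

lemma mat_act_no_const:
  assumes "\<And>a b. lookup (A a b) 0 = 0" shows "lookup (mat_act n A g a) 0 = 0"
  by (simp add: mat_act_def lookup_sum lookup_mult_0 assms)

lemma homogeneous_const:
  assumes "homogeneous e p" "lookup p 0 \<noteq> 0"
  shows "e = 0" "p = single 0 (lookup p 0)"
proof -
  show "e = 0" using assms by (force simp: homogeneous_def in_keys_iff)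
  show "p = single 0 (lookup p 0)"
  proof (rule poly_mapping_eqI)
    fix m
    show "lookup p m = lookup (single 0 (lookup p 0)) m"
    proof (cases "lookup p m = 0")
      case True
      then show ?thesis using assms(2) by (auto simp: lookup_single when_def)
    next
      case False
      then have "int (mon_degree m) = e" using assms(1) by (simp add: homogeneous_def in_keys_iff)
      then have "m = 0" using \<open>e = 0\<close> by (simp add: mon_degree_eq_0_iff)
      then show ?thesis by simp
    qed
  qed
qed

lemma mon_ideal_no_const: "{} \<notin> \<G> \<Longrightarrow> p \<in> mon_ideal V \<G> \<Longrightarrow> lookup p 0 = 0"
proof (rule ccontr)
  assume *: "{} \<notin> \<G>" "p \<in> mon_ideal V \<G>" "lookup p 0 \<noteq> 0"
  then have "0 \<in> keys p" by (simp add: in_keys_iff)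
  with *(2) obtain A where "A \<in> \<G>" "A \<subseteq> keys (0 :: 'a \<Rightarrow>\<^sub>0 nat)" unfolding mon_ideal_def by blast
  with *(1) show False by simp
qed

lemma mon_ideal_const_mult_iff:
  fixes c :: "'k::field"
  shows "c \<noteq> 0 \<Longrightarrow> single 0 c * p \<in> mon_ideal V \<G> \<longleftrightarrow> p \<in> mon_ideal V \<G>"
proof -
  assume "c \<noteq> 0"
  then have "keys (single 0 c * p) = keys p" by (auto simp: in_keys_iff lookup_const_mult)
  then show ?thesis by (simp add: mon_ideal_def poly_ring_def)
qed

text \<open>A unit among the entries of \<open>aug\<close> lets any further generator be cancelled modulo the
  kernel, so minimality forces \<open>F\<^sub>0 = R\<close>.\<close>

lemma resolution_rank_0:
  fixes F :: "('v, 'k::field) resolution"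
  assumes res: "min_graded_free_res V (mon_ideal V \<G>) F" and ne: "{} \<notin> \<G>"
  shows "rnk F 0 = 1" "shift F 0 0 = 0"
    "{g \<in> free_all V (rnk F 0). (\<Sum>a<rnk F 0. vec_fun (aug F) a * g a) \<in> mon_ideal V \<G>}
      = {g \<in> free_all V 1. g 0 \<in> (mon_ideal V \<G> :: ('v, 'k) mpoly set)}"
proof -
  let ?I = "mon_ideal V \<G> :: ('v, 'k) mpoly set"
  let ?n = "rnk F 0" and ?u = "vec_fun (aug F)"
  have gm: "graded_maps V F" and ex: "exact_resolution V ?I F" and mn: "minimal_maps V F"
    using res by (auto simp: min_graded_free_res_def)
  have aug: "aug F \<in> carrier_vec ?n" and bd0: "bd F 0 \<in> carrier_mat ?n (rnk F 1)"
    and u: "\<And>a. a < ?n \<Longrightarrow> ?u a \<in> poly_ring V \<and> homogeneous (shift F 0 a) (?u a)"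
    using gm by (auto simp: graded_maps_def free_mod_def vec_fun_def)
  have E0: "{g \<in> free_all V ?n. (\<Sum>a<?n. ?u a * g a) \<in> ?I} = mat_act (rnk F 1) (mat_fun (bd F 0)) ` free_all V (rnk F 1)"
    using ex unfolding exact_resolution_def exact_augmentation_iff[OF aug bd0, symmetric] by blast
  have "lookup (mat_fun (bd F 0) a b) 0 = 0" for a b
    using mn bd0 by (auto simp: minimal_maps_def mat_fun_def irrelevant_ideal_def)
  \<comment> \<open>The kernel is the image of a matrix with entries in the irrelevant ideal, so its
    elements have no constant terms.\<close>
  then have ker0: "lookup (g a) 0 = 0" if "g \<in> free_all V ?n" "(\<Sum>a<?n. ?u a * g a) \<in> ?I" for g a
    using that E0 mat_act_no_const by (metis (mono_tags, lifting) imageE mem_Collect_eq)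
  \<comment> \<open>Lifting 1 through the augmentation forces some entry of \<open>aug\<close> to
    have a nonzero constant term; being homogeneous, that entry is a constant.\<close>
  have "(1 :: ('v, 'k) mpoly) \<in> poly_ring V" by (simp add: poly_ring_iff lookup_one when_def)
  then obtain f where f: "f \<in> free_mod V ?n" "1 - scalar_prod (aug F) f \<in> ?I"
    using ex unfolding exact_resolution_def by blast
  have "lookup (1 - (\<Sum>a<?n. ?u a * vec_fun f a)) 0 = 0"
    using f mon_ideal_no_const[OF ne] by (metis vec_fun_scalar_prod[OF aug free_mod_carrier])
  then have "(\<Sum>a<?n. lookup (?u a) 0 * lookup (vec_fun f a) 0) = 1"
    by (simp add: lookup_minus lookup_sum lookup_mult_0)
  then have "(\<Sum>a<?n. lookup (?u a) 0 * lookup (vec_fun f a) 0) \<noteq> 0" by simp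
  then obtain a where a: "a \<in> {..<?n}" "lookup (?u a) 0 * lookup (vec_fun f a) 0 \<noteq> 0"
    by (rule sum.not_neutral_contains_not_neutral)
  define c where "c = lookup (?u a) 0"
  have c: "c \<noteq> 0" and an: "a < ?n" using a by (auto simp: c_def)
  have ua: "?u a = single 0 c" "shift F 0 a = 0"
    using homogeneous_const[of "shift F 0 a" "?u a"] u[OF an] c unfolding c_def by blast+
  have only: "b = a" if b: "b < ?n" for b
  proof (rule ccontr)
    assume "b \<noteq> a"
    \<comment> \<open>The basis vector at b, corrected by a multiple of the one at a: the
      augmentation kills it, but its entry at b has constant term 1, against
      \<open>ker0\<close>.\<close>
    define g where "g = (\<lambda>x. if x = b then 1 else if x = a then - (single 0 (inverse c) * ?u b) else 0)"
    have "single 0 (inverse c) * ?u b \<in> poly_ring V"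
      using u[OF b] by (simp add: poly_ring_iff lookup_const_mult)
    then have gf: "g \<in> free_all V ?n" using an b \<open>1 \<in> poly_ring V\<close>
      by (auto simp: free_all_def g_def poly_ring_iff)
    have sum0: "(\<Sum>x<?n. ?u x * g x) = 0"
    proof -
      have "(\<Sum>x<?n. ?u x * g x) = (\<Sum>x\<in>{a, b}. ?u x * g x)"
        using an b by (intro sum.mono_neutral_right) (auto simp: g_def)
      also have "\<dots> = ?u a * g a + ?u b * g b" using \<open>b \<noteq> a\<close> by simp
      also have "\<dots> = ?u b - single 0 c * (single 0 (inverse c) * ?u b)"
        using \<open>b \<noteq> a\<close> unfolding ua(1) by (simp add: g_def)
      also have "single 0 c * (single 0 (inverse c) * ?u b) = ?u b"
        using c by (simp add: mult_single flip: mult.assoc)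
      finally show ?thesis by simp
    qed
    have "(\<Sum>x<?n. ?u x * g x) \<in> ?I" unfolding sum0 by (simp add: mon_ideal_def poly_ring_iff)
    from ker0[OF gf this] have "lookup (g b) 0 = 0" .
    then show False by (simp add: g_def)
  qed
  have "{..<?n} = {a}" using only an by blast
  then have "card {..<?n} = card {a}" by (rule arg_cong)
  then have "?n = 1" by simp
  then have "a = 0" using an by simp
  show "?n = 1" by fact
  show "shift F 0 0 = 0" using ua \<open>a = 0\<close> by simp
  show "{g \<in> free_all V ?n. (\<Sum>a<?n. ?u a * g a) \<in> ?I} = {g \<in> free_all V 1. g 0 \<in> ?I}"
    unfolding \<open>?n = 1\<close> using ua(1) c \<open>a = 0\<close> by (simp add: mon_ideal_const_mult_iff)
qed

context poly_koszul
begin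

lemma resolution_khom:
  fixes F :: "('v, 'k) resolution"
  assumes res: "min_graded_free_res V (mon_ideal V \<G>) F" and ne: "{} \<notin> \<G>"
  shows "khom (ideal_piece V \<G>) i j (card {b\<in>{..<rnk F (Suc i)}. shift F (Suc i) b = j})"
proof -
  let ?I = "mon_ideal V \<G> :: ('v, 'k) mpoly set"
  note r0 = resolution_rank_0[OF res ne]
  have gm: "graded_maps V F" and ex: "exact_resolution V ?I F" and mn: "minimal_maps V F"
    using res by (auto simp: min_graded_free_res_def)
  define n where "n = rnk F"
  \<comment> \<open>At position 0 the twists are replaced by the zero function:
    \<open>shift F 0\<close> is known only at index 0, whereas \<open>ideal_piece\<close> is formed
    with the constant function.\<close>
  define d where "d i = (if i = 0 then (\<lambda>_. 0) else shift F i)" for i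
  define A where "A i = mat_fun (bd F i)" for i
  have bd: "bd F i \<in> carrier_mat (n i) (n (Suc i))" for i using gm by (simp add: graded_maps_def n_def)
  have A: "graded_mat V (n i) (d i) (n (Suc i)) (d (Suc i)) (A i)" for i
    unfolding graded_mat_def
  proof (intro conjI allI impI)
    fix a b assume ab: "a < n i" "b < n (Suc i)"
    then have "hom_in V (shift F (Suc i) b - shift F i a) (bd F i $$ (a, b))"
      using gm by (simp add: graded_maps_def n_def hom_in_iff)
    moreover have "d i a = shift F i a" using ab r0 by (auto simp: d_def n_def)
    ultimately show "hom_in V (d (Suc i) b - d i a) (A i a b)"
      using ab bd[of i] by (auto simp: A_def mat_fun_def d_def)
  next
    fix a b assume "\<not> (a < n i \<and> b < n (Suc i))"
    then show "A i a b = 0" using carrier_matD[OF bd[of i]] by (auto simp: A_def mat_fun_def)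
  qed
  have const: "lookup (A i a b) 0 = 0" for i a b
    using mn bd[of i] by (auto simp: minimal_maps_def A_def mat_fun_def irrelevant_ideal_def n_def)
  \<comment> \<open>\<open>N i\<close> is the module that \<open>A i\<close> covers: the ideal for i
    = 0, and the kernel of the preceding matrix afterwards.\<close>
  define N where "N i = (case i of 0 \<Rightarrow> ideal_piece V \<G> |
     Suc i \<Rightarrow> (\<lambda>j. {g \<in> free_piece V (n (Suc i)) (d (Suc i)) j. mat_act (n (Suc i)) (A i) g = 0}))" for i
  have E: "{g \<in> free_all V (n (Suc i)). mat_act (n (Suc i)) (A i) g = 0} =
      mat_act (n (Suc (Suc i))) (A (Suc i)) ` free_all V (n (Suc (Suc i)))" for i
    using ex unfolding exact_resolution_def A_def exact_kernel_iff[OF bd bd, symmetric] by (simp add: n_def)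
  have E0: "{g \<in> free_all V 1. g 0 \<in> ?I} = mat_act (n 1) (A 0) ` free_all V (n 1)"
  proof -
    have aug: "aug F \<in> carrier_vec (rnk F 0)" using gm by (simp add: graded_maps_def free_mod_def)
    have bd0: "bd F 0 \<in> carrier_mat (rnk F 0) (rnk F 1)" using bd[of 0] by (simp add: n_def)
    have "{g \<in> free_all V (rnk F 0). (\<Sum>a<rnk F 0. vec_fun (aug F) a * g a) \<in> ?I} = mat_act (n 1) (A 0) ` free_all V (n 1)"
      using ex unfolding exact_resolution_def A_def n_def exact_augmentation_iff[OF aug bd0, symmetric] by blast
    then show ?thesis using r0(3) by simp
  qed
  \<comment> \<open>By exactness the element is in the image of the next matrix, whose entries have
    no constant terms.\<close>
  have min: "lookup (g a) 0 = 0"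
    if "g \<in> free_piece V (n (Suc i)) (d (Suc i)) j" "mat_act (n (Suc i)) (A i) g = 0" for g i j a
  proof -
    have "g \<in> {g \<in> free_all V (n (Suc i)). mat_act (n (Suc i)) (A i) g = 0}"
      using that free_piece_subset by blast
    then obtain h where "g = mat_act (n (Suc (Suc i))) (A (Suc i)) h" unfolding E by blast
    then show ?thesis using mat_act_no_const const by metis
  qed
  have zero_free: "0 \<in> free_piece V m e j" for m e j by (simp add: free_piece_alt)
  have img: "mat_act (n (Suc i)) (A i) ` free_piece V (n (Suc i)) (d (Suc i)) j = N i j" for i j
  proof (cases i)
    case 0
    have n0: "n 0 = 1" and d0: "d 0 = (\<lambda>_. 0)" using r0 by (auto simp: n_def d_def)
    have A0: "graded_mat V 1 (\<lambda>_. 0) (n (Suc 0)) (d (Suc 0)) (A 0)" using A[of 0] unfolding n0 d0 .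
    have tot: "mat_act (n (Suc 0)) (A 0) ` free_all V (n (Suc 0)) = all_degrees V 1 (\<lambda>_. 0) (ideal_piece V \<G>)"
      unfolding all_degrees_ideal_piece E0 by simp
    have sub: "ideal_piece V \<G> j \<subseteq> free_piece V 1 (\<lambda>_. 0) j" "0 \<in> ideal_piece V \<G> j" for j
      by (auto simp: ideal_piece_def zero_free mon_ideal_def poly_ring_iff)
    have "\<forall>j. mat_act (n (Suc 0)) (A 0) ` free_piece V (n (Suc 0)) (d (Suc 0)) j = ideal_piece V \<G> j"
      by (rule image_piece_iff_all_degrees[OF A0 sub, THEN iffD2, OF tot])
    then show ?thesis by (simp add: 0 N_def)
  next
    case (Suc l)
    have z: "0 \<in> {g \<in> free_piece V (n (Suc l)) (d (Suc l)) j. mat_act (n (Suc l)) (A l) g = 0}" for j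
      by (simp add: zero_free mat_act_def fun_eq_iff)
    have "\<forall>j. mat_act (n (Suc (Suc l))) (A (Suc l)) ` free_piece V (n (Suc (Suc l))) (d (Suc (Suc l))) j =
       {g \<in> free_piece V (n (Suc l)) (d (Suc l)) j. mat_act (n (Suc l)) (A l) g = 0}"
    proof (rule image_piece_iff_all_degrees[OF A[of "Suc l"] _ z, THEN iffD2])
      show "mat_act (n (Suc (Suc l))) (A (Suc l)) ` free_all V (n (Suc (Suc l))) =
         all_degrees V (n (Suc l)) (d (Suc l)) (\<lambda>j. {g \<in> free_piece V (n (Suc l)) (d (Suc l)) j. mat_act (n (Suc l)) (A l) g = 0})"
        unfolding all_degrees_kernel[OF A[of l]] E ..
    qed blast
    then show ?thesis by (simp add: Suc N_def)
  qed
  have N0: "N 0 = ideal_piece V \<G>" by (simp add: N_def)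
  \<comment> \<open>Each step back along the resolution costs one homological degree, until the
    ideal is reached.\<close>
  have "graded_sub (N i) \<and> (\<forall>p j k. khom (N i) p j k \<longleftrightarrow> khom (N 0) (p + i) j k)" for i
  proof (induction i)
    case 0
    show ?case unfolding N0 using graded_ideal_piece by (simp only: add_0_right simp_thms)
  next
    case (Suc i)
    have NS: "N (Suc i) = (\<lambda>j. {g \<in> free_piece V (n (Suc i)) (d (Suc i)) j. mat_act (n (Suc i)) (A i) g = 0})"
      by (simp add: N_def)
    have NG: "graded_sub (N i)" using Suc by blast
    have "graded_sub (N (Suc i))" unfolding NS
      by (rule graded_kernel[OF A NG img]) (rule min)
    moreover have "khom (N (Suc i)) p j k \<longleftrightarrow> khom (N i) (Suc p) j k" for p j k
      unfolding NS by (rule khom_syzygy[OF A NG img]) (rule min)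
    ultimately show ?case using Suc by (simp only: add_Suc_right add_Suc simp_thms)
  qed
  then have NG: "graded_sub (N i)" and NK: "khom (N i) 0 j k \<longleftrightarrow> khom (N 0) (0 + i) j k" for i j k
    by blast+
  have "khom (N i) 0 j (card {b\<in>{..<n (Suc i)}. d (Suc i) b = j})"
    by (rule khom_generators[OF A NG img]) (rule min)
  then have "khom (N 0) (0 + i) j (card {b\<in>{..<n (Suc i)}. d (Suc i) b = j})" unfolding NK .
  then show ?thesis unfolding N0 n_def d_def by (simp only: add_0 nat.distinct if_False)
qed

end


section \<open>Existence of minimal resolutions\<close>

lemma poly_mapping_sum_single: "p = (\<Sum>m\<in>keys p. single m (lookup p m))"
  by (rule poly_mapping_eqI) (simp add: lookup_sum lookup_single when_def in_keys_iff)

text \<open>Koszul chains of homological degree 0 are concentrated on the empty set; this embeds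
  module elements as such chains.\<close>

definition at_empty :: "(nat \<Rightarrow> ('v, 'k::field) mpoly) \<Rightarrow> 'v set \<Rightarrow> nat \<Rightarrow> ('v, 'k) mpoly" where
  "at_empty z S = (if S = {} then z else 0)"

context poly_koszul
begin

lemma subspace_graded: "graded_sub N \<Longrightarrow> subspace (N j)"
  unfolding graded_sub_def by blast

lemma var_act_mem: "graded_sub N \<Longrightarrow> x \<in> V \<Longrightarrow> g \<in> N j \<Longrightarrow> var_act x g \<in> N (j + 1)"
  unfolding graded_sub_def by blast

text \<open>\<open>graded_sub\<close> provides closure under single variables; induction on the
  degree extends it to monomials.\<close>

lemma monomial_mult_mem:
  assumes N: "graded_sub N" and g: "g \<in> N j" and "keys m \<subseteq> V"
  shows "(\<lambda>a. single m 1 * g a) \<in> N (j + int (mon_degree m))"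
  using assms(3)
proof (induction "mon_degree m" arbitrary: m)
  case 0
  then have "m = 0" by (simp add: mon_degree_eq_0_iff)
  then show ?case using g by simp
next
  case (Suc k)
  then have "m \<noteq> 0" by auto
  then obtain x where x: "x \<in> keys m" by (metis all_not_in_conv keys_eq_empty)
  define m' where "m' = m - single x 1"
  have m: "m = single x 1 + m'"
    using x by (intro poly_mapping_eqI) (auto simp: m'_def lookup_add lookup_minus lookup_single when_def in_keys_iff)
  have deg: "mon_degree m = Suc (mon_degree m')" by (subst m) (simp add: mon_degree_add mon_degree_single)
  have "keys m' \<subseteq> V" "x \<in> V" using Suc.prems x m by (auto simp: keys_plus_nat)
  then have "(\<lambda>a. single m' 1 * g a) \<in> N (j + int (mon_degree m'))"
    using Suc.hyps(1)[of m'] Suc.hyps(2) deg by simp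
  then have "var_act x (\<lambda>a. single m' 1 * g a) \<in> N (j + int (mon_degree m') + 1)"
    using \<open>x \<in> V\<close> by (intro var_act_mem[OF N])
  moreover have "var_act x (\<lambda>a. single m' 1 * g a) = (\<lambda>a. single m 1 * g a)"
    unfolding m by (simp add: var_act_def indet_def mult_single flip: mult.assoc)
  moreover have "j + int (mon_degree m') + 1 = j + int (mon_degree m)" using deg by simp
  ultimately show ?case by simp
qed

lemma hom_mult_mem:
  assumes N: "graded_sub N" and g: "g \<in> N j" and p: "hom_in V e p"
  shows "(\<lambda>a. p * g a) \<in> N (j + e)"
proof -
  have "(\<Sum>m\<in>keys p. vscale (lookup p m) (\<lambda>a. single m 1 * g a)) \<in> N (j + e)"
  proof (intro subspace_sum subspace_scale subspace_graded[OF N])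
    fix m assume "m \<in> keys p"
    then have m: "keys m \<subseteq> V" "int (mon_degree m) = e"
      using p by (auto simp: hom_in_def in_keys_iff monomials_def)
    from monomial_mult_mem[OF N g m(1)] show "(\<lambda>a. single m 1 * g a) \<in> N (j + e)" unfolding m(2) .
  qed
  moreover have "(\<Sum>m\<in>keys p. vscale (lookup p m) (\<lambda>a. single m 1 * g a)) = (\<lambda>a. p * g a)"
  proof
    fix a
    have "(\<Sum>m\<in>keys p. vscale (lookup p m) (\<lambda>a. single m 1 * g a)) a = (\<Sum>m\<in>keys p. single m (lookup p m)) * g a"
      unfolding sum_fun_apply sum_distrib_right
      by (intro sum.cong refl) (simp add: pscale_def mult_single flip: mult.assoc)
    then show "(\<Sum>m\<in>keys p. vscale (lookup p m) (\<lambda>a. single m 1 * g a)) a = p * g a"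
      by (simp flip: poly_mapping_sum_single)
  qed
  ultimately show ?thesis by simp
qed

lemma at_empty_chain: "z \<in> N j \<Longrightarrow> at_empty z \<in> K N 0 j"
  by (auto simp: kchains_def at_empty_def split: if_splits)

lemma chain_0_at_empty:
  assumes "c \<in> K N 0 j" shows "c = at_empty (c {})"
proof
  fix S show "c S = at_empty (c {}) S"
  proof (cases "c S = 0")
    case False
    then have "S \<subseteq> V" "card S = 0" using assms by (auto simp: kchains_def)
    then have "S = {}" using finite_subset[OF _ fin, of S] by simp
    then show ?thesis by (simp add: at_empty_def)
  qed (auto simp: at_empty_def)
qed

lemma cycles_0: "kcycles N 0 j = K N 0 j"
  using D_chain_0 by (auto simp: kcycles_def)

text \<open>A boundary in homological degree 0 is an element of the irrelevant ideal times N,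
  written with one coefficient per variable.\<close>

lemma D_at_empty_pieces:
  assumes N: "graded_sub N" and z: "at_empty z \<in> kbounds N 0 j"
  obtains w where "\<forall>x. w x \<in> N (j - 1)" "z = (\<Sum>x\<in>V. var_act x (w x))"
proof -
  from z obtain c where c: "c \<in> K N (Suc 0) j" "at_empty z = D c" by (auto simp: kbounds_def)
  define w where "w x = vscale (ksign f x {}) (c {x})" for x
  have w: "\<forall>x. w x \<in> N (j - 1)"
    using chain_mem[OF N c(1)] unfolding w_def
    by (intro allI subspace_scale subspace_graded[OF N]) (metis int_ops(2) One_nat_def)
  have "at_empty z {} = D c {}" using c(2) by (rule fun_cong)
  then have "z = D c {}" by (simp add: at_empty_def)
  then have "z = (\<Sum>x\<in>V. var_act x (w x))" unfolding kdiff_def w_def by (simp add: X_scale)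
  with w show thesis by (rule that)
qed

lemma at_empty_linear: "at_empty (z - (\<Sum>i<n. vscale (c i) (b i))) = at_empty z - (\<Sum>i<n. fscale vscale (c i) (at_empty (b i)))"
  by (auto simp: at_empty_def fun_eq_iff sum_fun_apply pscale_def)

text \<open>All chains of homological degree 0 are cycles, so a basis of the homology is a family in
  \<open>N j\<close> that forms a basis modulo the irrelevant ideal times N.\<close>

lemma khom_0_basis:
  assumes N: "graded_sub N" and h: "khom N 0 j k"
  obtains B where "\<And>i. i < k \<Longrightarrow> B i \<in> N j"
    "\<And>z. z \<in> N j \<Longrightarrow> \<exists>c. at_empty (z - (\<Sum>i<k. vscale (c i) (B i))) \<in> kbounds N 0 j"
    "\<And>c. at_empty (\<Sum>i<k. vscale (c i) (B i)) \<in> kbounds N 0 j \<Longrightarrow> \<forall>i<k. c i = 0"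
proof -
  from h obtain b where b: "\<forall>i<k. b i \<in> K N 0 j"
    "\<forall>z\<in>K N 0 j. \<exists>c. z - (\<Sum>i<k. fscale vscale (c i) (b i)) \<in> kbounds N 0 j"
    "\<forall>c. (\<Sum>i<k. fscale vscale (c i) (b i)) \<in> kbounds N 0 j \<longrightarrow> (\<forall>i<k. c i = 0)"
    unfolding khom_def has_qdim_def cycles_0 by (elim exE conjE)
  define B where "B i = b i {}" for i
  have bB: "b i = at_empty (B i)" if "i < k" for i
    unfolding B_def using b(1) that by (intro chain_0_at_empty) auto
  have sum_b: "(\<Sum>i<k. fscale vscale (c i) (b i)) = (\<Sum>i<k. fscale vscale (c i) (at_empty (B i)))" for c
    using bB by (intro sum.cong) auto
  show thesis
  proof (rule that[of B])
    show "B i \<in> N j" if "i < k" for i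
      using b(1) that chain_mem[OF N, of "b i" 0 j "{}"] by (simp add: B_def)
    show "\<exists>c. at_empty (z - (\<Sum>i<k. vscale (c i) (B i))) \<in> kbounds N 0 j" if "z \<in> N j" for z
    proof -
      have "at_empty z \<in> K N 0 j" by (rule at_empty_chain[of z N j, OF that])
      with b(2) obtain c where "at_empty z - (\<Sum>i<k. fscale vscale (c i) (b i)) \<in> kbounds N 0 j" by blast
      then show ?thesis unfolding sum_b at_empty_linear by blast
    qed
    show "\<forall>i<k. c i = 0" if "at_empty (\<Sum>i<k. vscale (c i) (B i)) \<in> kbounds N 0 j" for c
    proof -
      have "at_empty (\<Sum>i<k. vscale (c i) (B i)) = (\<Sum>i<k. fscale vscale (c i) (b i))"
        unfolding sum_b by (auto simp: at_empty_def fun_eq_iff sum_fun_apply pscale_def)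
      then show ?thesis using that b(3) by simp
    qed
  qed
qed

lemma D_mat_act: "D (\<lambda>S. mat_act n A (c S)) = (\<lambda>S. mat_act n A (D c S))"
proof
  fix S
  interpret L: Vector_Spaces.linear vscale vscale "mat_act n A :: (nat \<Rightarrow> ('v, 'k) mpoly) \<Rightarrow> _" by (rule linear_mat_act)
  show "D (\<lambda>S. mat_act n A (c S)) S = mat_act n A (D c S)"
    unfolding kdiff_def L.sum L.scale mat_act_var[symmetric] ..
qed

text \<open>Graded Nakayama: lifts of a basis of \<open>N/\<mm>N\<close> generate \<open>N\<close>, by induction on the degree,
  which is bounded below.\<close>

lemma minimal_cover:
  assumes N: "graded_sub N" "\<And>j. N j \<subseteq> free_piece V n d j"
    and h: "\<And>j. khom N 0 j (h j)" and J: "finite J" "\<And>j. j \<notin> J \<Longrightarrow> h j = 0"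
  obtains n' d' and A :: "nat \<Rightarrow> nat \<Rightarrow> ('v, 'k) mpoly" where "graded_mat V n d n' d' A"
    "\<And>j. mat_act n' A ` free_piece V n' d' j = N j"
    "\<And>g j a. g \<in> free_piece V n' d' j \<Longrightarrow> mat_act n' A g = 0 \<Longrightarrow> a < n' \<Longrightarrow> lookup (g a) 0 = 0"
proof -
  define P where "P j B \<longleftrightarrow> (\<forall>i<h j. B i \<in> N j) \<and>
    (\<forall>z\<in>N j. \<exists>c. at_empty (z - (\<Sum>i<h j. vscale (c i) (B i))) \<in> kbounds N 0 j) \<and>
    (\<forall>c. at_empty (\<Sum>i<h j. vscale (c i) (B i)) \<in> kbounds N 0 j \<longrightarrow> (\<forall>i<h j. c i = 0))" for j B
  have "\<exists>B. P j B" for j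
    unfolding P_def by (rule khom_0_basis[OF N(1) h[of j]], rule exI, intro conjI allI impI ballI) blast+
  then have PB: "P j (SOME B. P j B)" for j by (rule someI_ex)
  define B where "B j = (SOME B. P j B)" for j
  have PB: "P j (B j)" for j unfolding B_def by (rule PB)
  note PB = this[unfolded P_def]
  have BN: "\<And>i j. i < h j \<Longrightarrow> B j i \<in> N j" using PB[THEN conjunct1] by simp
  have span: "\<exists>c. at_empty (z - (\<Sum>i<h j. vscale (c i) (B j i))) \<in> kbounds N 0 j" if "z \<in> N j" for z j
    using PB[of j, THEN conjunct2, THEN conjunct1] that by (rule bspec)
  have indep: "c i = 0" if "at_empty (\<Sum>i<h j. vscale (c i) (B j i)) \<in> kbounds N 0 j" "i < h j" for c i j
    using PB[of j, THEN conjunct2, THEN conjunct2, rule_format, OF that] .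
  \<comment> \<open>Columns are indexed by a degree and a basis index in that degree. Restricting to
    the finite set \<open>J\<close> loses no basis element, as h vanishes elsewhere.\<close>
  define I where "I = Sigma J (\<lambda>j. {..<h j})"
  have finI: "finite I" using J(1) by (simp add: I_def)
  define n' where "n' = card I"
  obtain e where e: "bij_betw e {..<n'} I"
    using ex_bij_betw_nat_finite[OF finI] unfolding n'_def atLeast0LessThan by blast
  define d' where "d' b = fst (e b)" for b
  define col where "col b = B (fst (e b)) (snd (e b))" for b
  define A where "A a b = (if b < n' then col b a else 0)" for a b
  have eI: "e b \<in> I" if "b < n'" for b using e that by (auto simp: bij_betw_def)
  have colN: "col b \<in> N (d' b)" if "b < n'" for b
    using eI[OF that] BN by (auto simp: col_def d'_def I_def)
  have A: "graded_mat V n d n' d' A" unfolding graded_mat_def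
  proof (intro conjI allI impI)
    fix a b assume "a < n" "b < n'"
    then show "hom_in V (d' b - d a) (A a b)" using colN N(2) by (fastforce simp: A_def free_piece_hom)
  next
    fix a b assume *: "\<not> (a < n \<and> b < n')"
    show "A a b = 0"
    proof (cases "b < n'")
      case True
      then have "col b \<in> free_piece V n d (d' b)" using colN N(2) by blast
      then show ?thesis using True * by (simp add: A_def free_piece_hom)
    qed (simp add: A_def)
  qed
  have act: "mat_act n' A g = (\<Sum>b<n'. (\<lambda>a. g b * col b a))" for g
    by (auto simp: mat_act_def A_def fun_eq_iff sum_fun_apply mult.commute intro!: sum.cong)
  have actN: "mat_act n' A g \<in> N j" if "g \<in> free_piece V n' d' j" for g j
    unfolding act
  proof (rule subspace_sum[OF subspace_graded[OF N(1)]])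
    fix b assume "b \<in> {..<n'}"
    then have "hom_in V (j - d' b) (g b)" "col b \<in> N (d' b)" using that colN by (auto simp: free_piece_hom)
    from hom_mult_mem[OF N(1) this(2,1)] show "(\<lambda>a. g b * col b a) \<in> N j" by simp
  qed
  define Im where "Im j = mat_act n' A ` free_piece V n' d' j" for j
  interpret L: Vector_Spaces.linear vscale vscale "mat_act n' A :: (nat \<Rightarrow> ('v, 'k) mpoly) \<Rightarrow> _" by (rule linear_mat_act)
  have subIm: "subspace (Im j)" for j
    unfolding Im_def by (rule L.subspace_image[OF subspace_graded[OF graded_free_piece]])
  have XIm: "var_act x z \<in> Im (j + 1)" if "x \<in> V" "z \<in> Im j" for x z j
  proof -
    from that(2) obtain g where g: "g \<in> free_piece V n' d' j" "z = mat_act n' A g" by (auto simp: Im_def)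
    have "var_act x g \<in> free_piece V n' d' (j + 1)" by (rule var_act_mem[OF graded_free_piece that(1) g(1)])
    then show ?thesis unfolding g(2) Im_def mat_act_var[symmetric] by (rule imageI)
  qed
  have BIm: "B j i \<in> Im j" if i: "i < h j" for i j
  proof -
    have "(j, i) \<in> I" using J(2)[of j] i by (auto simp: I_def)
    then obtain b where b: "b < n'" "e b = (j, i)" using e by (metis bij_betw_iff_bijections lessThan_iff)
    define u :: "nat \<Rightarrow> ('v, 'k) mpoly" where "u b' = (if b' = b then 1 else 0)" for b'
    have "u \<in> free_piece V n' d' j" using b
      by (auto simp: free_piece_hom u_def hom_in_def lookup_one when_def monomials_def d'_def)
    moreover have "mat_act n' A u = B j i"
    proof
      fix a
      have "mat_act n' A u a = (\<Sum>b'<n'. if b' = b then A a b else 0)"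
        unfolding mat_act_def u_def by (intro sum.cong) auto
      then show "mat_act n' A u a = B j i a" using b by (simp add: A_def col_def)
    qed
    ultimately show ?thesis unfolding Im_def by (metis image_eqI)
  qed
  \<comment> \<open>Below the least twist the free module is 0, which starts the induction on
    degrees; 0 is inserted to keep \<open>Min\<close> meaningful for n = 0.\<close>
  define lo where "lo = Min (insert 0 (d ` {..<n}))"
  have lo: "lo \<le> d a" if "a < n" for a using that unfolding lo_def by (intro Min_le) auto
  have N_low: "z = 0" if "z \<in> N j" "j < lo" for z j
  proof
    fix a
    have z: "z \<in> free_piece V n d j" using that N(2) by blast
    show "z a = 0 a"
    proof (rule poly_mapping_eqI, rule ccontr)
      fix m assume "lookup (z a) m \<noteq> lookup (0 a) m"
      then have "lookup (z a) m \<noteq> 0" by simp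
      then have "a < n" "m \<in> monomials V (j - d a)" using z by (auto simp: free_piece_alt)
      then show False using lo[of a] that(2) by (simp add: monomials_def)
    qed
  qed
  have NIm: "N j \<subseteq> Im j" if "j < lo + int t" for t j
    using that
  proof (induction t arbitrary: j)
    case 0
    then have "j < lo" by simp
    then show ?case using N_low[of _ j] subspace_0[OF subIm[of j]] by blast
  next
    case (Suc t)
    show ?case
    proof
      fix z assume "z \<in> N j"
      then obtain c where c: "at_empty (z - (\<Sum>i<h j. vscale (c i) (B j i))) \<in> kbounds N 0 j" using span by blast
      obtain w where w: "\<forall>x. w x \<in> N (j - 1)"
        "z - (\<Sum>i<h j. vscale (c i) (B j i)) = (\<Sum>x\<in>V. var_act x (w x))"
        by (rule D_at_empty_pieces[OF N(1) c])
      have "(\<Sum>x\<in>V. var_act x (w x)) \<in> Im j"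
      proof (rule subspace_sum[OF subIm])
        fix x assume x: "x \<in> V"
        have "N (j - 1) \<subseteq> Im (j - 1)" using Suc.prems by (intro Suc.IH) simp
        then have "var_act x (w x) \<in> Im (j - 1 + 1)" using w(1) by (intro XIm[OF x]) blast
        then show "var_act x (w x) \<in> Im j" by simp
      qed
      moreover have "(\<Sum>i<h j. vscale (c i) (B j i)) \<in> Im j"
        using BIm by (intro subspace_sum subspace_scale subIm) auto
      ultimately have "(\<Sum>x\<in>V. var_act x (w x)) + (\<Sum>i<h j. vscale (c i) (B j i)) \<in> Im j"
        by (rule subspace_add[OF subIm])
      then show "z \<in> Im j" unfolding w(2)[symmetric] by simp
    qed
  qed
  have img: "mat_act n' A ` free_piece V n' d' j = N j" for j
  proof
    show "mat_act n' A ` free_piece V n' d' j \<subseteq> N j" using actN by blast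
    show "N j \<subseteq> mat_act n' A ` free_piece V n' d' j"
      using NIm[of j "nat (j - lo + 1)"] unfolding Im_def by simp
  qed
  have min: "lookup (g a) 0 = 0"
    if g: "g \<in> free_piece V n' d' j" "mat_act n' A g = 0" and a: "a < n'" for g j a
  proof -
    have const: "lookup (g b) 0 = 0" if "\<not> (b < n' \<and> d' b = j)" for b
    proof (rule ccontr)
      assume "lookup (g b) 0 \<noteq> 0"
      then have "b < n'" "0 \<in> monomials V (j - d' b)" using g(1) by (auto simp: free_piece_alt)
      then show False using that by (simp add: monomials_def)
    qed
    show ?thesis
    proof (cases "d' a = j")
      case False
      then show ?thesis using const by simp
    next
      case True
      \<comment> \<open>The constant part of g, supported on the columns of degree j. As g - g0 lies
        in the irrelevant ideal times the free module and g is in the kernel, the image of g0 lies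
        in the irrelevant ideal times N; independence of the chosen basis then kills its
        coefficients.\<close>
      define g0 :: "nat \<Rightarrow> ('v, 'k) mpoly" where "g0 b = single 0 (lookup (g b) 0)" for b
      have g0: "g0 \<in> free_piece V n' d' j"
        unfolding free_piece_alt
      proof (intro CollectI allI impI)
        fix b m assume "lookup (g0 b) m \<noteq> 0"
        then have "m = 0" "lookup (g b) 0 \<noteq> 0" by (auto simp: g0_def lookup_single when_def split: if_splits)
        with const[of b] show "b < n' \<and> m \<in> monomials V (j - d' b)" by (auto simp: monomials_def)
      qed
      have gg: "g - g0 \<in> free_piece V n' d' j"
        by (rule subspace_diff[OF subspace_graded[OF graded_free_piece] g(1) g0])
      have "at_empty (g - g0) \<in> kbounds (free_piece V n' d') 0 j"
      proof (rule free_exact)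
        show "at_empty (g - g0) \<in> K (free_piece V n' d') 0 j" using gg by (rule at_empty_chain[where N = "free_piece V n' d'"])
        then show "D (at_empty (g - g0)) = 0" by (rule D_chain_0)
        show "lookup (at_empty (g - g0) {} a) 0 = 0" for a by (simp add: at_empty_def g0_def lookup_minus)
      qed
      then obtain w where w: "w \<in> K (free_piece V n' d') (Suc 0) j" "at_empty (g - g0) = D w" by (auto simp: kbounds_def)
      have "(\<lambda>S. mat_act n' A (w S)) \<in> K N (Suc 0) j"
        unfolding kchains_def
      proof (intro CollectI allI impI)
        fix S assume "mat_act n' A (w S) \<noteq> 0"
        then have "w S \<noteq> 0" using L.zero by metis
        then have "S \<subseteq> V \<and> card S = Suc 0 \<and> w S \<in> free_piece V n' d' (j - int (Suc 0))"
          using w(1) by (simp add: kchains_def)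
        then show "S \<subseteq> V \<and> card S = Suc 0 \<and> mat_act n' A (w S) \<in> N (j - int (Suc 0))" using actN by blast
      qed
      then have "D (\<lambda>S. mat_act n' A (w S)) \<in> kbounds N 0 j" unfolding kbounds_def by (rule imageI)
      moreover have "D (\<lambda>S. mat_act n' A (w S)) = at_empty (mat_act n' A (g - g0))"
        unfolding D_mat_act w(2)[symmetric] by (auto simp: at_empty_def L.zero)
      ultimately have kb: "at_empty (mat_act n' A (g - g0)) \<in> kbounds N 0 j" by simp
      have "mat_act n' A (g - g0) = - mat_act n' A g0" using g(2) by (simp add: L.diff)
      moreover have "mat_act n' A g0 = (\<Sum>i<h j. vscale (lookup (g (inv_into {..<n'} e (j, i))) 0) (B j i))"
      proof -
        have jJ: "j \<in> J" using eI[OF a] True by (auto simp: I_def d'_def)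
        let ?S = "{b\<in>{..<n'}. d' b = j}"
        have "mat_act n' A g0 = (\<Sum>b<n'. vscale (lookup (g b) 0) (col b))"
          unfolding act by (intro sum.cong refl) (simp add: g0_def fun_eq_iff pscale_def)
        also have "\<dots> = (\<Sum>b\<in>?S. vscale (lookup (g b) 0) (col b))"
        proof (intro sum.mono_neutral_right ballI)
          fix b assume "b \<in> {..<n'} - ?S"
          then have "lookup (g b) 0 = 0" by (intro const) auto
          then show "vscale (lookup (g b) 0) (col b) = 0" by simp
        qed auto
        also have "\<dots> = (\<Sum>i<h j. vscale (lookup (g (inv_into {..<n'} e (j, i))) 0) (B j i))"
        proof (rule sum.reindex_bij_witness[where i = "\<lambda>i. inv_into {..<n'} e (j, i)" and j = "\<lambda>b. snd (e b)"])
          have inj: "inj_on e {..<n'}" and im: "e ` {..<n'} = I" using e by (auto simp: bij_betw_def)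
          fix b assume b: "b \<in> ?S"
          then have eb: "(j, snd (e b)) = e b" by (auto simp: d'_def)
          show inv: "inv_into {..<n'} e (j, snd (e b)) = b" unfolding eb using inj b by (intro inv_into_f_f) auto
          show "snd (e b) \<in> {..<h j}" using eI[of b] b eb[symmetric] by (auto simp: I_def)
          show "vscale (lookup (g (inv_into {..<n'} e (j, snd (e b)))) 0) (B j (snd (e b))) = vscale (lookup (g b) 0) (col b)"
            unfolding inv using b by (simp add: col_def d'_def)
        next
          have im: "e ` {..<n'} = I" using e by (auto simp: bij_betw_def)
          fix i assume "i \<in> {..<h j}"
          then have "(j, i) \<in> e ` {..<n'}" unfolding im using jJ by (simp add: I_def)
          then have *: "e (inv_into {..<n'} e (j, i)) = (j, i)" "inv_into {..<n'} e (j, i) \<in> {..<n'}"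
            by (rule f_inv_into_f, rule inv_into_into)
          then show "snd (e (inv_into {..<n'} e (j, i))) = i" "inv_into {..<n'} e (j, i) \<in> ?S"
            by (simp_all add: d'_def)
        qed
        finally show ?thesis .
      qed
      ultimately have "mat_act n' A (g - g0) = (\<Sum>i<h j. vscale (- lookup (g (inv_into {..<n'} e (j, i))) 0) (B j i))"
        by (simp only: scale_minus_left sum_negf)
      with kb have "at_empty (\<Sum>i<h j. vscale (- lookup (g (inv_into {..<n'} e (j, i))) 0) (B j i)) \<in> kbounds N 0 j" by simp
      from indep[OF this, of "snd (e a)"] have *: "snd (e a) < h j \<Longrightarrow> lookup (g (inv_into {..<n'} e (j, snd (e a)))) 0 = 0" by simp
      have ea: "(j, snd (e a)) = e a" using True by (auto simp: d'_def)
      have "snd (e a) < h j" using eI[OF a] ea[symmetric] by (auto simp: I_def)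
      moreover have "inv_into {..<n'} e (j, snd (e a)) = a"
        unfolding ea using e a by (intro inv_into_f_f) (auto simp: bij_betw_def)
      ultimately show ?thesis using * by simp
    qed
  qed
  show thesis by (rule that[OF A img]) (rule min)
qed

definition ideal_hom :: "'v set set \<Rightarrow> nat \<Rightarrow> int \<Rightarrow> nat" where
  "ideal_hom \<G> p j = (\<Sum>W | W \<subseteq> V \<and> int (card W) = j. sdim {S. S \<subseteq> W \<and> (\<exists>A\<in>\<G>. A \<subseteq> W - S)} p)"

text \<open>Supplies the finite set of degrees that \<open>minimal_cover\<close> asks for: only
  squarefree multidegrees contribute, and their degree is at most \<open>card V\<close>.\<close>

lemma ideal_hom_bounded: "j \<notin> {0..int (card V)} \<Longrightarrow> ideal_hom \<G> p j = 0"
proof -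
  assume j: "j \<notin> {0..int (card V)}"
  have "{W. W \<subseteq> V \<and> int (card W) = j} = {}"
    using j card_mono[OF fin] by fastforce
  then show ?thesis unfolding ideal_hom_def by (simp only: sum.empty)
qed

text \<open>Stage k consists of a rank, its twists and the k-th syzygy module. The invariant
  \<open>P\<close> keeps the Koszul homology known: it is that of the ideal, shifted by k, and so is
  nonzero in finitely many degrees only. This makes the next finite cover possible.\<close>

lemma minimal_resolution_sequence:
  assumes ne: "{} \<notin> \<G>"
  obtains n d and A :: "nat \<Rightarrow> nat \<Rightarrow> nat \<Rightarrow> ('v, 'k) mpoly" where
    "n 0 = 1" "d 0 = (\<lambda>_. 0)" "\<forall>i. graded_mat V (n i) (d i) (n (Suc i)) (d (Suc i)) (A i)"
    "\<forall>i a b. lookup (A i a b) 0 = 0"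
    "mat_act (n 1) (A 0) ` free_all V (n 1) = {g \<in> free_all V 1. g 0 \<in> mon_ideal V \<G>}"
    "\<forall>i. mat_act (n (Suc (Suc i))) (A (Suc i)) ` free_all V (n (Suc (Suc i))) =
        {g \<in> free_all V (n (Suc i)). mat_act (n (Suc i)) (A i) g = 0}"
proof -
  define P where "P k x \<longleftrightarrow> (case x of (n, d, N) \<Rightarrow> graded_sub N \<and> (\<forall>j. N j \<subseteq> free_piece V n d j) \<and>
      (\<forall>j g a. g \<in> N j \<longrightarrow> a < n \<longrightarrow> lookup (g a) 0 = 0) \<and> (\<forall>p j. khom N p j (ideal_hom \<G> (p + k) j)) \<and>
      (k = 0 \<longrightarrow> n = 1 \<and> d = (\<lambda>_. 0) \<and> N = ideal_piece V \<G>))"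
    for k :: nat and x :: "nat \<times> (nat \<Rightarrow> int) \<times> (int \<Rightarrow> (nat \<Rightarrow> ('v, 'k) mpoly) set)"
  define Q where "Q x A y \<longleftrightarrow> (case x of (n, d, N) \<Rightarrow> case y of (n', d', N') \<Rightarrow>
      graded_mat V n d n' d' A \<and> (\<forall>j. mat_act n' A ` free_piece V n' d' j = N j) \<and>
      N' = (\<lambda>j. {g \<in> free_piece V n' d' j. mat_act n' A g = 0}))"
    for x y :: "nat \<times> (nat \<Rightarrow> int) \<times> (int \<Rightarrow> (nat \<Rightarrow> ('v, 'k) mpoly) set)" and A
  have P0: "P 0 (1, \<lambda>_. 0, ideal_piece V \<G>)"
    unfolding P_def prod.case
  proof (intro conjI allI impI refl)
    show "graded_sub (ideal_piece V \<G>)" by (rule graded_ideal_piece)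
    show "ideal_piece V \<G> j \<subseteq> free_piece V 1 (\<lambda>_. 0) j" for j by (auto simp: ideal_piece_def)
    show "lookup (g a) 0 = 0" if "g \<in> ideal_piece V \<G> j" "a < 1" for g j a
      using that mon_ideal_no_const[OF ne, of "g 0" V] by (simp add: ideal_piece_def)
    show "khom (ideal_piece V \<G>) p j (ideal_hom \<G> (p + 0) j)" for p j
      unfolding ideal_hom_def add_0_right by (rule khom_ideal)
  qed
  have step: "\<exists>y. P (Suc k) y \<and> (\<exists>A. Q x A y)" if Px: "P k x" for k x
  proof -
    obtain n d N where x: "x = (n, d, N)" by (cases x)
    from Px have NG: "graded_sub N" and NF: "\<And>j. N j \<subseteq> free_piece V n d j"
      and Nh: "\<And>p j. khom N p j (ideal_hom \<G> (p + k) j)"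
      unfolding P_def x prod.case by blast+
    have Nh0: "khom N 0 j (ideal_hom \<G> k j)" for j using Nh[of 0 j] unfolding add_0 .
    obtain n' d' and A :: "nat \<Rightarrow> nat \<Rightarrow> ('v, 'k) mpoly" where A: "graded_mat V n d n' d' A"
      and img: "\<And>j. mat_act n' A ` free_piece V n' d' j = N j"
      and min: "\<And>g j a. g \<in> free_piece V n' d' j \<Longrightarrow> mat_act n' A g = 0 \<Longrightarrow> a < n' \<Longrightarrow> lookup (g a) 0 = 0"
      using minimal_cover[OF NG NF Nh0 finite_atLeastAtMost_int ideal_hom_bounded] by blast
    define N' where "N' = (\<lambda>j. {g \<in> free_piece V n' d' j. mat_act n' A g = 0})"
    have "P (Suc k) (n', d', N')" unfolding P_def prod.case
    proof (intro conjI allI impI)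
      show "graded_sub N'" unfolding N'_def by (rule graded_kernel[OF A NG img]) (rule min)
      show "N' j \<subseteq> free_piece V n' d' j" for j unfolding N'_def by blast
      show "lookup (g a) 0 = 0" if "g \<in> N' j" "a < n'" for g j a
        using that min unfolding N'_def by blast
      show "khom N' p j (ideal_hom \<G> (p + Suc k) j)" for p j
        unfolding N'_def add_Suc_right add_Suc[symmetric]
        by (rule khom_syzygy[OF A NG img, THEN iffD2, OF _ Nh]) (rule min)
    qed simp_all
    moreover have "Q x A (n', d', N')" using A img unfolding Q_def x prod.case N'_def by blast
    ultimately show ?thesis by blast
  qed
  obtain s where s: "\<forall>k. P k (s k) \<and> (\<exists>A. Q (s k) A (s (Suc k)))"
    using dependent_nat_choice[of P "\<lambda>_ x y. \<exists>A. Q x A y"] P0 step by blast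
  define n d N where "n k = fst (s k)" and "d k = fst (snd (s k))" and "N k = snd (snd (s k))" for k
  have sk: "s k = (n k, d k, N k)" for k by (simp add: n_def d_def N_def)
  define A where "A k = (SOME A. Q (s k) A (s (Suc k)))" for k
  have "Q (s k) (A k) (s (Suc k))" for k unfolding A_def using s by (intro someI_ex[of "\<lambda>A. Q (s k) A (s (Suc k))"]) blast
  then have A: "graded_mat V (n k) (d k) (n (Suc k)) (d (Suc k)) (A k)"
    and img: "\<And>j. mat_act (n (Suc k)) (A k) ` free_piece V (n (Suc k)) (d (Suc k)) j = N k j"
    and NS: "N (Suc k) = (\<lambda>j. {g \<in> free_piece V (n (Suc k)) (d (Suc k)) j. mat_act (n (Suc k)) (A k) g = 0})" for k
    unfolding Q_def sk prod.case by blast+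
  have Pk: "P k (n k, d k, N k)" for k using s unfolding sk by blast
  have NG: "graded_sub (N k)" and NF: "N k j \<subseteq> free_piece V (n k) (d k) j"
    and Nc: "g \<in> N k j \<Longrightarrow> a < n k \<Longrightarrow> lookup (g a) 0 = 0" for k j g a
    using Pk[of k] unfolding P_def prod.case by blast+
  have init: "n 0 = 1" "d 0 = (\<lambda>_. 0)" "N 0 = ideal_piece V \<G>"
    using Pk[of 0] unfolding P_def prod.case by blast+
  have tot: "mat_act (n (Suc k)) (A k) ` free_all V (n (Suc k)) = all_degrees V (n k) (d k) (N k)" for k
    using image_piece_iff_all_degrees[OF A NF subspace_0[OF subspace_graded[OF NG]], THEN iffD1] img by blast
  \<comment> \<open>The image of a basis vector is a column of the matrix and lies in
    \<open>N k\<close>, whose elements have no constant terms by the invariant.\<close>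
  have const: "lookup (A k a b) 0 = 0" for k a b
  proof (cases "a < n k \<and> b < n (Suc k)")
    case False
    then have "A k a b = 0" using A[of k] unfolding graded_mat_def by blast
    then show ?thesis by simp
  next
    case True
    define u :: "nat \<Rightarrow> ('v, 'k) mpoly" where "u b' = (if b' = b then 1 else 0)" for b'
    have "u \<in> free_piece V (n (Suc k)) (d (Suc k)) (d (Suc k) b)" using True
      by (auto simp: free_piece_hom u_def hom_in_def lookup_one when_def monomials_def)
    then have "mat_act (n (Suc k)) (A k) u \<in> N k (d (Suc k) b)" using img by blast
    then have "lookup (mat_act (n (Suc k)) (A k) u a) 0 = 0" using True by (intro Nc) auto
    moreover have "mat_act (n (Suc k)) (A k) u a = (\<Sum>b'<n (Suc k). if b' = b then A k a b else 0)"
      unfolding mat_act_def u_def by (intro sum.cong) auto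
    ultimately show ?thesis using True by simp
  qed
  show thesis
  proof (rule that[of n d A]; (intro allI)?)
    show "mat_act (n 1) (A 0) ` free_all V (n 1) = {g \<in> free_all V 1. g 0 \<in> mon_ideal V \<G>}"
      using tot[of 0] unfolding init all_degrees_ideal_piece by simp
    show "mat_act (n (Suc (Suc i))) (A (Suc i)) ` free_all V (n (Suc (Suc i))) =
        {g \<in> free_all V (n (Suc i)). mat_act (n (Suc i)) (A i) g = 0}" for i
      unfolding tot NS by (rule all_degrees_kernel[OF A])
  qed (rule init(1) init(2) A const)+
qed

lemma minimal_resolution_exists:
  assumes ne: "{} \<notin> \<G>"
  shows "\<exists>F :: ('v, 'k) resolution. min_graded_free_res V (mon_ideal V \<G>) F"
proof -
  obtain n d and A :: "nat \<Rightarrow> nat \<Rightarrow> nat \<Rightarrow> ('v, 'k) mpoly" where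
    init: "n 0 = 1" "d 0 = (\<lambda>_. 0)" and seq: "\<forall>i. graded_mat V (n i) (d i) (n (Suc i)) (d (Suc i)) (A i)"
    "\<forall>i a b. lookup (A i a b) 0 = 0"
    and ex0: "mat_act (n 1) (A 0) ` free_all V (n 1) = {g \<in> free_all V 1. g 0 \<in> mon_ideal V \<G>}"
    and ex': "\<forall>i. mat_act (n (Suc (Suc i))) (A (Suc i)) ` free_all V (n (Suc (Suc i))) =
        {g \<in> free_all V (n (Suc i)). mat_act (n (Suc i)) (A i) g = 0}"
    by (rule minimal_resolution_sequence[OF ne])
  note A = seq(1)[rule_format] and const = seq(2)[rule_format] and ex = ex'[rule_format]
  define F :: "('v, 'k) resolution" where
    "F = \<lparr> rnk = n, shift = d, bd = (\<lambda>i. mat (n i) (n (Suc i)) (\<lambda>(a, b). A i a b)), aug = vec 1 (\<lambda>_. 1) \<rparr>"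
  have F: "rnk F = n" "shift F = d" "bd F i = mat (n i) (n (Suc i)) (\<lambda>(a, b). A i a b)" "aug F = vec 1 (\<lambda>_. 1)" for i
    by (simp_all add: F_def)
  have bd: "bd F i \<in> carrier_mat (n i) (n (Suc i))" for i by (simp add: F)
  have mf: "mat_fun (bd F i) = A i" for i
    using A[of i] by (auto simp: mat_fun_def F graded_mat_def fun_eq_iff)
  have one: "(1 :: ('v, 'k) mpoly) \<in> poly_ring V" "homogeneous 0 (1 :: ('v, 'k) mpoly)"
    by (auto simp: poly_ring_def homogeneous_def)
  have aug: "aug F \<in> carrier_vec 1" by (simp add: F)
  have "graded_maps V F"
    unfolding graded_maps_def
  proof (intro conjI allI impI)
    show "aug F \<in> free_mod V (rnk F 0)" using one by (simp add: F init free_mod_def)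
    show "homogeneous (shift F 0 a) (aug F $ a)" if "a < rnk F 0" for a
      using that one by (simp add: F init)
    show "bd F i \<in> carrier_mat (rnk F i) (rnk F (Suc i))" for i using bd by (simp add: F)
    fix i a b assume ab: "a < rnk F i" "b < rnk F (Suc i)"
    then have "bd F i $$ (a, b) = A i a b" by (simp add: F)
    moreover have "hom_in V (d (Suc i) b - d i a) (A i a b)" using A[of i] ab by (simp add: graded_mat_def F)
    ultimately show "bd F i $$ (a, b) \<in> poly_ring V" "homogeneous (shift F (Suc i) b - shift F i a) (bd F i $$ (a, b))"
      by (simp_all add: hom_in_iff F(2))
  qed
  moreover have "minimal_maps V F"
    unfolding minimal_maps_def irrelevant_ideal_def
  proof (intro allI impI CollectI conjI)
    fix i a b assume ab: "a < rnk F i" "b < rnk F (Suc i)"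
    then have eq: "bd F i $$ (a, b) = A i a b" by (simp add: F)
    show "bd F i $$ (a, b) \<in> poly_ring V" unfolding eq using A[of i] ab by (simp add: graded_mat_def F hom_in_iff)
    show "lookup (bd F i $$ (a, b)) 0 = 0" unfolding eq by (rule const)
  qed
  moreover have "exact_resolution V (mon_ideal V \<G>) F"
    unfolding exact_resolution_def
  proof (intro conjI allI ballI)
    fix p :: "('v, 'k) mpoly" assume p: "p \<in> poly_ring V"
    have "vec 1 (\<lambda>_. p) \<in> free_mod V (rnk F 0)" using p by (simp add: F init free_mod_def)
    moreover have "p - scalar_prod (aug F) (vec 1 (\<lambda>_. p)) \<in> mon_ideal V \<G>"
      by (simp add: F scalar_prod_def mon_ideal_def poly_ring_def)
    ultimately show "\<exists>g\<in>free_mod V (rnk F 0). p - scalar_prod (aug F) g \<in> mon_ideal V \<G>" by blast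
  next
    have "{g \<in> free_all V 1. (\<Sum>a<1. vec_fun (aug F) a * g a) \<in> mon_ideal V \<G>} = mat_act (n 1) (mat_fun (bd F 0)) ` free_all V (n 1)"
      unfolding mf ex0 by (simp add: vec_fun_def F)
    moreover have "bd F 0 \<in> carrier_mat 1 (n 1)" using bd[of 0] init by simp
    ultimately show "{g \<in> free_mod V (rnk F 0). scalar_prod (aug F) g \<in> mon_ideal V \<G>} = (*\<^sub>v) (bd F 0) ` free_mod V (rnk F 1)"
      unfolding F(1) init using exact_augmentation_iff[OF aug] by blast
  next
    fix i
    show "{g \<in> free_mod V (rnk F (Suc i)). bd F i *\<^sub>v g = 0\<^sub>v (rnk F i)} = (*\<^sub>v) (bd F (Suc i)) ` free_mod V (rnk F (Suc (Suc i)))"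
      unfolding F(1) exact_kernel_iff[OF bd bd] mf ex ..
  qed
  ultimately show ?thesis unfolding min_graded_free_res_def by blast
qed

section \<open>Graded Betti numbers of squarefree monomial ideals\<close>

text \<open>Existence makes the resolution picked by \<open>SOME\<close> a minimal one, and
  uniqueness of the dimension of Koszul homology fixes its count. The resolution starts with one
  copy of the ring; from i = 1 on it resolves the ideal, hence \<open>nat i - 1\<close>.\<close>

theorem betti_mon_ideal:
  assumes ne: "{} \<notin> \<G>"
  shows "betti V (mon_ideal V \<G> :: ('v, 'k) mpoly set) i j =
    (if i < 0 then 0 else if i = 0 then (if j = 0 then 1 else 0) else ideal_hom \<G> (nat i - 1) j)"
proof (cases "i < 0")
  case True then show ?thesis by (simp add: betti_def)
next
  case False
  define F :: "('v, 'k) resolution" where "F = (SOME F. min_graded_free_res V (mon_ideal V \<G>) F)"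
  have F: "min_graded_free_res V (mon_ideal V \<G>) F"
    unfolding F_def using minimal_resolution_exists[OF ne] by (rule someI_ex)
  have b: "betti V (mon_ideal V \<G> :: ('v, 'k) mpoly set) i j = card {b. b < rnk F (nat i) \<and> shift F (nat i) b = j}"
    using False unfolding betti_def F_def by (simp add: Let_def)
  show ?thesis
  proof (cases "i = 0")
    case True
    have "{b. b < rnk F 0 \<and> shift F 0 b = j} = (if j = 0 then {0} else {})"
      using resolution_rank_0[OF F ne] by auto
    then show ?thesis using True b by simp
  next
    case i: False
    then obtain k where k: "nat i = Suc k" using False by (metis gr0_implies_Suc linorder_neqE_linordered_idom zero_less_nat_eq)
    have "khom (ideal_piece V \<G>) k j (card {b\<in>{..<rnk F (Suc k)}. shift F (Suc k) b = j})"
      by (rule resolution_khom[OF F ne])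
    moreover have "khom (ideal_piece V \<G>) k j (ideal_hom \<G> k j)"
      unfolding ideal_hom_def by (rule khom_ideal)
    ultimately have "card {b\<in>{..<rnk F (Suc k)}. shift F (Suc k) b = j} = ideal_hom \<G> k j"
      by (rule khom_unique[OF graded_ideal_piece])
    then show ?thesis using i False k b by simp
  qed
qed

end


section \<open>Connected sets of a join\<close>

text \<open>Each monomial of p is assigned to one generator dividing it. As \<open>ideal_gen\<close>
  lists every generator once, the quotients of all monomials with the same generator are collected
  in one coefficient \<open>c s\<close>.\<close>

lemma ideal_gen_squarefree:
  fixes V :: "'v set"
  assumes V: "finite V" and \<G>: "\<G> \<subseteq> Pow V"
  shows "ideal_gen V {(\<Prod>x\<in>A. indet x) | A. A \<in> \<G>} = (mon_ideal V \<G> :: ('v, 'k::field) mpoly set)"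
proof -
  have finA: "finite A" if "A \<in> \<G>" for A using that \<G> V by (meson PowD finite_subset subsetD)
  let ?s = "\<lambda>A. single (sqf_mon A) 1 :: ('v, 'k) mpoly"
  have gens: "{(\<Prod>x\<in>A. indet x) | A. A \<in> \<G>} = ?s ` \<G>"
    using prod_indet[OF finA] by (force simp: image_def)
  show ?thesis unfolding gens
  proof (intro equalityI subsetI)
    fix p :: "('v, 'k) mpoly" assume "p \<in> ideal_gen V (?s ` \<G>)"
    then obtain T c where p: "p = (\<Sum>s\<in>T. c s * s)" and T: "T \<subseteq> ?s ` \<G>" and c: "\<forall>s\<in>T. c s \<in> poly_ring V"
      unfolding ideal_gen_def by blast
    have "keys m \<subseteq> V \<and> (\<exists>A\<in>\<G>. A \<subseteq> keys m)" if "lookup p m \<noteq> 0" for m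
    proof -
      from that obtain s where s: "s \<in> T" "lookup (c s * s) m \<noteq> 0"
        unfolding p lookup_sum by (rule sum.not_neutral_contains_not_neutral)
      then obtain A where A: "A \<in> \<G>" "s = ?s A" using T by blast
      from s(2) obtain m1 m2 where m: "m = m1 + m2" "lookup (c s) m1 \<noteq> 0" "lookup s m2 \<noteq> 0"
        by (rule lookup_mult_neq_0)
      have m2: "m2 = sqf_mon A" using m(3) unfolding A(2) by (auto simp: lookup_single when_def split: if_splits)
      have "keys m1 \<subseteq> V" using c s(1) m(2) by (auto simp: poly_ring_iff)
      moreover have "keys m2 = A" unfolding m2 by (rule keys_sqf_mon[OF finA[OF A(1)]])
      ultimately show ?thesis using A(1) \<G> by (auto simp: m(1) keys_plus_nat)
    qed
    then show "p \<in> mon_ideal V \<G>" by (simp add: mon_ideal_def poly_ring_def in_keys_iff)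
  next
    fix p :: "('v, 'k) mpoly" assume p: "p \<in> mon_ideal V \<G>"
    then have "\<forall>m\<in>keys p. \<exists>B. B \<in> \<G> \<and> B \<subseteq> keys m" unfolding mon_ideal_def by blast
    from bchoice[OF this] obtain A where A': "\<forall>m\<in>keys p. A m \<in> \<G> \<and> A m \<subseteq> keys m" ..
    note A = A'[rule_format]
    define c where "c s = (\<Sum>m | m \<in> keys p \<and> ?s (A m) = s. single (m - sqf_mon (A m)) (lookup p m))" for s
    let ?T = "(\<lambda>m. ?s (A m)) ` keys p"
    have "c s \<in> poly_ring V" for s
      unfolding c_def
    proof (rule poly_ring_sum)
      fix m assume "m \<in> {m \<in> keys p. ?s (A m) = s}"
      then have "keys m \<subseteq> V" using p by (auto simp: mon_ideal_def poly_ring_def)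
      moreover have "keys (m - sqf_mon (A m)) \<subseteq> keys m" by (auto simp: in_keys_iff lookup_minus)
      ultimately show "single (m - sqf_mon (A m)) (lookup p m) \<in> poly_ring V"
        by (auto simp: poly_ring_iff lookup_single when_def split: if_splits)
    qed
    moreover have "p = (\<Sum>s\<in>?T. c s * s)"
    proof -
      have "p = (\<Sum>m\<in>keys p. single m (lookup p m))" by (rule poly_mapping_sum_single)
      also have "\<dots> = (\<Sum>m\<in>keys p. single (m - sqf_mon (A m)) (lookup p m) * ?s (A m))"
        using A by (intro sum.cong refl) (simp add: mult_single minus_sqf_mon_add)
      also have "\<dots> = (\<Sum>s\<in>?T. \<Sum>m | m \<in> keys p \<and> ?s (A m) = s. single (m - sqf_mon (A m)) (lookup p m) * ?s (A m))"
        by (rule sum.image_gen) simp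
      also have "\<dots> = (\<Sum>s\<in>?T. c s * s)"
        unfolding c_def sum_distrib_right by (intro sum.cong refl) simp
      finally show ?thesis .
    qed
    moreover have "finite ?T" "?T \<subseteq> ?s ` \<G>" using A by auto
    ultimately show "p \<in> ideal_gen V (?s ` \<G>)" unfolding ideal_gen_def by blast
  qed
qed

definition conn_sets :: "nat \<Rightarrow> 'v pair_pre_digraph \<Rightarrow> 'v set set" where
  "conn_sets r G = {A. A \<subseteq> pverts G \<and> card A = r + 1 \<and> Digraph_Component.connected (with_proj G \<restriction> A)}"

definition faces :: "nat \<Rightarrow> 'v pair_pre_digraph \<Rightarrow> 'v set set" where
  "faces r G = {T. \<not> (\<exists>A\<in>conn_sets r G. A \<subseteq> T)}"

lemma conn_ideal_eq: "finite (pverts G) \<Longrightarrow> conn_ideal r G = mon_ideal (pverts G) (conn_sets r G)"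
  using ideal_gen_squarefree[of "pverts G" "conn_sets r G"]
  by (simp add: conn_ideal_def conn_sets_def subset_eq)

section \<open>Hochster's formula for graphs\<close>

text \<open>W has no subsets of d + 1 vertices, so every cochain of size d is closed even on the
  full simplex, which is exact. This covers the nonpositive homological degrees of Hochster's
  formula.\<close>

lemma cohdim_low:
  assumes W: "finite W" "inj_on f W" and d: "card W \<le> d" "1 \<le> d"
  shows "cohdim TYPE('k::field) f W \<Delta> d = 0"
proof (rule cohdim_eqI)
  have closed: "codiff f W g T = 0" if g: "\<And>T. g T \<noteq> 0 \<Longrightarrow> card T = d" and T: "T \<subseteq> W"
    for T and g :: "'a set \<Rightarrow> 'k"
  proof (rule ccontr)
    assume nz: "codiff f W g T \<noteq> 0"
    have "finite T" using T W(1) finite_subset by blast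
    with nz obtain x where "g (T - {x}) \<noteq> 0" "card T = Suc (card (T - {x}))" by (rule codiff_support)
    then have "card T = Suc d" using g by simp
    then show False using card_mono[OF W(1) T] d by simp
  qed
  have eq: "cocycles f W \<Delta> d = (coboundaries f W \<Delta> d :: ('a set \<Rightarrow> 'k) set)"
  proof (intro equalityI subsetI)
    fix g :: "'a set \<Rightarrow> 'k" assume g: "g \<in> coboundaries f W \<Delta> d"
    have "codiff f W g T = 0" if "T \<subseteq> W" for T
      using coboundary_cochain(1)[OF W(1) g] that by (intro closed) (auto simp: cochains_def)
    then show "g \<in> cocycles f W \<Delta> d" using coboundary_cochain[OF W(1) g] by (simp add: cocycles_alt)
  next
    fix g :: "'a set \<Rightarrow> 'k" assume g: "g \<in> cocycles f W \<Delta> d"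
    show "g \<in> coboundaries f W \<Delta> d"
    proof (cases "W = {}")
      case True
      have "g = 0"
      proof
        fix T show "g T = 0 T" using g True d by (auto simp: cocycles_def)
      qed
      then show ?thesis using cochain.subspace_0[OF subspace_coboundaries] by simp
    next
      case False
      have "codiff f W g T = 0" if "T \<subseteq> W" for T
        using g that by (intro closed) (auto simp: cocycles_def)
      then have "g \<in> cocycles f W UNIV d" using g by (auto simp: cocycles_def)
      then have "g \<in> coboundaries f W UNIV d" by (rule simplex_exact[OF W False])
      then obtain u where u: "\<forall>T. u T \<noteq> 0 \<longrightarrow> T \<subseteq> W \<and> Suc (card T) = d" "g = face_part W UNIV (codiff f W u)"
        by (rule coboundariesE)
      have "g = face_part W \<Delta> (codiff f W u)"
      proof
        fix T
        show "g T = face_part W \<Delta> (codiff f W u) T"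
        proof (cases "T \<in> \<Delta>")
          case True then show ?thesis unfolding u(2) by (simp add: face_part_def)
        next
          case False
          then have "g T = 0" using g by (auto simp: cocycles_def)
          then show ?thesis using False by (simp add: face_part_def)
        qed
      qed
      then show ?thesis using u(1) by (intro coboundariesI) auto
    qed
  qed
  show "has_qdim (fscale (*)) (cocycles f W \<Delta> d) (coboundaries f W \<Delta> d :: ('a set \<Rightarrow> 'k) set) 0"
    unfolding eq by (rule has_qdim_self[OF vector_space_cochain subspace_coboundaries])
qed

lemma cohdim_cong:
  assumes "\<And>T. T \<subseteq> W \<Longrightarrow> T \<in> \<Delta> \<longleftrightarrow> T \<in> \<Delta>'"
  shows "cohdim TYPE('k::field) f W \<Delta> d = cohdim TYPE('k) f W \<Delta>' d"
proof -
  have "cocycles f W \<Delta> d = (cocycles f W \<Delta>' d :: ('a set \<Rightarrow> 'k) set)"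
    unfolding cocycles_def using assms by (intro Collect_cong) auto
  moreover have "face_part W \<Delta> = (face_part W \<Delta>' :: ('a set \<Rightarrow> 'k) \<Rightarrow> _)"
    using assms by (auto simp: face_part_def fun_eq_iff)
  then have "coboundaries f W \<Delta> d = (coboundaries f W \<Delta>' d :: ('a set \<Rightarrow> 'k) set)"
    unfolding coboundaries_image by simp
  ultimately show ?thesis unfolding cohdim_def by simp
qed

text \<open>Stated for integer i because the join formula uses the indices i - j, which may be
  negative. For i \<le> 0 both sides vanish: the left one because d \<ge> 1, the right one by
  \<open>cohdim_low\<close>.\<close>

lemma graph_betti_hochster:
  fixes G :: "'v pair_pre_digraph"
  assumes fin: "finite (pverts G)" and inj: "inj_on f (pverts G)" and d: "1 \<le> d"
  shows "graph_betti TYPE('k::field) r G i (i + int d) =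
    (\<Sum>W | W \<subseteq> pverts G \<and> int (card W) = i + int d. cohdim TYPE('k) f W (faces r G) d)"
proof -
  let ?V = "pverts G" and ?\<G> = "conn_sets r G"
  interpret poly_koszul ?V f "TYPE('k)" by unfold_locales fact+
  have ne: "{} \<notin> ?\<G>" by (simp add: conn_sets_def)
  have b: "graph_betti TYPE('k) r G i (i + int d) =
    (if i < 0 then 0 else if i = 0 then (if i + int d = 0 then 1 else 0) else ideal_hom ?\<G> (nat i - 1) (i + int d))"
    unfolding graph_betti_def conn_ideal_eq[OF fin] by (rule betti_mon_ideal[OF ne])
  have WV: "finite W" "inj_on f W" if "W \<subseteq> ?V" for W
    using that fin inj finite_subset inj_on_subset by blast+
  show ?thesis
  proof (cases "i \<le> 0")
    case True
    have "cohdim TYPE('k) f W (faces r G) d = 0" if "W \<subseteq> ?V" "int (card W) = i + int d" for W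
      using True that d by (intro cohdim_low WV) auto
    then have "(\<Sum>W | W \<subseteq> ?V \<and> int (card W) = i + int d. cohdim TYPE('k) f W (faces r G) d) = 0"
      by (intro sum.neutral) auto
    then show ?thesis using True d unfolding b by simp
  next
    case False
    have "sdim {S. S \<subseteq> W \<and> (\<exists>A\<in>?\<G>. A \<subseteq> W - S)} (nat i - 1) = cohdim TYPE('k) f W (faces r G) d"
      if W: "W \<subseteq> ?V" "int (card W) = i + int d" for W
    proof -
      have "{S. S \<subseteq> W \<and> (\<exists>A\<in>?\<G>. A \<subseteq> W - S)} = {S. S \<subseteq> W \<and> W - S \<notin> faces r G}"
        by (simp add: faces_def)
      moreover have "sdim {S. S \<subseteq> W \<and> W - S \<notin> faces r G} (nat i - 1) = cohdim TYPE('k) f W (faces r G) d"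
      proof (rule sdim_eq_cohdim[OF W(1)])
        show "W \<noteq> {}" using W(2) False by auto
        show "Suc (nat i - 1) + d = card W" using W(2) False by linarith
        show "T' \<in> faces r G" if "T \<in> faces r G" "T' \<subseteq> T" for T T'
          using that unfolding faces_def by blast
      qed
      ultimately show ?thesis by simp
    qed
    then have "ideal_hom ?\<G> (nat i - 1) (i + int d) = (\<Sum>W | W \<subseteq> ?V \<and> int (card W) = i + int d. cohdim TYPE('k) f W (faces r G) d)"
      unfolding ideal_hom_def by (intro sum.cong) auto
    then show ?thesis using False unfolding b by simp
  qed
qed

section \<open>Induced subgraphs of the join\<close>

lemma pverts_join [simp]: "pverts (graph_join G H) = pverts G \<union> pverts H"
  by (simp add: graph_join_def)

lemma graph_join_commute: "graph_join G H = graph_join H G"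
  by (auto simp: graph_join_def)

lemma induce_join_left:
  assumes "pair_graph G1" "pair_graph G2" "pverts G1 \<inter> pverts G2 = {}" "A \<subseteq> pverts G1"
  shows "with_proj (graph_join G1 G2) \<restriction> A = with_proj G1 \<restriction> A"
proof -
  interpret G1: pair_graph G1 by fact
  interpret G2: pair_graph G2 by fact
  have "{e \<in> parcs (graph_join G1 G2). fst e \<in> A \<and> snd e \<in> A} = {e \<in> parcs G1. fst e \<in> A \<and> snd e \<in> A}"
  proof -
    have "(a, b) \<notin> parcs G2" if "a \<in> A" for a b
      using G2.arc_fst_in_verts[of "(a, b)"] assms(3,4) that by auto
    then show ?thesis using assms(3,4) by (auto simp: graph_join_def)
  qed
  then show ?thesis by (simp add: induce_subgraph_def)
qed

lemma conn_sets_join_left: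
  assumes "pair_graph G1" "pair_graph G2" "pverts G1 \<inter> pverts G2 = {}" "A \<subseteq> pverts G1"
  shows "A \<in> conn_sets r (graph_join G1 G2) \<longleftrightarrow> A \<in> conn_sets r G1"
  using induce_join_left[OF assms] assms(4) by (auto simp: conn_sets_def)

text \<open>Vertices on opposite sides are adjacent, and two on the same side have x or y as a
  common neighbour; so all distances are at most 2.\<close>

lemma connected_join_mixed:
  assumes A: "A \<subseteq> pverts G1 \<union> pverts G2" and x: "x \<in> A" "x \<in> pverts G1" and y: "y \<in> A" "y \<in> pverts G2"
  shows "Digraph_Component.connected (with_proj (graph_join G1 G2) \<restriction> A)"
proof -
  let ?S = "mk_symmetric (with_proj (graph_join G1 G2) \<restriction> A)"
  let ?R = "rtrancl_on A (parcs ?S)"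
  have V: "pverts ?S = A" by simp
  have edge: "(u, v) \<in> parcs ?S" "(v, u) \<in> parcs ?S" if "u \<in> A" "u \<in> pverts G1" "v \<in> A" "v \<in> pverts G2" for u v
  proof -
    have "(u, v) \<in> parcs (graph_join G1 G2)" using that by (simp add: graph_join_def)
    then have "(u, v) \<in> arcs (with_proj (graph_join G1 G2) \<restriction> A)" using that by simp
    then show "(u, v) \<in> parcs ?S" "(v, u) \<in> parcs ?S" unfolding parcs_mk_symmetric by force+
  qed
  have step: "(u, v) \<in> ?R" if "u \<in> A" "(u, v) \<in> parcs ?S" "v \<in> A" for u v
    using that by (intro rtrancl_on_into_rtrancl_on[OF rtrancl_on_refl])
  have step2: "(u, v) \<in> ?R" if "u \<in> A" "(u, w) \<in> parcs ?S" "w \<in> A" "(w, v) \<in> parcs ?S" "v \<in> A" for u v w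
    using that by (intro rtrancl_on_into_rtrancl_on[OF step[of u w]])
  have "(u, v) \<in> ?R" if u: "u \<in> A" and v: "v \<in> A" for u v
  proof -
    consider "u \<in> pverts G1" "v \<in> pverts G1" | "u \<in> pverts G1" "v \<in> pverts G2"
      | "u \<in> pverts G2" "v \<in> pverts G1" | "u \<in> pverts G2" "v \<in> pverts G2" using u v A by blast
    then show ?thesis
      using step[OF u _ v] step2[OF u _ _ _ v] edge x y u v by cases metis+
  qed
  then show ?thesis
    using x(1) unfolding Digraph_Component.connected_def strongly_connected_def reachable_def by auto
qed

lemma sum_subsets_disjoint_union:
  fixes F :: "'v set \<Rightarrow> 'v set \<Rightarrow> 'a::comm_monoid_add"
  assumes fin: "finite V1" "finite V2" and disj: "V1 \<inter> V2 = {}"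
  shows "(\<Sum>W | W \<subseteq> V1 \<union> V2 \<and> card W = N. F (W \<inter> V1) (W \<inter> V2)) =
    (\<Sum>j\<le>N. \<Sum>W2 | W2 \<subseteq> V2 \<and> card W2 = j. \<Sum>W1 | W1 \<subseteq> V1 \<and> card W1 = N - j. F W1 W2)"
proof -
  let ?P = "Sigma {..N} (\<lambda>j. {W2. W2 \<subseteq> V2 \<and> card W2 = j} \<times> {W1. W1 \<subseteq> V1 \<and> card W1 = N - j})"
  have "(\<Sum>j\<le>N. \<Sum>W2 | W2 \<subseteq> V2 \<and> card W2 = j. \<Sum>W1 | W1 \<subseteq> V1 \<and> card W1 = N - j. F W1 W2) =
     (\<Sum>(j, W2, W1)\<in>?P. F W1 W2)"
    using fin by (simp add: sum.Sigma sum.cartesian_product)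
  also have "\<dots> = (\<Sum>W | W \<subseteq> V1 \<union> V2 \<and> card W = N. F (W \<inter> V1) (W \<inter> V2))"
  proof (rule sum.reindex_bij_witness[where i = "\<lambda>W. (card (W \<inter> V2), W \<inter> V2, W \<inter> V1)" and j = "\<lambda>(j, W2, W1). W1 \<union> W2"])
    fix t assume "t \<in> ?P"
    then obtain j W2 W1 where t: "t = (j, W2, W1)" "j \<le> N" "W2 \<subseteq> V2" "card W2 = j" "W1 \<subseteq> V1" "card W1 = N - j" by auto
    have eq: "(W1 \<union> W2) \<inter> V1 = W1" "(W1 \<union> W2) \<inter> V2 = W2" using t disj by blast+
    have "card (W1 \<union> W2) = card W1 + card W2"
      using t fin disj by (intro card_Un_disjoint) (auto intro: finite_subset)
    then show "(case t of (j, W2, W1) \<Rightarrow> W1 \<union> W2) \<in> {W. W \<subseteq> V1 \<union> V2 \<and> card W = N}"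
      using t by auto
    show "(card ((case t of (j, W2, W1) \<Rightarrow> W1 \<union> W2) \<inter> V2), (case t of (j, W2, W1) \<Rightarrow> W1 \<union> W2) \<inter> V2,
        (case t of (j, W2, W1) \<Rightarrow> W1 \<union> W2) \<inter> V1) = t"
      unfolding t(1) prod.case eq using t(4) by simp
    show "F ((case t of (j, W2, W1) \<Rightarrow> W1 \<union> W2) \<inter> V1) ((case t of (j, W2, W1) \<Rightarrow> W1 \<union> W2) \<inter> V2) =
        (case t of (j, W2, W1) \<Rightarrow> F W1 W2)"
      unfolding t(1) prod.case eq ..
  next
    fix W assume "W \<in> {W. W \<subseteq> V1 \<union> V2 \<and> card W = N}"
    then have W: "W \<subseteq> V1 \<union> V2" "card W = N" by auto
    have un: "(W \<inter> V1) \<union> (W \<inter> V2) = W" using W by blast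
    have "card ((W \<inter> V1) \<union> (W \<inter> V2)) = card (W \<inter> V1) + card (W \<inter> V2)"
      using fin disj by (intro card_Un_disjoint) auto
    then have "card (W \<inter> V1) + card (W \<inter> V2) = N" unfolding un using W by simp
    then show "(card (W \<inter> V2), W \<inter> V2, W \<inter> V1) \<in> ?P" by auto
    show "(case (card (W \<inter> V2), W \<inter> V2, W \<inter> V1) of (j, W2, W1) \<Rightarrow> W1 \<union> W2) = W" using un by simp
  qed
  finally show ?thesis ..
qed

text \<open>The complex of the join satisfies \<open>face_join\<close>. Its faces inside one side
  are determined by that graph alone, because the induced subgraphs agree; so the two summands are
  those of the given graphs.\<close>

lemma cohdim_graph_join:
  fixes G1 G2 :: "'v pair_pre_digraph"
  assumes G: "pair_graph G1" "pair_graph G2" "pverts G1 \<inter> pverts G2 = {}" and rd: "1 \<le> r" "r \<le> d"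
    and inj: "inj_on f (pverts G1 \<union> pverts G2)"
    and less: "\<And>x y. x \<in> pverts G1 \<Longrightarrow> y \<in> pverts G2 \<Longrightarrow> f x < f y"
    and W: "W1 \<subseteq> pverts G1" "W2 \<subseteq> pverts G2"
  shows "int (cohdim TYPE('k::field) f (W1 \<union> W2) (faces r (graph_join G1 G2)) d) =
    int (cohdim TYPE('k) f W1 (faces r G1) d) + int (cohdim TYPE('k) f W2 (faces r G2) d) +
    (if d = r then int ((card W1 + card W2 - 1) choose r) - int ((card W1 - 1) choose r) - int ((card W2 - 1) choose r) else 0)"
proof -
  interpret G1: pair_graph G1 by fact
  interpret G2: pair_graph G2 by fact
  let ?\<Delta> = "faces r (graph_join G1 G2)"
  have fin: "finite W1" "finite W2" using W G1.pair_finite_verts G2.pair_finite_verts finite_subset by blast+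
  have disj: "W1 \<inter> W2 = {}" using W G(3) by blast
  have less': "f x < f y" if "x \<in> W1" "y \<in> W2" for x y using that W less by blast
  have down: "T' \<in> ?\<Delta>" if "T \<in> ?\<Delta>" "T' \<subseteq> T" for T T' using that unfolding faces_def by blast
  interpret face_join f W1 W2 ?\<Delta> r "1 :: 'k" "(- 1) ^ card W1"
  proof
    show "finite W1" "finite W2" "W1 \<inter> W2 = {}" "1 \<le> r" by fact+
    show "inj_on f (W1 \<union> W2)" using inj W by (meson Un_mono inj_on_subset)
    show "ksign f x (W1 \<union> W2 - T) = (1 * ksign f x (W1 - T) :: 'k)" if "x \<in> T" "T \<subseteq> W1" for x T
      by (rule ksign_join(1)[OF fin less' that])
    show "ksign f x (W1 \<union> W2 - T) = ((- 1) ^ card W1 * ksign f x (W2 - T) :: 'k)" if "x \<in> T" "T \<subseteq> W2" for x T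
      by (rule ksign_join(2)[OF fin less' that])
    show "T \<in> ?\<Delta>" if T: "T \<subseteq> W1 \<union> W2" "card T \<le> r" for T
    proof -
      have "finite T" using T(1) fin finite_subset by blast
      then have "card A \<noteq> r + 1" if "A \<subseteq> T" for A using card_mono[of T A] that T(2) by simp
      then show ?thesis unfolding faces_def conn_sets_def by blast
    qed
    show "T \<subseteq> W1 \<or> T \<subseteq> W2" if T: "T \<in> ?\<Delta>" "T \<subseteq> W1 \<union> W2" "r < card T" for T
    proof (rule ccontr)
      assume "\<not> (T \<subseteq> W1 \<or> T \<subseteq> W2)"
      then obtain x y where xy: "x \<in> T" "x \<in> W1" "y \<in> T" "y \<in> W2" using T(2) by blast
      have fT: "finite T" using T(2) fin finite_subset by blast
      \<comment> \<open>Since r \<ge> 1, one vertex from each side can be enlarged within T to r + 1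
        vertices; this mixed set is connected, so T is not a face.\<close>
      have "card {x, y} \<le> r + 1" using rd(1) by (simp add: card_insert_if)
      then obtain A where A: "{x, y} \<subseteq> A" "A \<subseteq> T" "card A = r + 1"
        using exists_subset_between[of "{x, y}" "r + 1" T] xy T(3) fT by auto
      have AV: "A \<subseteq> pverts G1 \<union> pverts G2" using A T(2) W by blast
      have "Digraph_Component.connected (with_proj (graph_join G1 G2) \<restriction> A)"
        by (rule connected_join_mixed[OF AV, of x y]) (use A xy W in auto)
      then have "A \<in> conn_sets r (graph_join G1 G2)" using AV A(3) by (simp add: conn_sets_def)
      then show False using T(1) A(2) unfolding faces_def by blast
    qed
  qed simp_all
  have f1: "cohdim TYPE('k) f W1 ?\<Delta> d = cohdim TYPE('k) f W1 (faces r G1) d"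
  proof (rule cohdim_cong)
    fix T assume "T \<subseteq> W1"
    then have "A \<in> conn_sets r (graph_join G1 G2) \<longleftrightarrow> A \<in> conn_sets r G1" if "A \<subseteq> T" for A
      using conn_sets_join_left[OF G] that W by (meson order_trans)
    then show "T \<in> ?\<Delta> \<longleftrightarrow> T \<in> faces r G1" unfolding faces_def by blast
  qed
  have f2: "cohdim TYPE('k) f W2 ?\<Delta> d = cohdim TYPE('k) f W2 (faces r G2) d"
  proof (rule cohdim_cong)
    fix T assume "T \<subseteq> W2"
    have G': "pverts G2 \<inter> pverts G1 = {}" using G(3) by blast
    have "A \<in> conn_sets r (graph_join G1 G2) \<longleftrightarrow> A \<in> conn_sets r G2" if "A \<subseteq> T" for A
      using conn_sets_join_left[OF G(2,1) G'] that W \<open>T \<subseteq> W2\<close> unfolding graph_join_commute[of G1] by (meson order_trans)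
    then show "T \<in> ?\<Delta> \<longleftrightarrow> T \<in> faces r G2" unfolding faces_def by blast
  qed
  have card: "card (W1 \<union> W2) = card W1 + card W2" using fin disj by (rule card_Un_disjoint)
  show ?thesis
  proof (cases "d = r")
    case True
    then show ?thesis using cohdim_join_critical f1 f2 unfolding card by simp
  next
    case False
    then have "cohdim TYPE('k) f (W1 \<union> W2) ?\<Delta> d = cohdim TYPE('k) f W1 ?\<Delta> d + cohdim TYPE('k) f W2 ?\<Delta> d"
      using rd by (intro cohdim_join_high) (auto intro: down)
    then show ?thesis using False f1 f2 by simp
  qed
qed

theorem theorem1p1:
  fixes G1 G2 :: "'v pair_pre_digraph" and n m r i d :: nat
  assumes "pair_graph G1" and "pair_graph G2"
    and "pverts G1 \<inter> pverts G2 = {}"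
    and "card (pverts G1) = n" and "card (pverts G2) = m"
    and "r \<ge> 1"
  shows "(d = r \<longrightarrow>
      int (graph_betti TYPE('k::field) r (graph_join G1 G2) (int i) (int i + int d)) =
        (\<Sum>j = 0..i + d - 1.
            int (m choose j) * int (graph_betti TYPE('k) r G1 (int i - int j) (int i - int j + int d))
          + int (n choose j) * int (graph_betti TYPE('k) r G2 (int i - int j) (int i - int j + int d)))
        + (\<Sum>j = 1..i + d - 1.
            (int ((i + d - 1) choose d) - int ((i + d - 1 - j) choose d) - int ((j - 1) choose d))
            * int (m choose j) * int (n choose (i + d - j)))) \<and>
    (d \<ge> r + 1 \<longrightarrow>
      int (graph_betti TYPE('k) r (graph_join G1 G2) (int i) (int i + int d)) =
        (\<Sum>j = 0..i + d - 1.
            int (m choose j) * int (graph_betti TYPE('k) r G1 (int i - int j) (int i - int j + int d))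
          + int (n choose j) * int (graph_betti TYPE('k) r G2 (int i - int j) (int i - int j + int d))))"
proof -
  interpret G1: pair_graph G1 by fact
  interpret G2: pair_graph G2 by fact
  let ?V1 = "pverts G1" and ?V2 = "pverts G2" and ?N = "i + d"
  note fin = G1.pair_finite_verts G2.pair_finite_verts
  obtain f1 :: "'v \<Rightarrow> nat" where f1: "inj_on f1 ?V1" using finite_imp_inj_to_nat_seg[OF fin(1)] by blast
  obtain f2 :: "'v \<Rightarrow> nat" where f2: "inj_on f2 ?V2" using finite_imp_inj_to_nat_seg[OF fin(2)] by blast
  \<comment> \<open>The numbering lists the first graph before the second, as the comparison of
    signs requires; the offset exceeds every value of \<open>f1\<close>.\<close>
  define f where "f x = (if x \<in> ?V1 then f1 x else Suc (Max (f1 ` ?V1) + f2 x))" for x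
  have less: "f x < f y" if "x \<in> ?V1" "y \<in> ?V2" for x y
  proof -
    have "f1 x \<le> Max (f1 ` ?V1)" using that fin by (intro Max_ge) auto
    then have "f1 x < Suc (Max (f1 ` ?V1) + f2 y)" by linarith
    moreover have "f x = f1 x" "f y = Suc (Max (f1 ` ?V1) + f2 y)" using that assms(3) by (auto simp: f_def)
    ultimately show ?thesis by (simp only:)
  qed
  have inj: "inj_on f (?V1 \<union> ?V2)"
  proof (rule inj_onI)
    fix x y assume xy: "x \<in> ?V1 \<union> ?V2" "y \<in> ?V1 \<union> ?V2" "f x = f y"
    consider "x \<in> ?V1" "y \<in> ?V1" | "x \<in> ?V1" "y \<in> ?V2" | "x \<in> ?V2" "y \<in> ?V1" | "x \<in> ?V2" "y \<in> ?V2" using xy by blast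
    then show "x = y"
    proof cases
      case 1 then show ?thesis using xy(3) f1 by (simp add: f_def inj_on_def)
    next
      case 2 then show ?thesis using less[of x y] xy(3) by simp
    next
      case 3 then show ?thesis using less[of y x] xy(3) by simp
    next
      case 4
      then have "x \<notin> ?V1" "y \<notin> ?V1" using assms(3) by auto
      then show ?thesis using 4 xy(3) f2 by (simp add: f_def inj_on_def)
    qed
  qed
  have inj12: "inj_on f ?V1" "inj_on f ?V2" using inj by (auto intro: inj_on_subset)
  define h1 where "h1 W = int (cohdim TYPE('k) f W (faces r G1) d)" for W
  define h2 where "h2 W = int (cohdim TYPE('k) f W (faces r G2) d)" for W
  \<comment> \<open>The correction for a set with a vertices in the first graph and b in the second,
    present only for d = r.\<close>
  define e where "e a b = (if d = r then int ((a + b - 1) choose r) - int ((a - 1) choose r) - int ((b - 1) choose r) else 0)"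
    for a b :: nat
  have main: "int (graph_betti TYPE('k) r (graph_join G1 G2) (int i) (int i + int d)) =
      (\<Sum>j = 0..i + d - 1.
            int (m choose j) * int (graph_betti TYPE('k) r G1 (int i - int j) (int i - int j + int d))
          + int (n choose j) * int (graph_betti TYPE('k) r G2 (int i - int j) (int i - int j + int d)))
      + (\<Sum>j = 1..i + d - 1. e (?N - j) j * int (m choose j) * int (n choose (i + d - j)))"
    if d: "r \<le> d"
  proof -
    have d1: "1 \<le> d" using d assms(6) by simp
    have b1: "int (graph_betti TYPE('k) r G1 (int i - int j) (int i - int j + int d)) = (\<Sum>W | W \<subseteq> ?V1 \<and> card W = ?N - j. h1 W)"
      if "j \<le> ?N" for j
    proof -
      have "int (card W) = int i - int j + int d \<longleftrightarrow> card W = ?N - j" for W :: "'v set" using that by linarith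
      then show ?thesis unfolding graph_betti_hochster[OF fin(1) inj12(1) d1] h1_def by simp
    qed
    have b2: "int (graph_betti TYPE('k) r G2 (int i - int j) (int i - int j + int d)) = (\<Sum>W | W \<subseteq> ?V2 \<and> card W = ?N - j. h2 W)"
      if "j \<le> ?N" for j
    proof -
      have "int (card W) = int i - int j + int d \<longleftrightarrow> card W = ?N - j" for W :: "'v set" using that by linarith
      then show ?thesis unfolding graph_betti_hochster[OF fin(2) inj12(2) d1] h2_def by simp
    qed
    \<comment> \<open>The index j = i + d belongs to homological degree -d, which is negative; so
      the sums may stop at i + d - 1.\<close>
    have z1: "int (graph_betti TYPE('k) r G1 (int i - int ?N) (int i - int ?N + int d)) = 0"
      unfolding graph_betti_def betti_def using d1 by simp
    have z2: "int (graph_betti TYPE('k) r G2 (int i - int ?N) (int i - int ?N + int d)) = 0"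
      unfolding graph_betti_def betti_def using d1 by simp
    have n1: "card {W. W \<subseteq> ?V1 \<and> card W = j} = n choose j" for j using n_subsets[OF fin(1)] assms(4) by simp
    have n2: "card {W. W \<subseteq> ?V2 \<and> card W = j} = m choose j" for j using n_subsets[OF fin(2)] assms(5) by simp
    have iff: "int (card W) = int i + int d \<longleftrightarrow> card W = ?N" for W :: "'v set" by linarith
    have "int (graph_betti TYPE('k) r (graph_join G1 G2) (int i) (int i + int d)) =
       (\<Sum>W | W \<subseteq> ?V1 \<union> ?V2 \<and> card W = ?N. int (cohdim TYPE('k) f W (faces r (graph_join G1 G2)) d))"
      using graph_betti_hochster[of "graph_join G1 G2" f d r "int i", where 'k = 'k] fin inj d1 unfolding iff by simp
    also have "\<dots> = (\<Sum>W | W \<subseteq> ?V1 \<union> ?V2 \<and> card W = ?N.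
        h1 (W \<inter> ?V1) + h2 (W \<inter> ?V2) + e (card (W \<inter> ?V1)) (card (W \<inter> ?V2)))"
    proof (rule sum.cong[OF refl])
      fix W assume "W \<in> {W. W \<subseteq> ?V1 \<union> ?V2 \<and> card W = ?N}"
      then have "(W \<inter> ?V1) \<union> (W \<inter> ?V2) = W" by blast
      then show "int (cohdim TYPE('k) f W (faces r (graph_join G1 G2)) d) =
          h1 (W \<inter> ?V1) + h2 (W \<inter> ?V2) + e (card (W \<inter> ?V1)) (card (W \<inter> ?V2))"
        using cohdim_graph_join[OF assms(1-3,6) d inj less Int_lower2 Int_lower2, of W W, where 'k = 'k]
        unfolding h1_def h2_def e_def by simp
    qed
    also have "\<dots> = (\<Sum>j\<le>?N. \<Sum>W2 | W2 \<subseteq> ?V2 \<and> card W2 = j. \<Sum>W1 | W1 \<subseteq> ?V1 \<and> card W1 = ?N - j.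
        h1 W1 + h2 W2 + e (card W1) (card W2))"
      by (rule sum_subsets_disjoint_union[OF fin assms(3)])
    also have "\<dots> = (\<Sum>j\<le>?N. int (m choose j) * int (graph_betti TYPE('k) r G1 (int i - int j) (int i - int j + int d))
        + int (n choose (?N - j)) * (\<Sum>W | W \<subseteq> ?V2 \<and> card W = j. h2 W)
        + e (?N - j) j * int (m choose j) * int (n choose (?N - j)))"
    proof (rule sum.cong[OF refl])
      fix j assume "j \<in> {..?N}"
      then have j: "j \<le> ?N" by simp
      have "(\<Sum>W2 | W2 \<subseteq> ?V2 \<and> card W2 = j. \<Sum>W1 | W1 \<subseteq> ?V1 \<and> card W1 = ?N - j. h1 W1 + h2 W2 + e (card W1) (card W2)) =
        (\<Sum>W2 | W2 \<subseteq> ?V2 \<and> card W2 = j. \<Sum>W1 | W1 \<subseteq> ?V1 \<and> card W1 = ?N - j. h1 W1 + h2 W2 + e (?N - j) j)"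
        by (intro sum.cong refl) auto
      also have "\<dots> = int (m choose j) * (\<Sum>W1 | W1 \<subseteq> ?V1 \<and> card W1 = ?N - j. h1 W1)
        + int (n choose (?N - j)) * (\<Sum>W | W \<subseteq> ?V2 \<and> card W = j. h2 W)
        + e (?N - j) j * int (m choose j) * int (n choose (?N - j))"
        by (simp add: sum.distrib n1 n2 sum_distrib_left mult_ac)
      finally show "(\<Sum>W2 | W2 \<subseteq> ?V2 \<and> card W2 = j. \<Sum>W1 | W1 \<subseteq> ?V1 \<and> card W1 = ?N - j. h1 W1 + h2 W2 + e (card W1) (card W2)) =
        int (m choose j) * int (graph_betti TYPE('k) r G1 (int i - int j) (int i - int j + int d))
        + int (n choose (?N - j)) * (\<Sum>W | W \<subseteq> ?V2 \<and> card W = j. h2 W)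
        + e (?N - j) j * int (m choose j) * int (n choose (?N - j))" unfolding b1[OF j] .
    qed
    also have "\<dots> = (\<Sum>j\<le>?N. int (m choose j) * int (graph_betti TYPE('k) r G1 (int i - int j) (int i - int j + int d)))
        + (\<Sum>j\<le>?N. int (n choose (?N - j)) * (\<Sum>W | W \<subseteq> ?V2 \<and> card W = j. h2 W))
        + (\<Sum>j\<le>?N. e (?N - j) j * int (m choose j) * int (n choose (?N - j)))"
      by (simp only: sum.distrib)
    \<comment> \<open>For the second graph the summation index is reversed: j then counts the
      vertices taken from the first graph.\<close>
    also have "(\<Sum>j\<le>?N. int (n choose (?N - j)) * (\<Sum>W | W \<subseteq> ?V2 \<and> card W = j. h2 W)) =
        (\<Sum>j\<le>?N. int (n choose j) * int (graph_betti TYPE('k) r G2 (int i - int j) (int i - int j + int d)))"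
    proof -
      have "(\<Sum>j\<le>?N. int (n choose (?N - j)) * (\<Sum>W | W \<subseteq> ?V2 \<and> card W = j. h2 W)) =
          (\<Sum>j\<le>?N. int (n choose j) * (\<Sum>W | W \<subseteq> ?V2 \<and> card W = ?N - j. h2 W))"
        by (rule sum.reindex_bij_witness[where i = "\<lambda>j. ?N - j" and j = "\<lambda>j. ?N - j"]) auto
      also have "\<dots> = (\<Sum>j\<le>?N. int (n choose j) * int (graph_betti TYPE('k) r G2 (int i - int j) (int i - int j + int d)))"
        using b2 by (intro sum.cong refl) (simp only: atMost_iff)
      finally show ?thesis .
    qed
    also have "(\<Sum>j\<le>?N. int (m choose j) * int (graph_betti TYPE('k) r G1 (int i - int j) (int i - int j + int d))) =
        (\<Sum>j = 0..?N - 1. int (m choose j) * int (graph_betti TYPE('k) r G1 (int i - int j) (int i - int j + int d)))"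
      using d1 z1 by (intro sum.mono_neutral_right) (auto simp: not_le Suc_le_eq dest!: le_neq_implies_less)
    also have "(\<Sum>j\<le>?N. int (n choose j) * int (graph_betti TYPE('k) r G2 (int i - int j) (int i - int j + int d))) =
        (\<Sum>j = 0..?N - 1. int (n choose j) * int (graph_betti TYPE('k) r G2 (int i - int j) (int i - int j + int d)))"
      using d1 z2 by (intro sum.mono_neutral_right) (auto simp: not_le Suc_le_eq dest!: le_neq_implies_less)
    also have "(\<Sum>j\<le>?N. e (?N - j) j * int (m choose j) * int (n choose (?N - j))) =
        (\<Sum>j = 1..?N - 1. e (?N - j) j * int (m choose j) * int (n choose (?N - j)))"
    proof (intro sum.mono_neutral_right ballI)
      fix j assume "j \<in> {..?N} - {1..?N - 1}"
      then have "j = 0 \<or> j = ?N" by auto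
      \<comment> \<open>With no vertices on one side two binomials cancel, and the third is
        \<open>0 choose r\<close> with r positive.\<close>
      then have "e (?N - j) j = 0" using assms(6) by (auto simp: e_def binomial_eq_0)
      then show "e (?N - j) j * int (m choose j) * int (n choose (?N - j)) = 0" by simp
    qed auto
    finally show ?thesis by (simp only: sum.distrib)
  qed
  have e_eq: "e (?N - j) j = int ((i + d - 1) choose d) - int ((i + d - 1 - j) choose d) - int ((j - 1) choose d)"
    if "d = r" "j \<in> {1..i + d - 1}" for j
  proof -
    have "?N - j + j - 1 = i + d - 1" "?N - j - 1 = i + d - 1 - j" using that by auto
    then show ?thesis using that(1) by (simp add: e_def)
  qed
  show ?thesis
  proof (intro conjI impI)
    assume dr: "d = r"
    have e_sum: "(\<Sum>j = 1..i + d - 1. e (?N - j) j * int (m choose j) * int (n choose (i + d - j))) =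
        (\<Sum>j = 1..i + d - 1.
            (int ((i + d - 1) choose d) - int ((i + d - 1 - j) choose d) - int ((j - 1) choose d))
            * int (m choose j) * int (n choose (i + d - j)))"
      by (rule sum.cong[OF refl]) (simp only: e_eq[OF dr])
    have "r \<le> d" using dr by simp
    from main[OF this] show "int (graph_betti TYPE('k) r (graph_join G1 G2) (int i) (int i + int d)) =
        (\<Sum>j = 0..i + d - 1.
            int (m choose j) * int (graph_betti TYPE('k) r G1 (int i - int j) (int i - int j + int d))
          + int (n choose j) * int (graph_betti TYPE('k) r G2 (int i - int j) (int i - int j + int d)))
        + (\<Sum>j = 1..i + d - 1.
            (int ((i + d - 1) choose d) - int ((i + d - 1 - j) choose d) - int ((j - 1) choose d))
            * int (m choose j) * int (n choose (i + d - j)))"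
      unfolding e_sum .
  next
    assume "d \<ge> r + 1"
    then show "int (graph_betti TYPE('k) r (graph_join G1 G2) (int i) (int i + int d)) =
        (\<Sum>j = 0..i + d - 1.
            int (m choose j) * int (graph_betti TYPE('k) r G1 (int i - int j) (int i - int j + int d))
          + int (n choose j) * int (graph_betti TYPE('k) r G2 (int i - int j) (int i - int j + int d)))"
      using main by (simp add: e_def)
  qed
qed

end
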